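(* Let $X:S^3\cong SU(2)\to\mathbb{C}$ be a square integrable random field on a probability space $\Omega$. Then $X$ can be decomposed as a sum of random fields $X^\ell_{\bullet,s}$, for $\ell\in\frac12\mathbb{N}$ and $s\in\{-\ell,-\ell+1,\dots,\ell\}$, $$X=\sum_{\ell\in\frac12\mathbb{N}}\ \sum_{s=-\ell}^{\ell}X^\ell_{\bullet,s},\qquad X^\ell_{\bullet,s}=\sum_{m=-\ell}^{\ell}a^\ell_{m,s}\phi^\ell_{m,s},$$ where the $a^\ell_{m,s}$ are complex random variables and the series converges almost surely in $L^2(S^3)$. Each $X^\ell_{\bullet,s}$ is a random (complex-valued) homogeneous harmonic polynomial on $\mathbb{R}^4$ of degree $2\ell$ restricted to the sphere, i.e. an eigenfunction of the Laplace–Beltrami operator of the 3-sphere of radius 2 with eigenvalue $-\ell(\ell+1)$, and, at the same time, it is the pull-back of a section of the spin $s$ bundle $\mathcal{T}^{\otimes s}\to S^2$, i.e. a random spin weighted function on $S^2$ with spin weight $s$.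
   Context: $\frac12\mathbb{N}=\{0,\frac12,1,\dots\}$; $m,s\in\{-\ell,-\ell+1,\dots,\ell\}$. Elements of $SU(2)$ are $h(\alpha,\beta)=\begin{pmatrix}\alpha&-\overline\beta\\ \beta&\overline\alpha\end{pmatrix}$, $|\alpha|^2+|\beta|^2=1$, identified with points $(\alpha,\beta)\in\mathbb{C}^2=\mathbb{R}^4$; $SU(2)\cong S^3$ carries the round metric of radius 2 (volume $16\pi^2$). Wigner functions: with $\psi^\ell_m(z_0,z_1)=\binom{2\ell}{\ell+m}^{1/2}z_0^{\ell+m}z_1^{\ell-m}$, $D^\ell_{m,s}:SU(2)\to\mathbb{C}$ is defined by $\sum_m\psi^\ell_m(z_0,z_1)D^\ell_{m,s}(h(\alpha,\beta))=\psi^\ell_s(\overline\alpha z_0+\overline\beta z_1,-\beta z_0+\alpha z_1)$ for all $z_0,z_1\in\mathbb{C}$, and $\phi^\ell_{m,s}=\frac{\sqrt{2\ell+1}}{4\pi}D^\ell_{m,s}$. A square integrable random field is a jointly measurable $X:\Omega\times SU(2)\to\mathbb{C}$ with $X(\omega,\cdot)\in L^2(SU(2))$ almost surely. Spin bundles: $\mathcal{T}^{\otimes\frac12}\to\mathbb{CP}^1\cong S^2$ is the tautological complex line bundle (fibre over a line $L\subset\mathbb{C}^2$ is $L$), and for $s\in\frac12\mathbb{Z}$, $\mathcal{T}^{\otimes s}=(\mathcal{T}^{\otimes\frac12})^{\otimes 2s}$ (negative powers are powers of the dual; for $v\neq0$, $v^{\otimes(-1)}$ is the dual element with $\langle v^{\otimes(-1)},v\rangle=1$).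 For $g=h(\alpha,\beta)\in SU(2)$ let $g\cdot\infty=[\alpha:\beta]\in\mathbb{CP}^1$ and $\tau_g=(\alpha,\beta)^T\in\mathcal{T}^{\otimes\frac12}_{g\cdot\infty}$. The pull-back of a section $\sigma$ of $\mathcal{T}^{\otimes s}$ is the function $F_\sigma:SU(2)\to\mathbb{C}$ with $\sigma(g\cdot\infty)=F_\sigma(g)(\tau_g)^{\otimes 2s}$; pull-backs of sections of $\mathcal{T}^{\otimes s}$ are exactly the functions $F$ with $F(g\cdot g_3(\psi))=F(g)e^{-is\psi}$ for all $\psi\in\mathbb{R}$, where $g_3(\psi)=\mathrm{diag}(e^{i\psi/2},e^{-i\psi/2})$. *)

theory Defs
  imports "HOL-Probability.Probability"
begin

section \<open>SU(2) and the round 3-sphere of radius 2\<close>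

definition su2_mat :: "complex \<Rightarrow> complex \<Rightarrow> complex^2^2" where
  "su2_mat \<alpha> \<beta> = vector [vector [\<alpha>, - cnj \<beta>], vector [\<beta>, cnj \<alpha>]]"

definition SU2 :: "(complex^2^2) set" where
  "SU2 = {su2_mat \<alpha> \<beta> | \<alpha> \<beta>. (cmod \<alpha>)\<^sup>2 + (cmod \<beta>)\<^sup>2 = 1}"

text \<open>A matrix in \<open>SU2\<close> is identified with its first column, a point of the unit sphere of
  \<open>complex^2\<close>; the latter, as a real Euclidean space, is \<open>\<real>\<^sup>4\<close>.\<close>

definition su2_of_vec :: "complex^2 \<Rightarrow> complex^2^2" where
  "su2_of_vec x = su2_mat (x $ 1) (x $ 2)"

text \<open>Riemannian volume of the round metric of radius 2. Radial projection maps Lebesgue measure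
  of the unit ball of \<open>\<real>\<^sup>4\<close> to \<open>1/4\<close> of the surface measure of the unit sphere, and passing to
  radius 2 multiplies 3-dimensional volumes by \<open>2\<^sup>3\<close>; hence the factor \<open>32\<close>.\<close>

definition su2_vol :: "(complex^2^2) measure" where
  "su2_vol = scale_measure 32
     (distr (restrict_space lborel (cball 0 1 - {0})) (restrict_space borel SU2)
        (\<lambda>x. su2_of_vec (x /\<^sub>R norm x)))"

lemma su2_of_vec_in_SU2:
  assumes "x \<noteq> 0"
  shows "su2_of_vec (x /\<^sub>R norm x) \<in> SU2"
proof -
  have n: "(norm x)\<^sup>2 = (cmod (x $ 1))\<^sup>2 + (cmod (x $ 2))\<^sup>2"
    by (simp add: norm_vec_def L2_set_def sum_2)
  have e: "(cmod ((x /\<^sub>R norm x) $ 1))\<^sup>2 + (cmod ((x /\<^sub>R norm x) $ 2))\<^sup>2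
      = ((cmod (x $ 1))\<^sup>2 + (cmod (x $ 2))\<^sup>2) / (norm x)\<^sup>2"
    by (simp add: norm_inverse power_mult_distrib power_inverse divide_inverse algebra_simps)
  have "(cmod ((x /\<^sub>R norm x) $ 1))\<^sup>2 + (cmod ((x /\<^sub>R norm x) $ 2))\<^sup>2 = 1"
    unfolding e n[symmetric] using assms by simp
  then show ?thesis
    unfolding SU2_def su2_of_vec_def by blast
qed

lemma su2_proj_measurable:
  "(\<lambda>x. su2_of_vec (x /\<^sub>R norm x))
     \<in> restrict_space lborel (cball 0 1 - {0}) \<rightarrow>\<^sub>M restrict_space borel SU2"
proof -
  have vec: "continuous_on S (\<lambda>x. vector [f x, g x] :: 'b::{topological_space,zero}^2)"
    if "continuous_on S f" "continuous_on S g"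
    for S :: "(complex^2) set" and f g :: "complex^2 \<Rightarrow> 'b::{topological_space,zero}"
  proof -
    have eq: "(\<lambda>x. vector [f x, g x] :: 'b^2) = (\<lambda>x. \<chi> i. if i = 1 then f x else g x)"
      by (auto simp: fun_eq_iff vec_eq_iff forall_2)
    have "continuous_on S (\<lambda>x. if i = 1 then f x else g x)" for i :: 2
      using that by (cases "i = 1") auto
    then show ?thesis unfolding eq by (rule continuous_on_vec_lambda)
  qed
  have "continuous_on (cball 0 1 - {0}) (\<lambda>x::complex^2. su2_of_vec (x /\<^sub>R norm x))"
    unfolding su2_of_vec_def su2_mat_def by (intro vec continuous_intros) auto
  then have "(\<lambda>x::complex^2. su2_of_vec (x /\<^sub>R norm x))
      \<in> restrict_space borel (cball 0 1 - {0}) \<rightarrow>\<^sub>M borel"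
    by (rule borel_measurable_continuous_on_restrict)
  then have "(\<lambda>x::complex^2. su2_of_vec (x /\<^sub>R norm x))
      \<in> restrict_space borel (cball 0 1 - {0}) \<rightarrow>\<^sub>M restrict_space borel SU2"
    by (intro measurable_restrict_space2) (auto simp: space_restrict_space su2_of_vec_in_SU2)
  then show ?thesis
    by (simp cong: measurable_cong_sets add: sets_restrict_space)
qed

lemma emeasure_su2_vol: "emeasure su2_vol SU2 = ennreal (16 * pi\<^sup>2)"
proof -
  have "emeasure (distr (restrict_space lborel (cball 0 1 - {0})) (restrict_space borel SU2)
      (\<lambda>x. su2_of_vec (x /\<^sub>R norm x))) SU2
      = emeasure (restrict_space lborel (cball 0 1 - {0 :: complex^2})) (cball 0 1 - {0})"
    by (subst emeasure_distr[OF su2_proj_measurable])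
       (auto simp: sets_restrict_space space_restrict_space su2_of_vec_in_SU2
             intro!: arg_cong[where f = "emeasure _"])
  also have "\<dots> = emeasure lborel (cball 0 1 - {0 :: complex^2})"
    by (subst emeasure_restrict_space) auto
  also have "\<dots> = emeasure lborel (cball 0 1 :: (complex^2) set)"
    by (subst emeasure_Diff_null_set) auto
  also have "\<dots> = ennreal (pi\<^sup>2 / 2)"
    by (subst emeasure_cball) (auto simp: eval_unit_ball_vol)
  finally show ?thesis
    unfolding su2_vol_def by (simp add: flip: ennreal_numeral ennreal_mult')
qed


section \<open>Wigner functions\<close>

definition half_nats :: "real set" where
  "half_nats = range (\<lambda>k::nat. real k / 2)"

definition spins :: "real \<Rightarrow> real set" where
  "spins l = (\<lambda>k::nat. real k - l) ` {..nat \<lfloor>2 * l\<rfloor>}"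

definition weight_poly :: "real \<Rightarrow> real \<Rightarrow> complex \<Rightarrow> complex \<Rightarrow> complex" where
  "weight_poly l m z0 z1 =
     of_real (sqrt (real (nat \<lfloor>2 * l\<rfloor> choose nat \<lfloor>l + m\<rfloor>)))
       * z0 ^ nat \<lfloor>l + m\<rfloor> * z1 ^ nat \<lfloor>l - m\<rfloor>"

definition is_wigner_family :: "real \<Rightarrow> real \<Rightarrow> complex^2^2 \<Rightarrow> (real \<Rightarrow> complex) \<Rightarrow> bool" where
  "is_wigner_family l s g d \<longleftrightarrow>
     (\<forall>m. m \<notin> spins l \<longrightarrow> d m = 0) \<and>
     (\<forall>z0 z1. (\<Sum>m\<in>spins l. weight_poly l m z0 z1 * d m) =
        (let \<alpha> = g $ 1 $ 1; \<beta> = g $ 2 $ 1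
         in weight_poly l s (cnj \<alpha> * z0 + cnj \<beta> * z1) (- \<beta> * z0 + \<alpha> * z1)))"

definition wigner_D :: "real \<Rightarrow> real \<Rightarrow> real \<Rightarrow> complex^2^2 \<Rightarrow> complex" where
  "wigner_D l m s g = (THE d. is_wigner_family l s g d) m"

definition wigner_phi :: "real \<Rightarrow> real \<Rightarrow> real \<Rightarrow> complex^2^2 \<Rightarrow> complex" where
  "wigner_phi l m s g = of_real (sqrt (2 * l + 1) / (4 * pi)) * wigner_D l m s g"

lemma binary_form_mult_linear:
  fixes c :: "nat \<Rightarrow> complex"
  shows "\<exists>c'. \<forall>x y. (a * x + b * y) * (\<Sum>k\<le>n. c k * x ^ k * y ^ (n - k))
                    = (\<Sum>k\<le>Suc n. c' k * x ^ k * y ^ (Suc n - k))"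
proof -
  define c' where "c' k = (if k = 0 then 0 else a * c (k - 1)) + (if k \<le> n then b * c k else 0)" for k
  have "(a * x + b * y) * (\<Sum>k\<le>n. c k * x ^ k * y ^ (n - k))
      = (\<Sum>k\<le>Suc n. c' k * x ^ k * y ^ (Suc n - k))" for x y
  proof -
    have 1: "(\<Sum>k\<le>Suc n. (if k = 0 then 0 else a * c (k - 1)) * x ^ k * y ^ (Suc n - k))
        = a * x * (\<Sum>k\<le>n. c k * x ^ k * y ^ (n - k))"
      unfolding sum.atMost_Suc_shift by (simp add: sum_distrib_left mult_ac)
    have 2: "(\<Sum>k\<le>Suc n. (if k \<le> n then b * c k else 0) * x ^ k * y ^ (Suc n - k))
        = b * y * (\<Sum>k\<le>n. c k * x ^ k * y ^ (n - k))"
      by (simp add: sum_distrib_left mult_ac Suc_diff_le)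
    show ?thesis
      unfolding c'_def distrib_right sum.distrib using 1 2 by simp
  qed
  then show ?thesis by blast
qed

lemma binary_form_mult_power:
  fixes c :: "nat \<Rightarrow> complex"
  shows "\<exists>c'. \<forall>x y. (a * x + b * y) ^ p * (\<Sum>k\<le>n. c k * x ^ k * y ^ (n - k))
                    = (\<Sum>k\<le>n + p. c' k * x ^ k * y ^ (n + p - k))"
proof (induction p)
  case 0
  then show ?case by auto
next
  case (Suc p)
  then obtain c' where c': "\<forall>x y. (a * x + b * y) ^ p * (\<Sum>k\<le>n. c k * x ^ k * y ^ (n - k))
      = (\<Sum>k\<le>n + p. c' k * x ^ k * y ^ (n + p - k))" by blast
  obtain c'' where "\<forall>x y. (a * x + b * y) * (\<Sum>k\<le>n + p. c' k * x ^ k * y ^ (n + p - k))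
      = (\<Sum>k\<le>Suc (n + p). c'' k * x ^ k * y ^ (Suc (n + p) - k))"
    using binary_form_mult_linear by blast
  with c' show ?case by (intro exI[of _ c'']) (simp add: mult.assoc)
qed

lemma ex1_wigner_family:
  assumes l: "l \<in> half_nats" and s: "s \<in> spins l"
  shows "\<exists>!d. is_wigner_family l s g d"
proof -
  obtain n :: nat where n: "l = real n / 2"
    using l by (auto simp: half_nats_def)
  have two_l: "nat \<lfloor>2 * l\<rfloor> = n" by (simp add: n)
  obtain p :: nat where p: "s = real p - l" "p \<le> n"
    using s by (auto simp: spins_def two_l)
  have reindex: "(\<Sum>m\<in>spins l. f m) = (\<Sum>k\<le>n. f (real k - l))" for f :: "real \<Rightarrow> complex"
    unfolding spins_def two_l by (subst sum.reindex) (auto simp: inj_on_def)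
  have wp: "weight_poly l (real k - l) z0 z1
      = of_real (sqrt (real (n choose k))) * z0 ^ k * z1 ^ (n - k)" if "k \<le> n" for k z0 z1
  proof -
    have "l - (real k - l) = real (n - k)" using that by (simp add: n of_nat_diff)
    then show ?thesis by (simp add: weight_poly_def two_l)
  qed
  define \<alpha> \<beta> where "\<alpha> = g $ 1 $ 1" and "\<beta> = g $ 2 $ 1"
  define w :: "nat \<Rightarrow> complex" where "w k = of_real (sqrt (real (n choose k)))" for k
  have w0: "w k \<noteq> 0" if "k \<le> n" for k using that by (simp add: w_def)
  define R where "R z0 z1 = w p * ((cnj \<alpha> * z0 + cnj \<beta> * z1) ^ p * ((- \<beta>) * z0 + \<alpha> * z1) ^ (n - p))"
    for z0 z1
  have fam: "is_wigner_family l s g d \<longleftrightarrow> (\<forall>m. m \<notin> spins l \<longrightarrow> d m = 0) \<and>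
     (\<forall>z0 z1. (\<Sum>k\<le>n. (w k * d (real k - l)) * z0 ^ k * z1 ^ (n - k)) = R z0 z1)" for d
    unfolding is_wigner_family_def Let_def reindex p(1)
    by (simp add: wp p(2) R_def mult_ac flip: w_def \<alpha>_def \<beta>_def)
  obtain c where c: "\<forall>x y. ((- \<beta>) * x + \<alpha> * y) ^ (n - p) = (\<Sum>k\<le>n - p. c k * x ^ k * y ^ (n - p - k))"
    using binary_form_mult_power[where a = "- \<beta>" and b = \<alpha> and p = "n - p" and n = 0 and c = "\<lambda>_. 1"]
    by auto
  obtain c' where c': "\<forall>x y. (cnj \<alpha> * x + cnj \<beta> * y) ^ p * ((- \<beta>) * x + \<alpha> * y) ^ (n - p)
      = (\<Sum>k\<le>n. c' k * x ^ k * y ^ (n - k))"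
    using binary_form_mult_power[where a = "cnj \<alpha>" and b = "cnj \<beta>" and p = p and n = "n - p" and c = c]
    p(2) c by auto
  define d where "d m = (if m \<in> spins l then w p * c' (nat \<lfloor>m + l\<rfloor>) / w (nat \<lfloor>m + l\<rfloor>) else 0)" for m
  have dk: "w k * d (real k - l) = w p * c' k" if "k \<le> n" for k
    using that w0 by (auto simp: d_def spins_def two_l)
  have "(\<Sum>k\<le>n. (w k * d (real k - l)) * z0 ^ k * z1 ^ (n - k)) = R z0 z1" for z0 z1
    unfolding R_def c'[rule_format] sum_distrib_left
    by (intro sum.cong) (auto simp: dk mult_ac)
  then have ex: "is_wigner_family l s g d"
    unfolding fam by (auto simp: d_def)
  have "e = d" if e: "is_wigner_family l s g e" for e
  proof -
    have "(\<Sum>k\<le>n. (w k * (e (real k - l) - d (real k - l))) * x ^ k) = 0" for x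
    proof -
      have "(\<Sum>k\<le>n. (w k * e (real k - l)) * x ^ k * 1 ^ (n - k))
          = (\<Sum>k\<le>n. (w k * d (real k - l)) * x ^ k * 1 ^ (n - k))"
        using e ex unfolding fam by metis
      then show ?thesis by (simp add: algebra_simps sum_subtractf)
    qed
    then have "\<forall>k\<le>n. w k * (e (real k - l) - d (real k - l)) = 0"
      using polyfun_eq_0[of "\<lambda>k. w k * (e (real k - l) - d (real k - l))" n] by blast
    then have "e (real k - l) = d (real k - l)" if "k \<le> n" for k
      using that w0 by auto
    then have "e m = d m" if "m \<in> spins l" for m
      using that by (auto simp: spins_def two_l)
    then show ?thesis
      using e ex unfolding fam by (metis ext)
  qed
  with ex show ?thesis by blast
qed

lemma wigner_D_eq:
  assumes "l \<in> half_nats" "s \<in> spins l"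
  shows "(\<Sum>m\<in>spins l. weight_poly l m z0 z1 * wigner_D l m s (su2_mat \<alpha> \<beta>))
       = weight_poly l s (cnj \<alpha> * z0 + cnj \<beta> * z1) (- \<beta> * z0 + \<alpha> * z1)"
proof -
  have "is_wigner_family l s g (\<lambda>m. wigner_D l m s g)" for g
    unfolding wigner_D_def by (rule theI'[OF ex1_wigner_family[OF assms]])
  from this[of "su2_mat \<alpha> \<beta>"] show ?thesis
    by (simp add: is_wigner_family_def su2_mat_def)
qed


section \<open>Random fields\<close>

definition square_integrable :: "'b measure \<Rightarrow> ('b \<Rightarrow> complex) \<Rightarrow> bool" where
  "square_integrable \<mu> f \<longleftrightarrow> f \<in> borel_measurable \<mu> \<and> integrable \<mu> (\<lambda>x. (cmod (f x))\<^sup>2)"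

definition square_integrable_random_field ::
    "'w measure \<Rightarrow> ('w \<Rightarrow> complex^2^2 \<Rightarrow> complex) \<Rightarrow> bool" where
  "square_integrable_random_field M X \<longleftrightarrow>
     (\<lambda>(\<omega>, g). X \<omega> g) \<in> borel_measurable (M \<Otimes>\<^sub>M su2_vol) \<and>
     (AE \<omega> in M. square_integrable su2_vol (X \<omega>))"

text \<open>Squared distance in \<open>L\<^sup>2\<close>; as an extended nonnegative integral it is \<open>\<infinity>\<close>, rather than a
  default value, when the difference is not square integrable.\<close>

definition L2_dist2 :: "'b measure \<Rightarrow> ('b \<Rightarrow> complex) \<Rightarrow> ('b \<Rightarrow> complex) \<Rightarrow> ennreal" where
  "L2_dist2 \<mu> f h = (\<integral>\<^sup>+ x. ennreal ((cmod (f x - h x))\<^sup>2) \<partial>\<mu>)"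


section \<open>Harmonic polynomials and the Laplace--Beltrami operator\<close>

definition partial :: "'a::real_normed_vector \<Rightarrow> ('a \<Rightarrow> 'b::real_normed_vector) \<Rightarrow> 'a \<Rightarrow> 'b" where
  "partial b f x = vector_derivative (\<lambda>t. f (x + t *\<^sub>R b)) (at 0)"

definition laplacian :: "('a::euclidean_space \<Rightarrow> 'b::real_normed_vector) \<Rightarrow> 'a \<Rightarrow> 'b" where
  "laplacian f x = (\<Sum>b\<in>Basis. partial b (partial b f) x)"

definition homogeneous_harmonic_poly :: "nat \<Rightarrow> ('a::euclidean_space \<Rightarrow> complex) \<Rightarrow> bool" where
  "homogeneous_harmonic_poly n p \<longleftrightarrow>
     polynomial_function p \<and> (\<forall>t x. p (t *\<^sub>R x) = t ^ n *\<^sub>R p x) \<and> (\<forall>x. laplacian p x = 0)"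

primrec times_cont_diff ::
    "nat \<Rightarrow> ('a::euclidean_space \<Rightarrow> 'b::real_normed_vector) \<Rightarrow> bool" where
  "times_cont_diff 0 f \<longleftrightarrow> continuous_on UNIV f"
| "times_cont_diff (Suc k) f \<longleftrightarrow> continuous_on UNIV f \<and>
     (\<forall>b\<in>Basis. (\<forall>x. (\<lambda>t. f (x + t *\<^sub>R b)) differentiable (at 0)) \<and>
        times_cont_diff k (partial b f))"

definition smooth :: "('a::euclidean_space \<Rightarrow> 'b::real_normed_vector) \<Rightarrow> bool" where
  "smooth f \<longleftrightarrow> (\<forall>k. times_cont_diff k f)"

definition metric_tensor :: "(real^'n \<Rightarrow> 'a::real_inner) \<Rightarrow> real^'n \<Rightarrow> real^'n^'n" where
  "metric_tensor \<phi> u = (\<chi> i j. partial (axis i 1) \<phi> u \<bullet> partial (axis j 1) \<phi> u)"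

text \<open>Laplace--Beltrami operator of the metric induced on the image of a parametrization \<open>\<phi>\<close>,
  applied to a function with local coordinate expression \<open>f\<close>:
  \<open>G\<^sup>-\<^sup>1\<^sup>/\<^sup>2 \<Sum>\<^sub>i \<partial>\<^sub>i (\<Sum>\<^sub>j G\<^sup>1\<^sup>/\<^sup>2 g\<^sup>i\<^sup>j \<partial>\<^sub>j f)\<close> with \<open>G = det (g\<^sub>i\<^sub>j)\<close>.\<close>

definition laplace_beltrami_coord ::
    "(real^'n \<Rightarrow> 'a::real_inner) \<Rightarrow> (real^'n \<Rightarrow> complex) \<Rightarrow> real^'n \<Rightarrow> complex" where
  "laplace_beltrami_coord \<phi> f u =
     (\<Sum>i\<in>UNIV. partial (axis i 1)
        (\<lambda>v. \<Sum>j\<in>UNIV. (sqrt (det (metric_tensor \<phi> v)) * matrix_inv (metric_tensor \<phi> v) $ i $ j)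
                        *\<^sub>R partial (axis j 1) f v) u)
       /\<^sub>R sqrt (det (metric_tensor \<phi> u))"

text \<open>Inverse stereographic projections onto the unit sphere from the poles \<open>(0, \<plusminus>\<i>)\<close>; for
  \<open>\<epsilon> = 1\<close> and \<open>\<epsilon> = -1\<close> together they form an atlas.\<close>

definition stereo :: "real \<Rightarrow> real^3 \<Rightarrow> complex^2" where
  "stereo \<epsilon> u = vector [Complex (2 * u $ 1) (2 * u $ 2),
                       Complex (2 * u $ 3) (\<epsilon> * ((norm u)\<^sup>2 - 1))] /\<^sub>R ((norm u)\<^sup>2 + 1)"

text \<open>The zero function is not excluded: an eigenfunction for \<open>\<mu>\<close> is here any smooth solution of
  \<open>\<Delta>F = \<mu>F\<close>. The factor 2 scales the unit sphere to the sphere of radius 2.\<close>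

definition laplace_beltrami_eigenfunction :: "real \<Rightarrow> (complex^2^2 \<Rightarrow> complex) \<Rightarrow> bool" where
  "laplace_beltrami_eigenfunction \<mu> F \<longleftrightarrow>
     (\<forall>\<epsilon>\<in>{1, -1}. let f = (\<lambda>u. F (su2_of_vec (stereo \<epsilon> u))) in
        smooth f \<and> (\<forall>u. laplace_beltrami_coord (\<lambda>v. 2 *\<^sub>R stereo \<epsilon> v) f u = \<mu> *\<^sub>R f u))"

lemma norm_stereo:
  assumes "\<epsilon> \<in> {1, -1}"
  shows "norm (stereo \<epsilon> u) = 1"
proof -
  have u: "(norm u)\<^sup>2 = (u $ 1)\<^sup>2 + (u $ 2)\<^sup>2 + (u $ 3)\<^sup>2"
    unfolding power2_norm_eq_inner inner_vec_def by (simp add: sum_3 power2_eq_square)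
  have nv: "(norm (vector [a, b] :: complex^2))\<^sup>2 = (cmod a)\<^sup>2 + (cmod b)\<^sup>2" for a b
    by (simp add: norm_vec_def L2_set_def sum_2)
  define N where "N = (norm u)\<^sup>2"
  have N: "N \<ge> 0" by (simp add: N_def)
  have "\<epsilon>\<^sup>2 = 1" using assms by auto
  then have "(norm (vector [Complex (2 * u $ 1) (2 * u $ 2),
      Complex (2 * u $ 3) (\<epsilon> * (N - 1))] :: complex^2))\<^sup>2
      = 4 * ((u $ 1)\<^sup>2 + (u $ 2)\<^sup>2 + (u $ 3)\<^sup>2) + (N - 1)\<^sup>2"
    unfolding nv by (simp add: cmod_power2 power_mult_distrib)
  also have "\<dots> = (N + 1)\<^sup>2"
    unfolding u[symmetric] N_def[symmetric] by (simp add: power2_eq_square algebra_simps)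
  finally have "norm (vector [Complex (2 * u $ 1) (2 * u $ 2),
      Complex (2 * u $ 3) (\<epsilon> * (N - 1))] :: complex^2) = N + 1"
    using N by (simp add: power2_eq_iff_nonneg)
  then show ?thesis
    using N by (simp add: stereo_def flip: N_def)
qed


section \<open>Spin bundles over the projective line\<close>

definition cline :: "complex^2 \<Rightarrow> (complex^2) set" where
  "cline v = range (\<lambda>c. c *s v)"

definition CP1 :: "(complex^2) set set" where
  "CP1 = cline ` (- {0})"

text \<open>Ambient space of the fibres over a line \<open>L\<close>: for \<open>n \<ge> 0\<close>, elements of \<open>L\<^sup>n \<subseteq> (\<complex>\<^sup>2)\<^sup>n\<close>
  (tensor powers) given by their coefficients, indexed by lists of length \<open>n\<close> over \<open>{1, 2}\<close>;
  for \<open>n < 0\<close>, elements of the \<open>\<bar>n\<bar>\<close>-th tensor power of the dual of \<open>L\<close>, as \<open>\<bar>n\<bar>\<close>-linear forms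
  on \<open>L\<close> (with value 0 outside their domain).\<close>

datatype spin_tensor = Contra "2 list \<Rightarrow> complex" | Covar "(complex^2) list \<Rightarrow> complex"

primrec tscale :: "complex \<Rightarrow> spin_tensor \<Rightarrow> spin_tensor" where
  "tscale c (Contra T) = Contra (\<lambda>js. c * T js)"
| "tscale c (Covar T) = Covar (\<lambda>ws. c * T ws)"

definition dual_vec :: "complex^2 \<Rightarrow> complex^2 \<Rightarrow> complex" where
  "dual_vec v w = (THE c. w = c *s v)"

definition tensor_power :: "int \<Rightarrow> complex^2 \<Rightarrow> spin_tensor" where
  "tensor_power n v =
     (if n \<ge> 0
      then Contra (\<lambda>js. if length js = nat n then (\<Prod>j\<leftarrow>js. v $ j) else 0)
      else Covar (\<lambda>ws. if length ws = nat (- n) \<and> set ws \<subseteq> cline v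
                        then (\<Prod>w\<leftarrow>ws. dual_vec v w) else 0))"

text \<open>As \<open>L\<close> is one-dimensional, every element of a power of \<open>L\<close> is a scalar multiple of the power
  of any nonzero vector of \<open>L\<close>. Sections are arbitrary (set-theoretic) sections.\<close>

definition spin_fibre :: "real \<Rightarrow> (complex^2) set \<Rightarrow> spin_tensor set" where
  "spin_fibre s L = {tscale c (tensor_power \<lfloor>2 * s\<rfloor> v) | c v. v \<in> L \<and> v \<noteq> 0}"

definition spin_section :: "real \<Rightarrow> ((complex^2) set \<Rightarrow> spin_tensor) \<Rightarrow> bool" where
  "spin_section s \<sigma> \<longleftrightarrow> (\<forall>L\<in>CP1. \<sigma> L \<in> spin_fibre s L)"

definition is_pullback ::
    "real \<Rightarrow> ((complex^2) set \<Rightarrow> spin_tensor) \<Rightarrow> (complex^2^2 \<Rightarrow> complex) \<Rightarrow> bool" where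
  "is_pullback s \<sigma> F \<longleftrightarrow>
     (\<forall>g\<in>SU2. let \<tau> = column 1 g in
        \<sigma> (cline \<tau>) = tscale (F g) (tensor_power \<lfloor>2 * s\<rfloor> \<tau>))"

lemma cline_scale:
  assumes "c \<noteq> 0"
  shows "cline (c *s v) = cline v"
proof -
  have 1: "a *s (c *s v) = (a * c) *s v" and 2: "a *s v = (a / c) *s (c *s v)" for a
    using assms by (simp_all add: vector_smult_assoc)
  show ?thesis
    unfolding cline_def using 1 2 by (metis (no_types, lifting) image_subsetI rangeI subset_antisym)
qed

lemma tensor_power_scale:
  assumes "c \<noteq> 0" "v \<noteq> 0"
  shows "tensor_power n (c *s v) = tscale (c powi n) (tensor_power n v)"
proof (cases "n \<ge> 0")
  case True
  have P: "(\<Prod>j\<leftarrow>js. (c *s v) $ j) = c ^ length js * (\<Prod>j\<leftarrow>js. v $ j)" for js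
    by (induction js) auto
  with True show ?thesis
    by (simp add: tensor_power_def power_int_def P fun_eq_iff)
next
  case False
  have line: "cline (c *s v) = cline v" by (rule cline_scale) fact
  have dual: "dual_vec w (a *s w) = a" if "w \<noteq> 0" for a w
    unfolding dual_vec_def by (rule the_equality) (use that in \<open>auto simp: vector_mul_rcancel\<close>)
  have "dual_vec (c *s v) w = inverse c * dual_vec v w" if "w \<in> cline v" for w
  proof -
    obtain a where a: "w = a *s v" using \<open>w \<in> cline v\<close> unfolding cline_def by blast
    then have "w = (a / c) *s (c *s v)" using assms by (simp add: vector_smult_assoc)
    then have "dual_vec (c *s v) w = a / c"
      using dual[of "c *s v" "a / c"] assms by simp
    then show ?thesis
      using dual[of v a] a assms by (simp add: field_simps)
  qed
  then have "(\<Prod>w\<leftarrow>ws. dual_vec (c *s v) w) = inverse c ^ length ws * (\<Prod>w\<leftarrow>ws. dual_vec v w)"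
    if "set ws \<subseteq> cline v" for ws
    using that by (induction ws) auto
  with False show ?thesis
    by (auto simp: tensor_power_def power_int_def line)
qed

lemma tscale_tscale: "tscale c (tscale d T) = tscale (c * d) T"
  by (cases T) (auto simp: mult.assoc)

lemma tscale_tensor_power_inj:
  assumes "v \<noteq> 0" and eq: "tscale c (tensor_power n v) = tscale d (tensor_power n v)"
  shows "c = d"
proof (cases "n \<ge> 0")
  case True
  obtain j where j: "v $ j \<noteq> 0" using assms by (auto simp: vec_eq_iff)
  have "(\<Prod>i\<leftarrow>replicate (nat n) j. v $ i) \<noteq> 0"
    using j by (simp add: prod_list_replicate)
  then show ?thesis
    using True eq by (auto simp: tensor_power_def dest!: fun_cong[where x = "replicate (nat n) j"])
next
  case False
  have "dual_vec v v = 1"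
    unfolding dual_vec_def
    by (rule the_equality) (use assms in \<open>auto simp: vec_eq_iff\<close>)
  moreover have "v \<in> cline v"
    unfolding cline_def by (rule image_eqI[of _ _ 1]) auto
  ultimately show ?thesis
    using False eq
    by (auto simp: tensor_power_def prod_list_replicate
             dest!: fun_cong[where x = "replicate (nat (- n)) v"])
qed

text \<open>The matrix \<open>su2_mat (cis (\<psi> / 2)) 0\<close> is \<open>diag(e\<^sup>i\<^sup>\<psi>\<^sup>/\<^sup>2, e\<^sup>-\<^sup>i\<^sup>\<psi>\<^sup>/\<^sup>2)\<close>.\<close>

lemma pullback_iff_equivariant:
  assumes "2 * s \<in> \<int>"
  shows "(\<exists>\<sigma>. spin_section s \<sigma> \<and> is_pullback s \<sigma> F) \<longleftrightarrow>
         (\<forall>g\<in>SU2. \<forall>\<psi>. F (g ** su2_mat (cis (\<psi> / 2)) 0) = F g * cis (- s * \<psi>))"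
proof -
  obtain n where n: "2 * s = of_int n" using assms by (auto elim: Ints_cases)
  have fl: "\<lfloor>2 * s\<rfloor> = n" by (simp add: n)
  have col: "column 1 (su2_mat a b) = vector [a, b]" for a b
    by (simp add: column_def su2_mat_def vec_eq_iff forall_2)
  have mult: "su2_mat a b ** su2_mat c 0 = su2_mat (c * a) (c * b)" for a b c
    by (simp add: su2_mat_def matrix_matrix_mult_def vec_eq_iff forall_2 sum_2)
  have scol: "vector [c * a, c * b] = c *s (vector [a, b] :: complex^2)" for a b c
    by (simp add: vec_eq_iff forall_2)
  have nz: "column 1 g \<noteq> 0" if "g \<in> SU2" for g
  proof -
    obtain a b where "g = su2_mat a b" "(cmod a)\<^sup>2 + (cmod b)\<^sup>2 = 1"
      using \<open>g \<in> SU2\<close> by (auto simp: SU2_def)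
    then show ?thesis by (auto simp: col vec_eq_iff[of _ 0] forall_2)
  qed
  have cpow: "cis (\<psi> / 2) powi n = cis (s * \<psi>)" for \<psi>
  proof -
    have s: "s = of_int n / 2" using n by simp
    show ?thesis unfolding s by (simp add: cis_power_int)
  qed
  have rot: "g ** su2_mat (cis t) 0 \<in> SU2"
      "column 1 (g ** su2_mat (cis t) 0) = cis t *s column 1 g" if "g \<in> SU2" for g t
  proof -
    obtain a b where ab: "g = su2_mat a b" "(cmod a)\<^sup>2 + (cmod b)\<^sup>2 = 1"
      using \<open>g \<in> SU2\<close> by (auto simp: SU2_def)
    then have "(cmod (cis t * a))\<^sup>2 + (cmod (cis t * b))\<^sup>2 = 1"
      by (simp add: norm_mult)
    then show "g ** su2_mat (cis t) 0 \<in> SU2"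
      unfolding ab mult SU2_def by blast
    show "column 1 (g ** su2_mat (cis t) 0) = cis t *s column 1 g"
      by (simp add: ab mult col scol)
  qed
  have line: "cline (cis t *s v) = cline v" for t v
    by (simp add: cline_scale)
  show ?thesis
  proof
    assume "\<exists>\<sigma>. spin_section s \<sigma> \<and> is_pullback s \<sigma> F"
    then obtain \<sigma> where \<sigma>: "\<And>g. g \<in> SU2 \<Longrightarrow>
        \<sigma> (cline (column 1 g)) = tscale (F g) (tensor_power n (column 1 g))"
      by (auto simp: is_pullback_def Let_def fl)
    show "\<forall>g\<in>SU2. \<forall>\<psi>. F (g ** su2_mat (cis (\<psi> / 2)) 0) = F g * cis (- s * \<psi>)"
    proof (intro ballI allI)
      fix g \<psi> assume g: "g \<in> SU2"
      have "tscale (F g) (tensor_power n (column 1 g))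
          = tscale (F (g ** su2_mat (cis (\<psi> / 2)) 0) * cis (s * \<psi>)) (tensor_power n (column 1 g))"
        using \<sigma>[OF g] \<sigma>[OF rot(1)[OF g, of "\<psi> / 2"]] nz[OF g]
        by (simp add: rot(2)[OF g] line tensor_power_scale cpow tscale_tscale)
      then have "F g = F (g ** su2_mat (cis (\<psi> / 2)) 0) * cis (s * \<psi>)"
        using tscale_tensor_power_inj nz[OF g] by blast
      then show "F (g ** su2_mat (cis (\<psi> / 2)) 0) = F g * cis (- s * \<psi>)"
        by (simp add: mult.assoc cis_mult)
    qed
  next
    assume eqv: "\<forall>g\<in>SU2. \<forall>\<psi>. F (g ** su2_mat (cis (\<psi> / 2)) 0) = F g * cis (- s * \<psi>)"
    define G where "G L = (SOME g. g \<in> SU2 \<and> cline (column 1 g) = L)" for L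
    define \<sigma> where "\<sigma> L = tscale (F (G L)) (tensor_power n (column 1 (G L)))" for L
    have G: "G L \<in> SU2 \<and> cline (column 1 (G L)) = L" if "g \<in> SU2" "cline (column 1 g) = L" for g L
      unfolding G_def by (rule someI[of _ g]) (use that in blast)
    have self: "v \<in> cline v" for v
      unfolding cline_def by (rule image_eqI[of _ _ 1]) auto
    have pb: "\<sigma> (cline (column 1 g)) = tscale (F g) (tensor_power n (column 1 g))"
      if g: "g \<in> SU2" for g
    proof -
      define k where "k = G (cline (column 1 g))"
      have k: "k \<in> SU2" "cline (column 1 k) = cline (column 1 g)"
        using G[OF g refl] by (auto simp: k_def)
      then obtain c where c: "column 1 k = c *s column 1 g"
        using self[of "column 1 k"] by (auto simp: cline_def)
      obtain a b where ab: "g = su2_mat a b" "(cmod a)\<^sup>2 + (cmod b)\<^sup>2 = 1"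
        using g by (auto simp: SU2_def)
      obtain a' b' where ab': "k = su2_mat a' b'" "(cmod a')\<^sup>2 + (cmod b')\<^sup>2 = 1"
        using k by (auto simp: SU2_def)
      have cab: "a' = c * a" "b' = c * b"
        using c by (auto simp: ab ab' col vec_eq_iff forall_2)
      have "(cmod c)\<^sup>2 * ((cmod a)\<^sup>2 + (cmod b)\<^sup>2) = 1"
        using ab'(2) by (simp add: cab norm_mult power_mult_distrib algebra_simps)
      then have "cmod c = 1" using ab by (simp add: power2_eq_1_iff)
         (smt (verit) norm_ge_zero)
      then obtain t where t: "c = cis (t / 2)"
        by (metis cis_Arg_unique complex_norm_eq_1_exp cis_conv_exp mult.commute nonzero_mult_div_cancel_left zero_neq_numeral)
      have kg: "k = g ** su2_mat (cis (t / 2)) 0"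
        by (simp add: ab ab' mult cab t)
      have "\<sigma> (cline (column 1 g)) = tscale (F k) (tensor_power n (column 1 k))"
        by (simp add: \<sigma>_def k_def)
      also have "\<dots> = tscale (F g * (cis (- s * t) * cis (s * t))) (tensor_power n (column 1 g))"
        using eqv g nz[OF g]
        by (simp add: kg rot(2)[OF g] tensor_power_scale cpow tscale_tscale mult.assoc)
      also have "cis (- s * t) * cis (s * t) = 1" by (simp add: cis_mult)
      finally show ?thesis by simp
    qed
    have "spin_section s \<sigma>"
      unfolding spin_section_def
    proof
      fix L assume "L \<in> CP1"
      then obtain v where v: "v \<noteq> 0" "L = cline v" by (auto simp: CP1_def)
      define r where "r = complex_of_real (norm v)"
      have r: "r \<noteq> 0" using v by (simp add: r_def)
      have "su2_of_vec (v /\<^sub>R norm v) \<in> SU2" using v by (rule_tac su2_of_vec_in_SU2)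
      moreover have c1: "column 1 (su2_of_vec (v /\<^sub>R norm v)) = inverse r *s v"
        by (simp add: su2_of_vec_def col vec_eq_iff forall_2 r_def scaleR_conv_of_real[where 'a = complex])
      moreover have "cline (inverse r *s v) = cline v"
        using r by (simp add: cline_scale)
      ultimately have "G L \<in> SU2 \<and> cline (column 1 (G L)) = L"
        using G[of "su2_of_vec (v /\<^sub>R norm v)" L] v by simp
      then show "\<sigma> L \<in> spin_fibre s L"
        using self[of "column 1 (G L)"] nz unfolding spin_fibre_def \<sigma>_def fl by blast
    qed
    moreover have "is_pullback s \<sigma> F"
      using pb by (simp add: is_pullback_def Let_def fl)
    ultimately show "\<exists>\<sigma>. spin_section s \<sigma> \<and> is_pullback s \<sigma> F" by blast
  qed
qed

end

theory Submission
  imports Defs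
begin

text \<open>The coefficients are the Fourier coefficients of \<open>X \<omega>\<close> with respect to the Wigner functions.
  Orthogonality comes from the invariance of the volume under rotations of \<open>\<real>\<^sup>4\<close>: left and right
  multiplication by the diagonal torus separates the weights \<open>m\<close> and \<open>s\<close>, and a general rotation moves a
  form of degree \<open>2 l\<close> to a highest weight vector, whose weight does not occur for smaller \<open>l\<close>.
  The span of the Wigner functions is stable under multiplication by the coordinates and their
  conjugates, hence contains all polynomials, which are dense in \<open>L\<^sup>2\<close> by Stone--Weierstrass;
  convergence then follows from the best approximation property of orthogonal expansions.
  Finally, each Wigner function is a linear combination of products \<open>U\<^sup>p V\<^sup>q\<close> of linear forms on
  \<open>\<real>\<^sup>4\<close> that are isotropic and orthogonal for the complex bilinear extension of the scalar product;
  for such products harmonicity and the eigenvalue equation are short computations.\<close>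

section \<open>Rotation invariance of the volume on SU(2)\<close>

text \<open>\<open>wigner_D\<close> is a definite description, so everything rests on replacing it
  by an explicit coefficient of a product of powers of two linear polynomials, indexed by the
  natural numbers n = 2 l, p = l + s, k = l + m. These coefficients have a generating form in z
  whose value at a fixed z is a product of powers of two real-linear forms in x; rotations and
  harmonicity are handled on the generating form, weights and totality on the coefficients.
  Multiplication by a coordinate is the Clebsch-Gordan rule for tensoring with spin 1/2: on the
  sphere, degree n goes to degrees n + 1 and n - 1. The expansion coefficients are quotients by the
  squared norm, so orthogonality together with nonzero normalizing constants is enough and no norm
  has to be evaluated. The Laplace-Beltrami operator is given by a coordinate formula and not
  through the ambient Laplacian; the eigenvalue therefore comes from a computation in the two
  stereographic charts, where the metric is conformally flat.\<close>

lemma nn_integral_lborel_translation: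
  fixes f :: "'a::euclidean_space \<Rightarrow> ennreal"
  assumes [measurable]: "f \<in> borel_measurable borel"
  shows "(\<integral>\<^sup>+x. f (x + t) \<partial>lborel) = (\<integral>\<^sup>+x. f x \<partial>lborel)"
proof -
  have "(\<integral>\<^sup>+x. f x \<partial>lborel) = (\<integral>\<^sup>+x. f x \<partial>distr lborel borel ((+) t))"
    by (simp add: lborel_distr_plus)
  also have "\<dots> = (\<integral>\<^sup>+x. f (x + t) \<partial>lborel)"
    by (subst nn_integral_distr) (auto simp: add.commute)
  finally show ?thesis ..
qed

lemma nn_integral_lborel_reflection:
  fixes f :: "'a::euclidean_space \<Rightarrow> ennreal"
  assumes [measurable]: "f \<in> borel_measurable borel"
  shows "(\<integral>\<^sup>+x. f (t - x) \<partial>lborel) = (\<integral>\<^sup>+x. f x \<partial>lborel)"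
proof -
  have "(\<integral>\<^sup>+x. f x \<partial>lborel) = (\<integral>\<^sup>+x. f x \<partial>distr lborel borel (\<lambda>x. t + (-1) *\<^sub>R x))"
    using lborel_affine[of "-1" t] by (simp add: density_1)
  also have "\<dots> = (\<integral>\<^sup>+x. f (t - x) \<partial>lborel)"
    by (subst nn_integral_distr) auto
  finally show ?thesis ..
qed

text \<open>The uniqueness argument for Haar measure: integrating \<open>f x * g (y + x)\<close> against
  \<open>\<nu> \<otimes> lborel\<close>, with \<open>\<nu>\<close> the transported measure, in both orders.\<close>

lemma distr_lborel_orthogonal_transformation:
  fixes T :: "'a::euclidean_space \<Rightarrow> 'a"
  assumes T: "orthogonal_transformation T"
  shows "distr lborel borel T = lborel"
proof -
  have lin: "linear T" and nrm: "norm (T x) = norm x" for x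
    using T by (auto simp: orthogonal_transformation)
  have [measurable]: "T \<in> borel_measurable borel"
    by (intro borel_measurable_continuous_onI linear_continuous_on)
       (use lin in \<open>simp add: linear_conv_bounded_linear\<close>)
  define \<nu> where "\<nu> = distr lborel borel T"
  have sets_\<nu>[simp, measurable_cong]: "sets \<nu> = sets borel" by (simp add: \<nu>_def)
  have space_\<nu>[simp]: "space \<nu> = UNIV" by (simp add: \<nu>_def)
  have ballT: "T -` ball (0::'a) r = ball 0 r" for r :: real
    by (auto simp: nrm)
  have em_ball: "emeasure \<nu> (ball (0::'a) r) = emeasure lborel (ball (0::'a) r)" for r
    unfolding \<nu>_def by (subst emeasure_distr) (auto simp: ballT)
  have fin: "emeasure lborel (ball (0::'a) r) < \<infinity>" for r
    by (rule emeasure_bounded_finite) simp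
  \<comment> \<open>Balls about the origin are their own preimages under \<open>T\<close>, so they
    exhaust the space with finite \<open>\<nu>\<close>-measure; Fubini for \<open>\<nu>\<close> and
    \<open>lborel\<close> depends on this.\<close>
  interpret \<nu>: sigma_finite_measure \<nu>
  proof
    show "\<exists>A. countable A \<and> A \<subseteq> sets \<nu> \<and> \<Union> A = space \<nu> \<and> (\<forall>a\<in>A. emeasure \<nu> a \<noteq> \<infinity>)"
    proof (intro exI[of _ "range (\<lambda>n::nat. ball 0 (real n))"] conjI)
      show "\<Union> (range (\<lambda>n::nat. ball (0::'a) (real n))) = space \<nu>"
        using reals_Archimedean2 by auto
    qed (use fin in \<open>auto simp: em_ball less_top\<close>)
  qed
  interpret pair_sigma_finite \<nu> lborel ..
  \<comment> \<open>Translation by y pulls back through the linear surjection \<open>T\<close> to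
    translation by a preimage of y, which \<open>lborel\<close> does not see.\<close>
  have trans: "(\<integral>\<^sup>+x. f (x + y) \<partial>\<nu>) = (\<integral>\<^sup>+x. f x \<partial>\<nu>)"
    if [measurable]: "f \<in> borel_measurable borel" for f and y :: 'a
  proof -
    obtain y' where y': "y = T y'"
      using orthogonal_transformation_surj[OF T] by (metis surjD)
    have "(\<integral>\<^sup>+x. f (x + y) \<partial>\<nu>) = (\<integral>\<^sup>+x. f (T (x + y')) \<partial>lborel)"
      unfolding \<nu>_def by (subst nn_integral_distr) (auto simp: y' linear_add[OF lin])
    also have "\<dots> = (\<integral>\<^sup>+x. f (T x) \<partial>lborel)"
      by (rule nn_integral_lborel_translation) measurable
    also have "\<dots> = (\<integral>\<^sup>+x. f x \<partial>\<nu>)"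
      unfolding \<nu>_def by (subst nn_integral_distr) auto
    finally show ?thesis .
  qed
  have key: "(\<integral>\<^sup>+x. f x \<partial>\<nu>) * (\<integral>\<^sup>+x. g x \<partial>lborel) = (\<integral>\<^sup>+x. g x \<partial>\<nu>) * (\<integral>\<^sup>+x. f x \<partial>lborel)"
    if [measurable]: "f \<in> borel_measurable borel" "g \<in> borel_measurable borel" for f g
  proof -
    have "(\<integral>\<^sup>+x. f x \<partial>\<nu>) * (\<integral>\<^sup>+x. g x \<partial>lborel) = (\<integral>\<^sup>+x. f x * (\<integral>\<^sup>+y. g (y + x) \<partial>lborel) \<partial>\<nu>)"
      by (subst nn_integral_lborel_translation) (auto simp: nn_integral_multc)
    also have "\<dots> = (\<integral>\<^sup>+x. (\<integral>\<^sup>+y. f x * g (y + x) \<partial>lborel) \<partial>\<nu>)"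
      by (intro nn_integral_cong) (simp add: nn_integral_cmult)
    also have "\<dots> = (\<integral>\<^sup>+y. (\<integral>\<^sup>+x. f x * g (y + x) \<partial>\<nu>) \<partial>lborel)"
      by (rule Fubini'[symmetric]) measurable
    also have "\<dots> = (\<integral>\<^sup>+y. (\<integral>\<^sup>+x. f (x - y) * g x \<partial>\<nu>) \<partial>lborel)"
    proof (rule nn_integral_cong)
      fix y :: 'a
      show "(\<integral>\<^sup>+x. f x * g (y + x) \<partial>\<nu>) = (\<integral>\<^sup>+x. f (x - y) * g x \<partial>\<nu>)"
        using trans[of "\<lambda>x. f (x - y) * g x" y] by (simp add: add.commute)
    qed
    also have "\<dots> = (\<integral>\<^sup>+x. (\<integral>\<^sup>+y. f (x - y) * g x \<partial>lborel) \<partial>\<nu>)"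
      by (rule Fubini') measurable
    also have "\<dots> = (\<integral>\<^sup>+x. (\<integral>\<^sup>+y. f y \<partial>lborel) * g x \<partial>\<nu>)"
      by (intro nn_integral_cong) (simp add: nn_integral_multc nn_integral_lborel_reflection)
    also have "\<dots> = (\<integral>\<^sup>+x. g x \<partial>\<nu>) * (\<integral>\<^sup>+x. f x \<partial>lborel)"
      by (subst nn_integral_cmult) (auto simp: mult.commute)
    finally show ?thesis .
  qed
  \<comment> \<open>By \<open>key\<close> the measures \<open>\<nu>\<close> and
    \<open>lborel\<close> are proportional; the unit ball, on which they agree, fixes the factor to
    1 because its measure is neither 0 nor infinite.\<close>
  define B where "B = emeasure lborel (ball (0::'a) 1)"
  have B: "B \<noteq> 0" "B \<noteq> \<infinity>"
  proof -
    have "\<not> negligible (ball (0::'a) 1)"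
      by (rule open_not_negligible) auto
    then show "B \<noteq> 0"
      unfolding B_def negligible_iff_null_sets
      by (metis borel_open null_setsI null_sets_completionI open_ball sets_lborel)
    show "B \<noteq> \<infinity>" using fin[of 1] by (simp add: B_def)
  qed
  show ?thesis
    unfolding \<nu>_def[symmetric]
  proof (rule measure_eqI)
    fix A assume "A \<in> sets \<nu>"
    then have A[measurable]: "A \<in> sets borel" by simp
    have "emeasure \<nu> A * B = B * emeasure lborel A"
      using key[OF borel_measurable_indicator borel_measurable_indicator, OF A borel_open[OF open_ball], of 0 1]
        em_ball[of 1] A
      by (simp add: B_def)
    then have "B * emeasure \<nu> A = B * emeasure lborel A" by (simp add: mult.commute)
    then show "emeasure \<nu> A = emeasure lborel A"
      using B by (simp add: ennreal_mult_cancel_left)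
  qed simp
qed

section \<open>The volume of SU(2) seen through the first column\<close>

lemma space_su2_vol [simp]: "space su2_vol = SU2"
  by (simp add: su2_vol_def space_scale_measure space_restrict_space)

lemma sets_su2_vol: "sets su2_vol = sets (restrict_space borel SU2)"
  by (simp add: su2_vol_def)

lemma finite_measure_su2_vol: "finite_measure su2_vol"
  by standard (simp add: emeasure_su2_vol)

lemma borel_measurable_su2_vol:
  "f \<in> borel_measurable borel \<Longrightarrow> f \<in> borel_measurable su2_vol"
  by (subst measurable_cong_sets[OF sets_su2_vol refl]) (rule measurable_restrict_space1)

lemma continuous_column: "continuous_on S (column i :: 'a::topological_space^'n^'m \<Rightarrow> 'a^'m)"
  unfolding column_def by (intro continuous_intros)

lemma measurable_column_su2_vol [measurable]: "column 1 \<in> su2_vol \<rightarrow>\<^sub>M borel"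
  by (intro borel_measurable_su2_vol borel_measurable_continuous_onI continuous_column)

lemma column_su2_of_vec [simp]: "column 1 (su2_of_vec x) = x"
  by (simp add: su2_of_vec_def su2_mat_def column_def vec_eq_iff forall_2)

lemma su2_of_vec_column: "g \<in> SU2 \<Longrightarrow> su2_of_vec (column 1 g) = g"
  by (auto simp: SU2_def su2_of_vec_def su2_mat_def column_def vec_eq_iff forall_2)

lemma norm_column_SU2:
  assumes "g \<in> SU2" shows "norm (column 1 g) = 1"
proof -
  obtain a b where ab: "g = su2_mat a b" "(cmod a)\<^sup>2 + (cmod b)\<^sup>2 = 1"
    using assms by (auto simp: SU2_def)
  then show ?thesis
    by (simp add: norm_vec_def L2_set_def sum_2 column_def su2_mat_def)
qed

text \<open>The volume is a push-forward under radial projection, so a set of directions is measured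
  by the cone over it in the unit ball. In this form rotations of the ambient space act on Lebesgue
  measure.\<close>

lemma emeasure_su2_vol_column:
  assumes [measurable]: "A \<in> sets borel"
  shows "emeasure (distr su2_vol borel (column 1)) A
     = 32 * emeasure lborel {x. x \<in> cball 0 1 - {0} \<and> x /\<^sub>R norm x \<in> A}"
proof -
  let ?B = "cball 0 1 - {0 :: complex^2}"
  let ?p = "\<lambda>x::complex^2. su2_of_vec (x /\<^sub>R norm x)"
  have "column 1 -` A \<inter> SU2 \<in> sets su2_vol"
    using measurable_sets[OF measurable_column_su2_vol assms] by simp
  then have C: "column 1 -` A \<inter> SU2 \<in> sets (restrict_space borel SU2)"
    by (simp add: sets_su2_vol)
  have "emeasure (distr su2_vol borel (column 1)) A = emeasure su2_vol (column 1 -` A \<inter> SU2)"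
    by (subst emeasure_distr) auto
  also have "\<dots> = 32 * emeasure (restrict_space lborel ?B) (?p -` (column 1 -` A \<inter> SU2) \<inter> ?B)"
    unfolding su2_vol_def emeasure_scale_measure
    by (subst emeasure_distr[OF su2_proj_measurable C]) (simp add: space_restrict_space)
  also have "\<dots> = 32 * emeasure lborel (?p -` (column 1 -` A \<inter> SU2) \<inter> ?B)"
    by (subst emeasure_restrict_space) auto
  also have "?p -` (column 1 -` A \<inter> SU2) \<inter> ?B = {x. x \<in> ?B \<and> x /\<^sub>R norm x \<in> A}"
    using su2_of_vec_in_SU2 by auto
  finally show ?thesis .
qed

text \<open>A linear isometry commutes with radial projection, hence maps cones to cones of the same
  Lebesgue measure. Integrands are functions of the first column because \<open>T\<close> acts on
  vectors, not on matrices.\<close>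

lemma integral_su2_vol_orthogonal_transformation:
  fixes f :: "complex^2 \<Rightarrow> 'b::{banach, second_countable_topology}"
  assumes T: "orthogonal_transformation T" and [measurable]: "f \<in> borel_measurable borel"
  shows "(\<integral>g. f (T (column 1 g)) \<partial>su2_vol) = (\<integral>g. f (column 1 g) \<partial>su2_vol)"
proof -
  let ?B = "cball 0 1 - {0 :: complex^2}"
  define \<nu> where "\<nu> = distr su2_vol borel (column 1 :: complex^2^2 \<Rightarrow> _)"
  have lin: "linear T" and nrm: "norm (T x) = norm x" for x
    using T by (auto simp: orthogonal_transformation)
  have [measurable]: "T \<in> borel_measurable borel"
    by (intro borel_measurable_continuous_onI linear_continuous_on)
       (use lin in \<open>simp add: linear_conv_bounded_linear\<close>)
  have "distr \<nu> borel T = \<nu>"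
  proof (rule measure_eqI)
    fix A assume "A \<in> sets (distr \<nu> borel T)"
    then have A[measurable]: "A \<in> sets borel" by simp
    have TA: "T -` A \<in> sets borel"
      using measurable_sets[OF \<open>T \<in> borel_measurable borel\<close> A] by simp
    have M: "{x. x \<in> ?B \<and> x /\<^sub>R norm x \<in> A} \<in> sets borel"
      by measurable
    have "emeasure (distr \<nu> borel T) A = emeasure \<nu> (T -` A)"
      by (subst emeasure_distr) (auto simp: \<nu>_def)
    also have "\<dots> = 32 * emeasure lborel {x. x \<in> ?B \<and> x /\<^sub>R norm x \<in> T -` A}"
      unfolding \<nu>_def by (rule emeasure_su2_vol_column) (rule TA)
    also have "{x. x \<in> ?B \<and> x /\<^sub>R norm x \<in> T -` A} = T -` {x. x \<in> ?B \<and> x /\<^sub>R norm x \<in> A}"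
    proof -
      have "T x = 0 \<longleftrightarrow> x = 0" for x using nrm[of x] by (metis norm_eq_zero)
      then show ?thesis by (auto simp: nrm linear_scale[OF lin])
    qed
    also have "emeasure lborel \<dots> = emeasure (distr lborel borel T) {x. x \<in> ?B \<and> x /\<^sub>R norm x \<in> A}"
      using M by (subst emeasure_distr) auto
    also have "32 * \<dots> = emeasure \<nu> A"
      unfolding \<nu>_def by (simp only: distr_lborel_orthogonal_transformation[OF T] emeasure_su2_vol_column[OF A])
    finally show "emeasure (distr \<nu> borel T) A = emeasure \<nu> A" .
  qed (simp add: \<nu>_def)
  then have "(\<integral>x. f x \<partial>\<nu>) = (\<integral>x. f x \<partial>distr \<nu> borel T)"
    by (simp only:)
  also have "\<dots> = (\<integral>x. f (T x) \<partial>\<nu>)"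
    by (rule integral_distr) (simp_all add: \<nu>_def)
  also have "\<dots> = (\<integral>g. f (T (column 1 g)) \<partial>su2_vol)"
    unfolding \<nu>_def by (rule integral_distr) simp_all
  also have "(\<integral>x. f x \<partial>\<nu>) = (\<integral>g. f (column 1 g) \<partial>su2_vol)"
    unfolding \<nu>_def by (rule integral_distr) simp_all
  finally show ?thesis ..
qed

text \<open>Linear over the reals only, since the second column is conjugated; this is enough to
  turn polynomials on matrices into polynomials on vectors.\<close>

lemma linear_su2_of_vec: "linear su2_of_vec"
  by (rule linearI) (auto simp: su2_of_vec_def su2_mat_def vec_eq_iff forall_2)

lemma compact_SU2: "compact SU2"
proof -
  have "SU2 = su2_of_vec ` sphere 0 1"
  proof (intro set_eqI iffI)
    fix g assume "g \<in> SU2"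
    then show "g \<in> su2_of_vec ` sphere 0 1"
      by (intro image_eqI[of _ _ "column 1 g"]) (auto simp: su2_of_vec_column norm_column_SU2)
  next
    fix g assume "g \<in> su2_of_vec ` sphere 0 1"
    then obtain x where x: "g = su2_of_vec x" "norm x = 1" by auto
    then show "g \<in> SU2" using su2_of_vec_in_SU2[of x] by fastforce
  qed
  moreover have "continuous_on (sphere 0 1) su2_of_vec"
    using linear_su2_of_vec by (intro linear_continuous_on) (simp add: linear_conv_bounded_linear)
  ultimately show ?thesis by (metis compact_continuous_image compact_sphere)
qed

section \<open>Continuous functions are dense in the space of square integrable functions\<close>

text \<open>Pointwise (a + b)^2 <= 2 a^2 + 2 b^2 replaces the Minkowski inequality, which would need
  square roots of extended reals. The lost factor 2 is the source of the quarters
  \<open>e / 4\<close> below.\<close>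

lemma L2_dist2_add_le:
  assumes [measurable]: "f \<in> borel_measurable M" "f' \<in> borel_measurable M"
    "g \<in> borel_measurable M" "g' \<in> borel_measurable M"
  shows "L2_dist2 M (\<lambda>x. f x + g x) (\<lambda>x. f' x + g' x) \<le> 2 * L2_dist2 M f f' + 2 * L2_dist2 M g g'"
proof -
  have *: "(cmod (f x + g x - (f' x + g' x)))\<^sup>2 \<le> 2 * (cmod (f x - f' x))\<^sup>2 + 2 * (cmod (g x - g' x))\<^sup>2" for x
  proof -
    have "cmod (f x + g x - (f' x + g' x)) \<le> cmod (f x - f' x) + cmod (g x - g' x)"
      using norm_triangle_ineq[of "f x - f' x" "g x - g' x"] by (simp add: algebra_simps)
    then have "(cmod (f x + g x - (f' x + g' x)))\<^sup>2 \<le> (cmod (f x - f' x) + cmod (g x - g' x))\<^sup>2"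
      by (simp add: power_mono)
    also have "\<dots> \<le> 2 * (cmod (f x - f' x))\<^sup>2 + 2 * (cmod (g x - g' x))\<^sup>2"
      using zero_le_power2[of "cmod (f x - f' x) - cmod (g x - g' x)"]
      by (simp add: power2_eq_square algebra_simps)
    finally show ?thesis .
  qed
  have "L2_dist2 M (\<lambda>x. f x + g x) (\<lambda>x. f' x + g' x)
     \<le> (\<integral>\<^sup>+x. 2 * ennreal ((cmod (f x - f' x))\<^sup>2) + 2 * ennreal ((cmod (g x - g' x))\<^sup>2) \<partial>M)"
    unfolding L2_dist2_def
  proof (rule nn_integral_mono)
    fix x
    have "ennreal ((cmod (f x + g x - (f' x + g' x)))\<^sup>2)
        \<le> ennreal (2 * (cmod (f x - f' x))\<^sup>2 + 2 * (cmod (g x - g' x))\<^sup>2)"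
      by (rule ennreal_leI) (rule *)
    then show "ennreal ((cmod (f x + g x - (f' x + g' x)))\<^sup>2)
        \<le> 2 * ennreal ((cmod (f x - f' x))\<^sup>2) + 2 * ennreal ((cmod (g x - g' x))\<^sup>2)"
      by (simp add: ennreal_plus ennreal_mult)
  qed
  also have "\<dots> = 2 * L2_dist2 M f f' + 2 * L2_dist2 M g g'"
    unfolding L2_dist2_def by (subst nn_integral_add) (auto simp: nn_integral_cmult)
  finally show ?thesis .
qed

text \<open>The sum inequality for the pairs (f, g) and (0, h - g).\<close>

lemma L2_dist2_triangle:
  assumes "f \<in> borel_measurable M" "g \<in> borel_measurable M" "h \<in> borel_measurable M"
  shows "L2_dist2 M f h \<le> 2 * L2_dist2 M f g + 2 * L2_dist2 M g h"
  using L2_dist2_add_le[of f M g "\<lambda>x. g x - g x" "\<lambda>x. h x - g x"] assms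
  by (simp add: L2_dist2_def)

lemma ennreal_four_quarters:
  assumes "e > 0"
  shows "2 * ennreal (e / 4) + 2 * ennreal (e / 4) = ennreal e"
proof -
  have "2 * ennreal (e / 4) = ennreal (e / 2)"
    using assms by (simp flip: ennreal_numeral ennreal_mult')
  then show ?thesis using assms by (simp flip: ennreal_plus)
qed

lemma L2_dist2_less_of_halves:
  assumes "f \<in> borel_measurable M" "g \<in> borel_measurable M" "h \<in> borel_measurable M"
    and "L2_dist2 M f g < ennreal (e / 4)" "L2_dist2 M g h < ennreal (e / 4)"
  shows "L2_dist2 M f h < ennreal e"
proof -
  \<comment> \<open>For e <= 0 the bound \<open>ennreal (e / 4)\<close> would be 0, and nothing lies
    strictly below 0.\<close>
  have e: "e > 0" using assms(4) by (metis divide_nonpos_pos ennreal_neg not_le not_less_zero zero_less_numeral)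
  have "L2_dist2 M f h \<le> 2 * L2_dist2 M f g + 2 * L2_dist2 M g h"
    by (intro L2_dist2_triangle assms)
  also have "\<dots> < 2 * ennreal (e / 4) + 2 * ennreal (e / 4)"
    using assms(4,5) by (intro add_strict_mono ennreal_mult_strict_left_mono) auto
  also have "\<dots> = ennreal e" by (rule ennreal_four_quarters[OF e])
  finally show ?thesis by simp
qed

text \<open>As a set closed under sums, scalars and limits, it lets density be proved along the
  usual ladder of indicators, simple functions and limits. Continuity is asked on the whole space so
  that the approximants are Borel.\<close>

definition L2_closure_cont :: "'a::topological_space measure \<Rightarrow> ('a \<Rightarrow> complex) set" where
  "L2_closure_cont M = {f \<in> borel_measurable M. \<forall>e>0. \<exists>g. continuous_on UNIV g \<and> L2_dist2 M f g < ennreal e}"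

lemma L2_closure_cont_limit:
  assumes M: "sets M = sets borel" and f: "f \<in> borel_measurable M"
    and lim: "\<And>e. e > 0 \<Longrightarrow> \<exists>h\<in>L2_closure_cont M. L2_dist2 M f h < ennreal e"
  shows "f \<in> L2_closure_cont M"
  unfolding L2_closure_cont_def
proof (intro CollectI conjI allI impI f)
  fix e :: real assume e: "e > 0"
  obtain h where h: "h \<in> L2_closure_cont M" "L2_dist2 M f h < ennreal (e / 4)"
    using lim[of "e / 4"] e by auto
  then obtain g where g: "continuous_on UNIV g" "L2_dist2 M h g < ennreal (e / 4)"
    using e unfolding L2_closure_cont_def by (auto dest!: spec[of _ "e / 4"])
  have "g \<in> borel_measurable M"
    using borel_measurable_continuous_onI[OF g(1)] by (simp add: measurable_cong_sets[OF M refl])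
  then have "L2_dist2 M f g < ennreal e"
    using h g f by (intro L2_dist2_less_of_halves[of f M h g]) (auto simp: L2_closure_cont_def)
  with g(1) show "\<exists>g. continuous_on UNIV g \<and> L2_dist2 M f g < ennreal e" by blast
qed

lemma L2_closure_cont_add:
  assumes M: "sets M = sets borel" and "f \<in> L2_closure_cont M" "g \<in> L2_closure_cont M"
  shows "(\<lambda>x. f x + g x) \<in> L2_closure_cont M"
  unfolding L2_closure_cont_def
proof (intro CollectI conjI allI impI)
  show "(\<lambda>x. f x + g x) \<in> borel_measurable M" using assms by (auto simp: L2_closure_cont_def)
  fix e :: real assume e: "e > 0"
  obtain f' where f': "continuous_on UNIV f'" "L2_dist2 M f f' < ennreal (e / 4)"
    using e assms(2) unfolding L2_closure_cont_def by (auto dest!: spec[of _ "e / 4"])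
  obtain g' where g': "continuous_on UNIV g'" "L2_dist2 M g g' < ennreal (e / 4)"
    using e assms(3) unfolding L2_closure_cont_def by (auto dest!: spec[of _ "e / 4"])
  have m: "f' \<in> borel_measurable M" "g' \<in> borel_measurable M"
    using f' g' by (auto simp: measurable_cong_sets[OF M refl] intro!: borel_measurable_continuous_onI)
  have "L2_dist2 M (\<lambda>x. f x + g x) (\<lambda>x. f' x + g' x) \<le> 2 * L2_dist2 M f f' + 2 * L2_dist2 M g g'"
    using assms m by (intro L2_dist2_add_le) (auto simp: L2_closure_cont_def)
  also have "\<dots> < 2 * ennreal (e / 4) + 2 * ennreal (e / 4)"
    using f' g' by (intro add_strict_mono ennreal_mult_strict_left_mono) auto
  also have "\<dots> = ennreal e" by (rule ennreal_four_quarters[OF e])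
  finally show "\<exists>h. continuous_on UNIV h \<and> L2_dist2 M (\<lambda>x. f x + g x) h < ennreal e"
    using f' g' by (intro exI[of _ "\<lambda>x. f' x + g' x"]) (auto intro: continuous_intros)
qed

lemma L2_closure_cont_cmult:
  assumes "f \<in> L2_closure_cont M" and M: "sets M = sets borel"
  shows "(\<lambda>x. c * f x) \<in> L2_closure_cont M"
  unfolding L2_closure_cont_def
proof (intro CollectI conjI allI impI)
  show "(\<lambda>x. c * f x) \<in> borel_measurable M" using assms by (auto simp: L2_closure_cont_def)
  fix e :: real assume e: "e > 0"
  \<comment> \<open>The summand 1 keeps \<open>K\<close> positive when c = 0.\<close>
  define K where "K = (cmod c)\<^sup>2 + 1"
  have K: "K > 0" by (simp add: K_def add_nonneg_pos)
  obtain g where g: "continuous_on UNIV g" "L2_dist2 M f g < ennreal (e / K)"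
    using e K assms(1) unfolding L2_closure_cont_def by (auto dest!: spec[of _ "e / K"])
  have [measurable]: "f \<in> borel_measurable M" "g \<in> borel_measurable M"
    using g assms by (auto simp: L2_closure_cont_def measurable_cong_sets[OF M refl] intro!: borel_measurable_continuous_onI)
  have "L2_dist2 M (\<lambda>x. c * f x) (\<lambda>x. c * g x) = (\<integral>\<^sup>+x. ennreal ((cmod c)\<^sup>2) * ennreal ((cmod (f x - g x))\<^sup>2) \<partial>M)"
    unfolding L2_dist2_def
    by (intro nn_integral_cong)
       (simp flip: ennreal_mult' add: norm_mult power_mult_distrib right_diff_distrib[symmetric])
  also have "\<dots> = ennreal ((cmod c)\<^sup>2) * L2_dist2 M f g"
    unfolding L2_dist2_def by (rule nn_integral_cmult) measurable
  also have "\<dots> \<le> ennreal K * L2_dist2 M f g"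
    by (intro mult_right_mono ennreal_leI) (auto simp: K_def)
  also have "\<dots> < ennreal K * ennreal (e / K)"
    using g K by (intro ennreal_mult_strict_left_mono) auto
  also have "\<dots> = ennreal e"
    using e K by (simp flip: ennreal_mult')
  finally show "\<exists>h. continuous_on UNIV h \<and> L2_dist2 M (\<lambda>x. c * f x) h < ennreal e"
    using g by (intro exI[of _ "\<lambda>x. c * g x"]) (auto intro: continuous_intros)
qed

text \<open>Regularity of a finite Borel measure puts A between a compact K and an open U whose
  difference has measure below e. A Urysohn function for K and the complement of U deviates from the
  indicator only on that difference, and by at most 1.\<close>

lemma L2_closure_cont_indicator:
  fixes M :: "'a::euclidean_space measure"
  assumes fin: "finite_measure M" and M: "sets M = sets borel" and A: "A \<in> sets M"
  shows "(\<lambda>x. indicator A x) \<in> L2_closure_cont M"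
  unfolding L2_closure_cont_def
proof (intro CollectI conjI allI impI)
  show "(\<lambda>x. indicator A x :: complex) \<in> borel_measurable M" using A by simp
  fix e :: real assume e: "e > 0"
  interpret finite_measure M by fact
  have nt: "emeasure M (space M) \<noteq> \<infinity>" by simp
  have AA: "A \<in> sets borel" using A M by simp
  have "\<exists>K. K \<subseteq> A \<and> compact K \<and> emeasure M A < emeasure M K + ennreal (e / 2)"
  proof (cases "emeasure M A = 0")
    case True
    then show ?thesis using e by (intro exI[of _ "{}"]) auto
  next
    case False
    \<comment> \<open>Subtraction of extended reals is truncated at 0, so the strict inequality
      needs A to have positive measure.\<close>
    have "emeasure M A - ennreal (e / 2) < emeasure M A"
      using False e by (intro ennreal_between) (auto simp: zero_less_iff_neq_zero less_top[symmetric])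
    also have "emeasure M A = (SUP K \<in> {K. K \<subseteq> A \<and> compact K}. emeasure M K)"
      by (rule inner_regular[OF M nt AA])
    finally obtain K where K: "K \<subseteq> A" "compact K" "emeasure M A - ennreal (e / 2) < emeasure M K"
      unfolding less_SUP_iff by auto
    then have "emeasure M A < emeasure M K + ennreal (e / 2)"
    proof -
      have "\<not> measure M K \<le> measure M A - e / 2"
        using K(3) e ennreal_leI[of "measure M K" "measure M A - e / 2"]
        by (auto simp: emeasure_eq_measure ennreal_minus)
      then show ?thesis
        using e by (simp add: emeasure_eq_measure ennreal_less_iff flip: ennreal_plus)
    qed
    with K show ?thesis by blast
  qed
  then obtain K where K: "K \<subseteq> A" "compact K" "emeasure M A < emeasure M K + ennreal (e / 2)" by blast
  have "(INF U \<in> {U. A \<subseteq> U \<and> open U}. emeasure M U) < emeasure M A + ennreal (e / 2)"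
    unfolding outer_regular[OF M nt AA, symmetric] using e by simp
  then obtain U where U: "A \<subseteq> U" "open U" "emeasure M U < emeasure M A + ennreal (e / 2)"
    unfolding INF_less_iff by auto
  have sK: "K \<in> sets M" and sU: "U \<in> sets M" using K U by (auto simp: M compact_imp_closed)
  \<comment> \<open>The values lie on the complex segment from 1 to 0, hence are real numbers
    between 0 and 1.\<close>
  obtain h :: "'a \<Rightarrow> complex" where h: "continuous_on UNIV h"
     "\<And>x. h x \<in> closed_segment 1 0" "\<And>x. x \<in> K \<Longrightarrow> h x = 1" "\<And>x. x \<in> - U \<Longrightarrow> h x = 0"
    using K U by (rule_tac Urysohn_local[of UNIV K "- U" 1 0]) (auto simp: compact_imp_closed)
  have bound: "(cmod (indicator A x - h x))\<^sup>2 \<le> indicator (U - K) x" for x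
  proof (cases "x \<in> U - K")
    case True
    obtain t where t: "h x = of_real t" "0 \<le> t" "t \<le> 1"
    proof -
      obtain u where u: "h x = (1 - u) *\<^sub>R 1 + u *\<^sub>R 0" "0 \<le> u" "u \<le> 1"
        using h(2)[of x] unfolding closed_segment_def by blast
      then show ?thesis using that[of "1 - u"] by (simp add: scaleR_conv_of_real)
    qed
    have "cmod (indicator A x - h x) \<le> 1"
    proof (cases "x \<in> A")
      case True
      then have "indicator A x - h x = of_real (1 - t)" using t by simp
      then show ?thesis using t by (simp only: norm_of_real)
    qed (use t in auto)
    then show ?thesis using True by (simp add: power_le_one)
  next
    case False
    then have "x \<in> K \<or> x \<in> - U" by blast
    then show ?thesis using h(3,4)[of x] K(1) U(1) by (auto simp: indicator_def)
  qed
  have "L2_dist2 M (\<lambda>x. indicator A x) h \<le> (\<integral>\<^sup>+x. indicator (U - K) x \<partial>M)"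
    unfolding L2_dist2_def
    by (rule nn_integral_mono) (use ennreal_leI[OF bound] in \<open>simp add: ennreal_indicator\<close>)
  also have "\<dots> = emeasure M (U - K)" using sK sU by simp
  also have "\<dots> = emeasure M U - emeasure M K"
    using K U sK sU by (intro emeasure_Diff) auto
  also have "\<dots> < ennreal e"
  proof -
    have r: "emeasure M U = ennreal (measure M U)" "emeasure M K = ennreal (measure M K)"
       "emeasure M A = ennreal (measure M A)" by (auto simp: emeasure_eq_measure)
    have "measure M A < measure M K + e / 2" "measure M U < measure M A + e / 2"
      using K(3) U(3) e unfolding r by (auto simp: ennreal_less_iff simp flip: ennreal_plus)
    then have "measure M U - measure M K < e" by simp
    then show ?thesis unfolding r using e by (simp add: ennreal_minus ennreal_less_iff ennreal_lessI)
  qed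
  finally show "\<exists>g. continuous_on UNIV g \<and> L2_dist2 M (\<lambda>x. indicator A x) g < ennreal e"
    using h(1) by blast
qed

lemma L2_closure_cont_sum:
  assumes M: "sets M = sets borel" and "\<And>i. i \<in> I \<Longrightarrow> f i \<in> L2_closure_cont M"
  shows "(\<lambda>x. \<Sum>i\<in>I. f i x) \<in> L2_closure_cont M"
  using assms(2)
proof (induction I rule: infinite_finite_induct)
  case (insert i I)
  then show ?case using L2_closure_cont_add[OF M, of "f i" "\<lambda>x. \<Sum>i\<in>I. f i x"] by simp
qed (auto simp: L2_closure_cont_def L2_dist2_def intro!: exI[of _ "\<lambda>_. 0"])

lemma continuous_dense_in_L2:
  fixes M :: "'a::euclidean_space measure"
  assumes fin: "finite_measure M" and M: "sets M = sets borel" and f: "square_integrable M f"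
  shows "f \<in> L2_closure_cont M"
proof (rule L2_closure_cont_limit[OF M])
  show fm[measurable]: "f \<in> borel_measurable M" using f by (simp add: square_integrable_def)
  obtain s where s: "\<And>i. simple_function M (s i)" "\<And>x. x \<in> space M \<Longrightarrow> (\<lambda>i. s i x) \<longlonglongrightarrow> f x"
      "\<And>i x. x \<in> space M \<Longrightarrow> norm (s i x) \<le> 2 * norm (f x)"
    using borel_measurable_implies_sequence_metric[OF fm, of 0] by auto metis
  have [measurable]: "s i \<in> borel_measurable M" for i
    by (rule borel_measurable_simple_function) (rule s)
  have sc: "s i \<in> L2_closure_cont M" for i
  proof -
    have "(\<lambda>x. \<Sum>y\<in>s i ` space M. y * indicator (s i -` {y} \<inter> space M) x) \<in> L2_closure_cont M"
      using s(1)[of i]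
      by (intro L2_closure_cont_sum M L2_closure_cont_cmult L2_closure_cont_indicator fin)
         (auto simp: simple_function_def)
    moreover have "(\<Sum>y\<in>s i ` space M. y * indicator (s i -` {y} \<inter> space M) x) = s i x" for x
    proof -
      have x: "x \<in> space M" using sets_eq_imp_space_eq[OF M] by simp
      have "(\<Sum>y\<in>s i ` space M. y * indicator (s i -` {y} \<inter> space M) x)
         = (\<Sum>y\<in>{s i x}. y * indicator (s i -` {y} \<inter> space M) x)"
        using s(1)[of i] x by (intro sum.mono_neutral_right) (auto simp: simple_function_def)
      with x show ?thesis by simp
    qed
    ultimately show ?thesis by simp
  qed
  have "(\<lambda>i. L2_dist2 M f (s i)) \<longlonglongrightarrow> (\<integral>\<^sup>+x. 0 \<partial>M)"
    unfolding L2_dist2_def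
  \<comment> \<open>The simple functions satisfy |s i| <= 2 |f|, so |f - s i| <= 3 |f|, and 9 is the
    square of 3.\<close>
  proof (rule nn_integral_dominated_convergence[where w = "\<lambda>x. ennreal (9 * (cmod (f x))\<^sup>2)"])
    show "AE x in M. ennreal ((cmod (f x - s i x))\<^sup>2) \<le> ennreal (9 * (cmod (f x))\<^sup>2)" for i
    proof (rule AE_I2)
      fix x assume x: "x \<in> space M"
      have "cmod (f x - s i x) \<le> 3 * cmod (f x)"
        using norm_triangle_ineq4[of "f x" "s i x"] s(3)[OF x, of i] by simp
      then have "(cmod (f x - s i x))\<^sup>2 \<le> (3 * cmod (f x))\<^sup>2" by (rule power_mono) simp
      then show "ennreal ((cmod (f x - s i x))\<^sup>2) \<le> ennreal (9 * (cmod (f x))\<^sup>2)"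
        by (simp add: power_mult_distrib ennreal_leI)
    qed
    show "(\<integral>\<^sup>+x. ennreal (9 * (cmod (f x))\<^sup>2) \<partial>M) < \<infinity>"
      using f by (subst nn_integral_eq_integral) (auto simp: square_integrable_def)
    show "AE x in M. (\<lambda>i. ennreal ((cmod (f x - s i x))\<^sup>2)) \<longlonglongrightarrow> 0"
    proof (rule AE_I2)
      fix x assume x: "x \<in> space M"
      have "(\<lambda>i. (cmod (f x - s i x))\<^sup>2) \<longlonglongrightarrow> (cmod (f x - f x))\<^sup>2"
        by (intro tendsto_intros s x)
      then show "(\<lambda>i. ennreal ((cmod (f x - s i x))\<^sup>2)) \<longlonglongrightarrow> 0"
        using tendsto_ennrealI by fastforce
    qed
  qed measurable
  then have lim: "(\<lambda>i. L2_dist2 M f (s i)) \<longlonglongrightarrow> 0" by simp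
  fix e :: real assume "e > 0"
  then have "eventually (\<lambda>i. L2_dist2 M f (s i) < ennreal e) sequentially"
    by (intro order_tendstoD(2)[OF lim]) simp
  then show "\<exists>h\<in>L2_closure_cont M. L2_dist2 M f h < ennreal e"
    using sc by (auto simp: eventually_sequentially)
qed

section \<open>Matrix coefficients\<close>

text \<open>The form \<open>(\<alpha>\<^sup>* z\<^sub>0 + \<beta>\<^sup>* z\<^sub>1)\<^sup>p (\<alpha> z\<^sub>1 - \<beta> z\<^sub>0)\<^sup>q\<close> dehomogenized at \<open>z\<^sub>1 = 1\<close>, with \<open>p = l + s\<close> and
  \<open>q = l - s\<close>; up to a positive factor its coefficient at \<open>k = l + m\<close> is the Wigner function with
  indices \<open>l, m, s\<close>.\<close>

definition wig_poly :: "nat \<Rightarrow> nat \<Rightarrow> complex^2 \<Rightarrow> complex poly" where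
  "wig_poly p q x = [:cnj (x $ 2), cnj (x $ 1):] ^ p * [:x $ 1, - (x $ 2):] ^ q"

text \<open>Multiplication by \<open>[:b, a:]\<close> is multiplication by the form a x + b y
  dehomogenized at y = 1. A bound n on the degree takes the place of the degree, because leading
  coefficients may vanish.\<close>

lemma homogenized_linear_mult:
  fixes a b :: "'a::comm_ring_1"
  assumes "degree P \<le> n"
  shows "(\<Sum>k\<le>Suc n. coeff ([:b, a:] * P) k * x ^ k * y ^ (Suc n - k))
       = (a * x + b * y) * (\<Sum>k\<le>n. coeff P k * x ^ k * y ^ (n - k))"
proof -
  have c: "coeff ([:b, a:] * P) k = (if k = 0 then 0 else a * coeff P (k - 1)) + (if k \<le> n then b * coeff P k else 0)" for k
    using assms by (cases k) (auto simp: coeff_eq_0)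
  have 1: "(\<Sum>k\<le>Suc n. (if k = 0 then 0 else a * coeff P (k - 1)) * x ^ k * y ^ (Suc n - k))
      = a * x * (\<Sum>k\<le>n. coeff P k * x ^ k * y ^ (n - k))"
    unfolding sum.atMost_Suc_shift by (simp add: sum_distrib_left mult_ac)
  have 2: "(\<Sum>k\<le>Suc n. (if k \<le> n then b * coeff P k else 0) * x ^ k * y ^ (Suc n - k))
      = b * y * (\<Sum>k\<le>n. coeff P k * x ^ k * y ^ (n - k))"
    by (simp add: sum_distrib_left mult_ac Suc_diff_le)
  show ?thesis
    unfolding c distrib_right sum.distrib using 1 2 by simp
qed

lemma wig_poly_Suc_left: "wig_poly (Suc p) q x = [:cnj (x $ 2), cnj (x $ 1):] * wig_poly p q x"
  by (simp add: wig_poly_def mult.assoc del: mult_pCons_left mult_pCons_right)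

lemma wig_poly_Suc_right: "wig_poly p (Suc q) x = [:x $ 1, - (x $ 2):] * wig_poly p q x"
  by (simp add: wig_poly_def mult_ac del: mult_pCons_left mult_pCons_right)

lemma degree_wig_poly: "degree (wig_poly p q x) \<le> p + q"
proof -
  have "degree (wig_poly p q x)
      \<le> degree ([:cnj (x $ 2), cnj (x $ 1):] ^ p) + degree ([:x $ 1, - (x $ 2):] ^ q)"
    unfolding wig_poly_def by (rule degree_mult_le)
  also have "\<dots> \<le> degree [:cnj (x $ 2), cnj (x $ 1):] * p + degree [:x $ 1, - (x $ 2):] * q"
    by (intro add_mono degree_power_le)
  also have "\<dots> \<le> 1 * p + 1 * q"
    by (intro add_mono mult_right_mono) auto
  finally show ?thesis by simp
qed

text \<open>Restores the binary form from its dehomogenization. The formal degree p + q is kept even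
  where the actual degree drops, which happens when a coordinate of x is 0.\<close>

lemma homogenized_wig_poly:
  "(\<Sum>k\<le>p + q. coeff (wig_poly p q x) k * z0 ^ k * z1 ^ (p + q - k))
   = (cnj (x $ 1) * z0 + cnj (x $ 2) * z1) ^ p * (- (x $ 2) * z0 + x $ 1 * z1) ^ q"
proof (induction p)
  case 0
  show ?case
  proof (induction q)
    case 0
    show ?case by (simp add: wig_poly_def)
  next
    case (Suc q)
    then show ?case
      using homogenized_linear_mult[OF degree_wig_poly[of 0 q x]]
      unfolding wig_poly_Suc_right by (simp del: sum.atMost_Suc mult_pCons_left)
  qed
next
  case (Suc p)
  then show ?case
    using homogenized_linear_mult[OF degree_wig_poly[of p q x]]
    unfolding wig_poly_Suc_left by (simp del: sum.atMost_Suc mult_pCons_left)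
qed

lemma spins_half: "spins (real n / 2) = (\<lambda>k. real k - real n / 2) ` {..n}"
  by (simp add: spins_def)

text \<open>Here n = 2 l, k = l + m, p = l + s. The explicit family satisfies the defining identity
  and uniqueness identifies it with the definite description; the quotient of square roots
  compensates the normalization of the weight polynomials.\<close>

lemma wigner_D_half:
  assumes "p \<le> n" "k \<le> n"
  shows "wigner_D (real n / 2) (real k - real n / 2) (real p - real n / 2) g
    = of_real (sqrt (real (n choose p)) / sqrt (real (n choose k)))
       * coeff (wig_poly p (n - p) (column 1 g)) k"
proof -
  let ?l = "real n / 2" and ?s = "real p - real n / 2" and ?x = "column 1 g"
  define w :: "nat \<Rightarrow> complex" where "w j = of_real (sqrt (real (n choose j)))" for j
  define d where "d m = (if m \<in> spins ?l
     then w p / w (nat \<lfloor>m + ?l\<rfloor>) * coeff (wig_poly p (n - p) ?x) (nat \<lfloor>m + ?l\<rfloor>) else 0)" for m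
  have w0: "w j \<noteq> 0" if "j \<le> n" for j using that by (simp add: w_def)
  have x: "?x $ 1 = g $ 1 $ 1" "?x $ 2 = g $ 2 $ 1" by (simp_all add: column_def)
  have wp: "weight_poly ?l (real j - ?l) z0 z1 = w j * z0 ^ j * z1 ^ (n - j)" if "j \<le> n" for j z0 z1
  proof -
    have "?l - (real j - ?l) = real (n - j)" using that by (simp add: of_nat_diff field_simps)
    then have "nat \<lfloor>?l - (real j - ?l)\<rfloor> = n - j" by (simp only: floor_of_nat nat_int)
    then show ?thesis by (simp add: weight_poly_def w_def)
  qed
  have dk: "d (real j - ?l) = w p / w j * coeff (wig_poly p (n - p) ?x) j" if "j \<le> n" for j
    using that by (simp add: d_def spins_half)
  have "is_wigner_family ?l ?s g d"
    unfolding is_wigner_family_def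
  proof (intro conjI allI)
    fix z0 z1
    have "(\<Sum>m\<in>spins ?l. weight_poly ?l m z0 z1 * d m)
        = (\<Sum>j\<le>n. weight_poly ?l (real j - ?l) z0 z1 * d (real j - ?l))"
      unfolding spins_half by (subst sum.reindex) (auto simp: inj_on_def)
    also have "\<dots> = (\<Sum>j\<le>n. w p * (coeff (wig_poly p (n - p) ?x) j * z0 ^ j * z1 ^ (n - j)))"
      by (intro sum.cong) (auto simp: wp dk w0)
    also have "\<dots> = w p * (cnj (?x $ 1) * z0 + cnj (?x $ 2) * z1) ^ p * (- (?x $ 2) * z0 + ?x $ 1 * z1) ^ (n - p)"
      using homogenized_wig_poly[of p "n - p" ?x z0 z1] assms by (simp add: sum_distrib_left[symmetric] mult.assoc)
    finally show "(\<Sum>m\<in>spins ?l. weight_poly ?l m z0 z1 * d m)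
      = (let \<alpha> = g $ 1 $ 1; \<beta> = g $ 2 $ 1
         in weight_poly ?l ?s (cnj \<alpha> * z0 + cnj \<beta> * z1) (- \<beta> * z0 + \<alpha> * z1))"
      using assms by (simp add: Let_def wp x)
  qed (simp add: d_def)
  moreover have "\<exists>!d. is_wigner_family ?l ?s g d"
    by (rule ex1_wigner_family) (use assms in \<open>auto simp: half_nats_def spins_half\<close>)
  ultimately have "(THE d. is_wigner_family ?l ?s g d) = d" by (rule the1_equality[rotated])
  then show ?thesis
    unfolding wigner_D_def using assms by (simp add: dk w_def)
qed

text \<open>The Euler operator is diagonal on monomials, so an operator such as N - X d/dX becomes
  the scalar N - k on the coefficient at k.\<close>

lemma coeff_pderiv_mult_X: "coeff ([:0, 1:] * pderiv P) k = of_nat k * coeff P k"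
  by (cases k) (simp_all add: coeff_pderiv)

lemma pderiv_wig_poly:
  "pderiv (wig_poly p q x) = of_nat p * [:cnj (x $ 1):] * wig_poly (p - 1) q x
     - of_nat q * [:x $ 2:] * wig_poly p (q - 1) x"
proof -
  have *: "pderiv (A ^ m) = of_nat m * A ^ (m - 1) * pderiv A" for A :: "complex poly" and m
    by (cases m) (simp_all add: pderiv_power_Suc of_nat_poly del: of_nat_Suc power_Suc)
  show ?thesis
    unfolding wig_poly_def pderiv_mult * by (simp add: pderiv_pCons algebra_simps)
qed

text \<open>The Leibniz-type formula \<open>\<partial>\<^sub>y (u\<^sup>p v\<^sup>q\<^sup>+\<^sup>1) + p x u\<^sup>p\<^sup>-\<^sup>1 v\<^sup>q = (p + q + 1) a u\<^sup>p v\<^sup>q\<close>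
  for the homogeneous forms \<open>u = a\<^sup>* x + b\<^sup>* y\<close>, \<open>v = a y - b x\<close> (and its three companions),
  dehomogenized at \<open>y = 1\<close>.\<close>

lemma wig_poly_mult_coords:
  fixes p q :: nat
  assumes x: "norm x = 1"
  defines "A \<equiv> [:cnj (x $ 1):]" and "A' \<equiv> [:x $ 1:]" and "B \<equiv> [:cnj (x $ 2):]" and "B' \<equiv> [:x $ 2:]"
    and "X \<equiv> [:0, 1:]" and "N \<equiv> of_nat (p + q + 1)"
  shows "N * A' * wig_poly p q x = N * wig_poly p (Suc q) x - X * pderiv (wig_poly p (Suc q) x)
        + of_nat p * X * wig_poly (p - 1) q x" (is ?th1)
    and "N * B * wig_poly p q x = N * wig_poly (Suc p) q x - X * pderiv (wig_poly (Suc p) q x)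
        - of_nat q * X * wig_poly p (q - 1) x" (is ?th2)
    and "N * B' * wig_poly p q x = of_nat p * wig_poly (p - 1) q x - pderiv (wig_poly p (Suc q) x)" (is ?th3)
    and "N * A * wig_poly p q x = of_nat q * wig_poly p (q - 1) x + pderiv (wig_poly (Suc p) q x)" (is ?th4)
proof -
  have "complex_of_real ((norm x)\<^sup>2) = x $ 1 * cnj (x $ 1) + x $ 2 * cnj (x $ 2)"
    by (simp add: norm_vec_def L2_set_def sum_2 complex_norm_square[symmetric] del: of_real_power)
  \<comment> \<open>The equation of the unit sphere, lifted to constant polynomials;
    \<open>x\<close> enters nowhere else.\<close>
  then have one: "1 = A' * A + B' * B"
    using x by (simp add: A_def A'_def B_def B'_def one_pCons mult.commute)
  have U: "[:cnj (x $ 2), cnj (x $ 1):] = B + A * X" and V: "[:x $ 1, - (x $ 2):] = A' - B' * X"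
    by (simp_all add: A_def A'_def B_def B'_def X_def)
  have w: "wig_poly i j x = (B + A * X) ^ i * (A' - B' * X) ^ j" for i j
    unfolding wig_poly_def U V ..
  have d: "pderiv (wig_poly i j x) = of_nat i * A * wig_poly (i - 1) j x - of_nat j * B' * wig_poly i (j - 1) x" for i j
    unfolding A_def B'_def by (rule pderiv_wig_poly)
  define T where "T = (B + A * X) ^ (p - 1) * (A' - B' * X) ^ q"
  define S where "S = (B + A * X) ^ p * (A' - B' * X) ^ (q - 1)"
  define R where "R = (B + A * X) ^ p * (A' - B' * X) ^ q"
  \<comment> \<open>\<open>T\<close> is \<open>R\<close> with one factor removed. The multiplier
    \<open>of_nat p\<close> saves the relation at p = 0, where the exponent p - 1 is
    truncated.\<close>
  have T: "of_nat p * R = of_nat p * (B + A * X) * T"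
    unfolding T_def R_def by (cases p) (simp_all add: mult_ac)
  have S: "of_nat q * R = of_nat q * (A' - B' * X) * S"
    unfolding S_def R_def by (cases q) (simp_all add: mult_ac)
  have N: "N = of_nat p + of_nat q + 1" by (simp add: N_def)
  \<comment> \<open>The difference of the two sides is written as a combination of the sphere
    equation \<open>one\<close> and the relation \<open>T\<close>, so that it vanishes modulo these;
    the other three identities follow the same pattern.\<close>
  have "N * wig_poly p (Suc q) x - X * pderiv (wig_poly p (Suc q) x) + of_nat p * X * wig_poly (p - 1) q x
      - N * A' * wig_poly p q x
      = of_nat p * X * T * (1 - (A' * A + B' * B))
        + (of_nat p * R - of_nat p * (B + A * X) * T) * (- B' * X)"
    unfolding d unfolding N w by (simp add: algebra_simps T_def R_def)
  then show ?th1 unfolding T one[symmetric] by simp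
  have "N * wig_poly (Suc p) q x - X * pderiv (wig_poly (Suc p) q x) - of_nat q * X * wig_poly p (q - 1) x
      - N * B * wig_poly p q x
      = - of_nat q * X * S * (1 - (A' * A + B' * B))
        + (of_nat q * R - of_nat q * (A' - B' * X) * S) * (A * X)"
    unfolding d unfolding N w by (simp add: algebra_simps S_def R_def)
  then show ?th2 unfolding S one[symmetric] by simp
  have "of_nat p * wig_poly (p - 1) q x - pderiv (wig_poly p (Suc q) x) - N * B' * wig_poly p q x
      = of_nat p * T * (1 - (A' * A + B' * B))
        + (of_nat p * R - of_nat p * (B + A * X) * T) * (- B')"
    unfolding d unfolding N w by (simp add: algebra_simps T_def R_def)
  then show ?th3 unfolding T one[symmetric] by simp
  have "of_nat q * wig_poly p (q - 1) x + pderiv (wig_poly (Suc p) q x) - N * A * wig_poly p q x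
      = of_nat q * S * (1 - (A' * A + B' * B))
        + (of_nat q * R - of_nat q * (A' - B' * X) * S) * (- A)"
    unfolding d unfolding N w by (simp add: algebra_simps S_def R_def)
  then show ?th4 unfolding S one[symmetric] by simp
qed

section \<open>Totality\<close>

text \<open>The rule \<open>on_sphere\<close> identifies functions with equal restrictions to the
  unit sphere, since the multiplication identities hold only there. Degrees and coefficient
  positions are unrestricted; a position beyond the degree gives the zero function.\<close>

inductive_set wig_span :: "(complex^2 \<Rightarrow> complex) set" where
  basis: "(\<lambda>x. coeff (wig_poly p q x) k) \<in> wig_span"
| add: "f \<in> wig_span \<Longrightarrow> g \<in> wig_span \<Longrightarrow> (\<lambda>x. f x + g x) \<in> wig_span"
| cmult: "f \<in> wig_span \<Longrightarrow> (\<lambda>x. c * f x) \<in> wig_span"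
| on_sphere: "f \<in> wig_span \<Longrightarrow> (\<And>x. norm x = 1 \<Longrightarrow> g x = f x) \<Longrightarrow> g \<in> wig_span"

lemma wig_span_basis_X: "(\<lambda>x. coeff ([:0, 1:] * wig_poly p q x) k) \<in> wig_span"
  using cmult[OF basis, of 0] basis by (cases k) auto

lemma wig_span_diff: "f \<in> wig_span \<Longrightarrow> g \<in> wig_span \<Longrightarrow> (\<lambda>x. f x - g x) \<in> wig_span"
  using add[OF _ cmult[of g "-1"]] by simp

text \<open>The multiplication identities carry the positive integer factor p + q + 1 on the left,
  which is divided out here.\<close>

lemma wig_span_lincomb3:
  assumes "f \<in> wig_span" "g \<in> wig_span" "h \<in> wig_span" "n > 0"
    and "\<And>x. norm x = 1 \<Longrightarrow> of_nat n * e x = a * f x + b * g x + c * h x"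
  shows "e \<in> wig_span"
proof (rule on_sphere)
  show "(\<lambda>x. inverse (of_nat n) * ((a * f x + b * g x) + c * h x)) \<in> wig_span"
    by (intro cmult add assms)
  fix x :: "complex^2" assume "norm x = 1"
  show "e x = inverse (of_nat n) * ((a * f x + b * g x) + c * h x)"
    using assms(4) unfolding assms(5)[OF \<open>norm x = 1\<close>, symmetric] by simp
qed

text \<open>Comparing coefficients at k in \<open>wig_poly_mult_coords\<close>: the terms with
  \<open>Suc p\<close> or \<open>Suc q\<close> have formal degree p + q + 1, those with
  \<open>p - 1\<close> or \<open>q - 1\<close> have p + q - 1 and drop out through their factor when
  the exponent is already 0.\<close>

lemma wig_span_mult_coord_basis:
  shows "(\<lambda>x. x $ 1 * coeff (wig_poly p q x) k) \<in> wig_span" (is ?th1)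
    and "(\<lambda>x. cnj (x $ 2) * coeff (wig_poly p q x) k) \<in> wig_span" (is ?th2)
    and "(\<lambda>x. x $ 2 * coeff (wig_poly p q x) k) \<in> wig_span" (is ?th3)
    and "(\<lambda>x. cnj (x $ 1) * coeff (wig_poly p q x) k) \<in> wig_span" (is ?th4)
proof -
  let ?N = "p + q + 1" and ?c = "\<lambda>p q k x. coeff (wig_poly p q x) k"
  have nat_mult: "coeff (of_nat m * P) k = of_nat m * coeff P k"
      "coeff (of_nat m * Q * P) k = of_nat m * coeff (Q * P) k"
      "coeff ([:c:] * P) k = c * coeff P k" for m c and P Q :: "complex poly"
    by (simp_all add: of_nat_poly)
  note rules = nat_mult coeff_diff coeff_add coeff_pderiv_mult_X coeff_pderiv
  show ?th1
  proof (rule wig_span_lincomb3[OF basis wig_span_basis_X basis])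
    fix x :: "complex^2" assume x: "norm x = 1"
    show "of_nat ?N * (x $ 1 * ?c p q k x)
        = (of_nat ?N - of_nat k) * ?c p (Suc q) k x
          + of_nat p * coeff ([:0, 1:] * wig_poly (p - 1) q x) k + 0 * ?c 0 0 0 x"
      using arg_cong[OF wig_poly_mult_coords(1)[OF x, of p q], of "\<lambda>P. coeff P k"]
      unfolding rules by (simp only: left_diff_distrib mult_zero_left add_0_right)
  qed simp
  show ?th2
  proof (rule wig_span_lincomb3[OF basis wig_span_basis_X basis])
    fix x :: "complex^2" assume x: "norm x = 1"
    show "of_nat ?N * (cnj (x $ 2) * ?c p q k x)
        = (of_nat ?N - of_nat k) * ?c (Suc p) q k x
          + - of_nat q * coeff ([:0, 1:] * wig_poly p (q - 1) x) k + 0 * ?c 0 0 0 x"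
      using arg_cong[OF wig_poly_mult_coords(2)[OF x, of p q], of "\<lambda>P. coeff P k"]
      unfolding rules by (simp only: left_diff_distrib mult_zero_left add_0_right) simp
  qed simp
  show ?th3
  proof (rule wig_span_lincomb3[OF basis basis basis])
    fix x :: "complex^2" assume x: "norm x = 1"
    show "of_nat ?N * (x $ 2 * ?c p q k x)
        = of_nat p * ?c (p - 1) q k x + - of_nat (Suc k) * ?c p (Suc q) (Suc k) x + 0 * ?c 0 0 0 x"
      using arg_cong[OF wig_poly_mult_coords(3)[OF x, of p q], of "\<lambda>P. coeff P k"]
      unfolding rules by (simp del: of_nat_Suc of_nat_add)
  qed simp
  show ?th4
  proof (rule wig_span_lincomb3[OF basis basis basis])
    fix x :: "complex^2" assume x: "norm x = 1"
    show "of_nat ?N * (cnj (x $ 1) * ?c p q k x)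
        = of_nat q * ?c p (q - 1) k x + of_nat (Suc k) * ?c (Suc p) q (Suc k) x + 0 * ?c 0 0 0 x"
      using arg_cong[OF wig_poly_mult_coords(4)[OF x, of p q], of "\<lambda>P. coeff P k"]
      unfolding rules by (simp only: mult_zero_left add_0_right)
  qed simp
qed

lemma wig_span_mult_coord:
  assumes "f \<in> wig_span"
  shows "(\<lambda>x. x $ i * f x) \<in> wig_span" and "(\<lambda>x. cnj (x $ i) * f x) \<in> wig_span"
proof -
  have "(\<lambda>x. x $ i * f x) \<in> wig_span \<and> (\<lambda>x. cnj (x $ i) * f x) \<in> wig_span"
    using assms
  proof induction
    case (basis p q k)
    then show ?case
      using exhaust_2[of i] wig_span_mult_coord_basis by auto
  next
    case (add f g)
    then show ?case by (auto simp: distrib_left intro: wig_span.add)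
  next
    case (cmult f c)
    then show ?case by (auto simp: mult.left_commute[of _ c] intro: wig_span.cmult)
  next
    case (on_sphere f g)
    then show ?case
      by (auto intro: wig_span.on_sphere[of "\<lambda>x. x $ i * f x"] wig_span.on_sphere[of "\<lambda>x. cnj (x $ i) * f x"])
  qed
  then show "(\<lambda>x. x $ i * f x) \<in> wig_span" and "(\<lambda>x. cnj (x $ i) * f x) \<in> wig_span" by auto
qed

lemma wig_span_sum: "(\<And>i. i \<in> I \<Longrightarrow> f i \<in> wig_span) \<Longrightarrow> (\<lambda>x. \<Sum>i\<in>I. f i x) \<in> wig_span"
proof (induction I rule: infinite_finite_induct)
  case (insert i I)
  then show ?case using add[of "f i" "\<lambda>x. \<Sum>i\<in>I. f i x"] by simp
qed (use cmult[OF basis, of 0] in auto)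

text \<open>A real functional is a combination of real and imaginary parts of coordinates, and these
  are complex combinations of the coordinates and their conjugates.\<close>

lemma wig_span_mult_linear:
  fixes L :: "complex^2 \<Rightarrow> real"
  assumes L: "linear L" and f: "f \<in> wig_span"
  shows "(\<lambda>x. of_real (L x) * f x) \<in> wig_span"
proof -
  have Lx: "L x = (\<Sum>b\<in>Basis. (x \<bullet> b) * L b)" for x
  proof -
    have "L x = L (\<Sum>b\<in>Basis. (x \<bullet> b) *\<^sub>R b)" by (simp add: euclidean_representation)
    then show ?thesis by (simp add: linear_sum[OF L] linear_scale[OF L])
  qed
  have e: "of_real (L x) * f x = (\<Sum>b\<in>Basis. of_real (L b) * (of_real (x \<bullet> b) * f x))" for x
    by (subst Lx) (simp add: sum_distrib_left mult_ac)
  have "(\<lambda>x. of_real (x \<bullet> b) * f x) \<in> wig_span" if b: "b \<in> Basis" for b :: "complex^2"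
  proof -
    obtain i u where iu: "b = axis i u" "u = 1 \<or> u = \<i>"
      using b by (auto simp: Basis_vec_def Basis_complex_def)
    have re: "of_real (Re z) * w = (1/2) * (z * w + cnj z * w)"
      and im: "of_real (Im z) * w = (- \<i>/2) * (z * w - cnj z * w)" for z w
      by (auto simp: complex_eq_iff field_simps)
    have "(\<lambda>x. of_real (Re (x $ i)) * f x) \<in> wig_span" "(\<lambda>x. of_real (Im (x $ i)) * f x) \<in> wig_span"
      unfolding re im by (intro cmult add wig_span_diff wig_span_mult_coord f)+
    then show ?thesis
      using iu(2) unfolding iu(1) by (auto simp: inner_axis inner_complex_def)
  qed
  then show ?thesis
    unfolding e by (intro wig_span_sum cmult)
qed

text \<open>The statement is about multiplication operators on the span, with f arbitrary, so that
  the case of a product of polynomials is a composition of two operators; closure of the span under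
  products is thereby bypassed.\<close>

lemma wig_span_mult_real_polynomial:
  assumes "real_polynomial_function h" "f \<in> wig_span"
  shows "(\<lambda>x. of_real (h (su2_of_vec x)) * f x) \<in> wig_span"
  using assms
proof (induction arbitrary: f)
  case (linear h)
  have "linear (\<lambda>x. h (su2_of_vec x))"
    using linear_compose[OF linear_su2_of_vec bounded_linear.linear[OF linear(1)]] by (simp add: o_def)
  then show ?case by (rule wig_span_mult_linear) fact
next
  case (const c)
  then show ?case by (intro cmult)
next
  case (add h1 h2)
  have "(\<lambda>x. of_real (h1 (su2_of_vec x)) * f x + of_real (h2 (su2_of_vec x)) * f x) \<in> wig_span"
    by (intro wig_span.add add)
  then show ?case by (simp add: distrib_right)
next
  case (mult h1 h2)
  have "(\<lambda>x. of_real (h1 (su2_of_vec x)) * (of_real (h2 (su2_of_vec x)) * f x)) \<in> wig_span"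
    by (intro mult)
  then show ?case by (simp add: mult.assoc)
qed

lemma polynomial_in_wig_span:
  fixes h :: "complex^2^2 \<Rightarrow> complex"
  assumes "polynomial_function h"
  shows "(\<lambda>x. h (su2_of_vec x)) \<in> wig_span"
proof -
  have one: "(\<lambda>x. 1) \<in> wig_span"
    using basis[of 0 0 0] by (simp add: wig_poly_def)
  have "real_polynomial_function (\<lambda>x. Re (h x))" "real_polynomial_function (\<lambda>x. Im (h x))"
    using assms bounded_linear_Re bounded_linear_Im unfolding polynomial_function_def o_def by blast+
  then have "(\<lambda>x. of_real (Re (h (su2_of_vec x))) * 1 + \<i> * (of_real (Im (h (su2_of_vec x))) * 1)) \<in> wig_span"
    by (intro add cmult wig_span_mult_real_polynomial one)
  moreover have "of_real (Re z) * 1 + \<i> * (of_real (Im z) * 1) = z" for z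
    by (simp add: complex_eq_iff)
  ultimately show ?thesis by simp
qed

text \<open>The triples are (n, p, k) = (2 l, l + s, l + m) with n in A, so one set A of degrees
  governs all admissible weights.\<close>

definition wig_idx :: "nat set \<Rightarrow> (nat \<times> nat \<times> nat) set" where
  "wig_idx A = Sigma A (\<lambda>n. {..n} \<times> {..n})"

lemma finite_wig_idx: "finite A \<Longrightarrow> finite (wig_idx A)"
  by (simp add: wig_idx_def)

text \<open>Turns inductive membership into a finite sum over all indices up to a common degree,
  with coefficients padded by 0. This is the shape that best approximation compares with.\<close>

lemma wig_span_expansion:
  assumes "f \<in> wig_span"
  obtains N c where "\<And>x. norm x = 1 \<Longrightarrow>
    f x = (\<Sum>(n, p, k)\<in>wig_idx {..N}. c n p k * coeff (wig_poly p (n - p) x) k)"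
proof -
  have "\<exists>N c. \<forall>x. norm x = 1 \<longrightarrow>
    f x = (\<Sum>(n, p, k)\<in>wig_idx {..N}. c n p k * coeff (wig_poly p (n - p) x) k)"
    using assms
  proof induction
    case (basis p q k)
    show ?case
    proof (intro exI allI impI)
      fix x :: "complex^2"
      let ?c = "\<lambda>n p' k'. if n = p + q \<and> p' = p \<and> k' = k then 1 else 0"
      have "(\<Sum>(n, p', k')\<in>wig_idx {..p + q}. ?c n p' k' * coeff (wig_poly p' (n - p') x) k')
          = (\<Sum>i\<in>wig_idx {..p + q}. if i = (p + q, p, k) then coeff (wig_poly p q x) k else 0)"
        by (intro sum.cong) (auto split: if_splits)
      also have "\<dots> = (if k \<le> p + q then coeff (wig_poly p q x) k else 0)"
        by (subst sum.delta) (auto simp: finite_wig_idx wig_idx_def)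
      \<comment> \<open>For k > p + q the triple lies outside the index set, and the coefficient is
        0 by the degree bound.\<close>
      also have "\<dots> = coeff (wig_poly p q x) k"
        using degree_wig_poly[of p q x] by (auto intro!: coeff_eq_0)
      finally show "coeff (wig_poly p q x) k
        = (\<Sum>(n, p', k')\<in>wig_idx {..p + q}. ?c n p' k' * coeff (wig_poly p' (n - p') x) k')" ..
    qed
  next
    case (add f g)
    from add.IH(1) obtain N c where
      f: "\<forall>x. norm x = 1 \<longrightarrow> f x = (\<Sum>(n, p, k)\<in>wig_idx {..N}. c n p k * coeff (wig_poly p (n - p) x) k)"
      by (elim exE)
    from add.IH(2) obtain N' c' where
      g: "\<forall>x. norm x = 1 \<longrightarrow> g x = (\<Sum>(n, p, k)\<in>wig_idx {..N'}. c' n p k * coeff (wig_poly p (n - p) x) k)"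
      by (elim exE)
    have ext: "(\<Sum>(n, p, k)\<in>wig_idx {..K}. d n p k * coeff (wig_poly p (n - p) x) k)
      = (\<Sum>(n, p, k)\<in>wig_idx {..N + N'}. (if n \<le> K then d n p k else 0) * coeff (wig_poly p (n - p) x) k)"
      if "K \<le> N + N'" for K d and x :: "complex^2"
      by (rule sum.mono_neutral_cong_left) (use that in \<open>auto simp: finite_wig_idx, auto simp: wig_idx_def\<close>)
    show ?case
    proof (intro exI allI impI)
      fix x :: "complex^2" assume x: "norm x = 1"
      show "f x + g x = (\<Sum>(n, p, k)\<in>wig_idx {..N + N'}.
         ((if n \<le> N then c n p k else 0) + (if n \<le> N' then c' n p k else 0)) * coeff (wig_poly p (n - p) x) k)"
        unfolding f[rule_format, OF x] g[rule_format, OF x] ext[of N, OF le_add1] ext[of N', OF le_add2] sum.distrib[symmetric]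
        by (intro sum.cong) (auto simp: distrib_right)
    qed
  next
    case (cmult f b)
    from cmult.IH obtain N c where
      f: "\<forall>x. norm x = 1 \<longrightarrow> f x = (\<Sum>(n, p, k)\<in>wig_idx {..N}. c n p k * coeff (wig_poly p (n - p) x) k)"
      by (elim exE)
    show ?case
      by (rule exI[of _ N], rule exI[of _ "\<lambda>n p k. b * c n p k"])
         (simp add: f sum_distrib_left case_prod_unfold mult.assoc)
  next
    case (on_sphere f g)
    from on_sphere.IH obtain N c where
      f: "\<forall>x. norm x = 1 \<longrightarrow> f x = (\<Sum>(n, p, k)\<in>wig_idx {..N}. c n p k * coeff (wig_poly p (n - p) x) k)"
      by (elim exE)
    show ?case
      by (rule exI[of _ N], rule exI[of _ c]) (simp add: f on_sphere.hyps)
  qed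
  then show ?thesis using that by blast
qed

text \<open>The density theorem concerns Borel measures on a Euclidean space, whereas
  \<open>su2_vol\<close> lives on the subspace \<open>SU2\<close>. The measure is pushed forward
  along the inclusion into the space of all matrices and f is extended by 0.\<close>

lemma continuous_dense_su2_vol:
  assumes f: "square_integrable su2_vol f" and e: "e > 0"
  obtains g where "continuous_on UNIV g" "L2_dist2 su2_vol f g < ennreal e"
proof -
  define \<nu> where "\<nu> = distr su2_vol borel (\<lambda>g. g)"
  define f' where "f' = (\<lambda>g. indicator SU2 g *\<^sub>R f g)"
  have id[measurable]: "(\<lambda>g. g) \<in> su2_vol \<rightarrow>\<^sub>M borel" by (rule borel_measurable_su2_vol) simp
  have "f \<in> borel_measurable (restrict_space borel SU2)"
    using f measurable_cong_sets[OF sets_su2_vol refl] unfolding square_integrable_def by blast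
  then have [measurable]: "f' \<in> borel_measurable borel"
    unfolding f'_def using compact_SU2
    by (subst (asm) borel_measurable_restrict_space_iff) (auto simp: compact_imp_closed)
  have f'f: "f' g = f g" if "g \<in> SU2" for g using that by (simp add: f'_def)
  have "integrable su2_vol (\<lambda>g. (cmod (f' g))\<^sup>2) = integrable su2_vol (\<lambda>g. (cmod (f g))\<^sup>2)"
    by (rule Bochner_Integration.integrable_cong) (auto simp: f'f)
  then have "integrable \<nu> (\<lambda>g. (cmod (f' g))\<^sup>2)"
    using f unfolding square_integrable_def \<nu>_def by (subst integrable_distr_eq[OF id]) auto
  then have "square_integrable \<nu> f'"
    unfolding square_integrable_def by (simp add: \<nu>_def)
  moreover have "finite_measure \<nu>"
    unfolding \<nu>_def by (rule finite_measure.finite_measure_distr[OF finite_measure_su2_vol]) measurable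
  ultimately have "f' \<in> L2_closure_cont \<nu>"
    by (intro continuous_dense_in_L2) (simp_all add: \<nu>_def)
  then obtain g where g: "continuous_on UNIV g" "L2_dist2 \<nu> f' g < ennreal e"
    using e unfolding L2_closure_cont_def by blast
  have [measurable]: "g \<in> borel_measurable borel" using g by (intro borel_measurable_continuous_onI)
  have "L2_dist2 \<nu> f' g = L2_dist2 su2_vol f g"
    unfolding L2_dist2_def \<nu>_def
    by (subst nn_integral_distr) (auto intro!: nn_integral_cong simp: f'f)
  with g that show ?thesis by metis
qed

lemma wigner_total:
  assumes f: "square_integrable su2_vol f" and e: "e > 0"
  obtains N c where "L2_dist2 su2_vol f
     (\<lambda>g. \<Sum>(n, p, k)\<in>wig_idx {..N}. c n p k * coeff (wig_poly p (n - p) (column 1 g)) k) < ennreal e"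
proof -
  obtain h where h: "continuous_on UNIV h" "L2_dist2 su2_vol f h < ennreal (e / 4)"
    using continuous_dense_su2_vol[OF f, of "e / 4"] e by auto
  \<comment> \<open>With total volume 16 pi^2, a uniform error \<delta> costs at most \<delta>^2 *
    16 pi^2 = e / 16 in squared distance, below the allowed e / 4.\<close>
  define \<delta> where "\<delta> = sqrt e / (16 * pi)"
  have \<delta>: "\<delta> > 0" using e by (simp add: \<delta>_def)
  have "continuous_on SU2 h" using h(1) by (rule continuous_on_subset) simp
  then obtain r where r: "polynomial_function r" "\<And>g. g \<in> SU2 \<Longrightarrow> cmod (h g - r g) < \<delta>"
    using Stone_Weierstrass_polynomial_function[OF compact_SU2 _ \<delta>] by metis
  have m: "f \<in> borel_measurable su2_vol" "h \<in> borel_measurable su2_vol" "r \<in> borel_measurable su2_vol"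
    using f h(1) r(1) unfolding square_integrable_def
    by (auto intro!: borel_measurable_su2_vol borel_measurable_continuous_onI continuous_on_polymonial_function)
  have "L2_dist2 su2_vol h r \<le> (\<integral>\<^sup>+g. ennreal (\<delta>\<^sup>2) \<partial>su2_vol)"
    unfolding L2_dist2_def
    by (intro nn_integral_mono ennreal_leI power_mono) (use r(2) in \<open>auto intro: less_imp_le\<close>)
  also have "\<dots> = ennreal (\<delta>\<^sup>2) * ennreal (16 * pi\<^sup>2)"
    by (simp add: emeasure_su2_vol)
  also have "\<dots> = ennreal (e / 16)"
    using e by (simp add: \<delta>_def power_divide power_mult_distrib flip: ennreal_mult')
  also have "\<dots> < ennreal (e / 4)"
    using e by (simp add: ennreal_less_iff)
  finally have fr: "L2_dist2 su2_vol f r < ennreal e"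
    using L2_dist2_less_of_halves[OF m h(2)] by simp
  obtain N c where c: "\<And>x. norm x = 1 \<Longrightarrow>
    r (su2_of_vec x) = (\<Sum>(n, p, k)\<in>wig_idx {..N}. c n p k * coeff (wig_poly p (n - p) x) k)"
    by (rule wig_span_expansion[OF polynomial_in_wig_span[OF r(1)]]) (rule that)
  have eq: "L2_dist2 su2_vol f r = L2_dist2 su2_vol f
     (\<lambda>g. \<Sum>(n, p, k)\<in>wig_idx {..N}. c n p k * coeff (wig_poly p (n - p) (column 1 g)) k)"
    unfolding L2_dist2_def
  proof (rule nn_integral_cong)
    fix g assume "g \<in> space su2_vol"
    then have g: "g \<in> SU2" by simp
    show "ennreal ((cmod (f g - r g))\<^sup>2) = ennreal ((cmod (f g
      - (\<Sum>(n, p, k)\<in>wig_idx {..N}. c n p k * coeff (wig_poly p (n - p) (column 1 g)) k)))\<^sup>2)"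
      using c[OF norm_column_SU2[OF g]] by (simp add: su2_of_vec_column[OF g])
  qed
  show ?thesis by (rule that) (rule fr[unfolded eq])
qed

section \<open>Orthogonality\<close>

lemma norm_complex2: "(norm (x :: complex^2))\<^sup>2 = (cmod (x $ 1))\<^sup>2 + (cmod (x $ 2))\<^sup>2"
  by (simp add: norm_vec_def L2_set_def sum_2)

text \<open>This is left multiplication by \<open>su2_mat a b\<close>, read on the first
  column.\<close>

lemma orthogonal_transformation_left:
  assumes "(cmod a)\<^sup>2 + (cmod b)\<^sup>2 = 1"
  shows "orthogonal_transformation (\<lambda>x::complex^2. vector [a * x $ 1 - cnj b * x $ 2, b * x $ 1 + cnj a * x $ 2] :: complex^2)"
    (is "orthogonal_transformation ?T")
  unfolding orthogonal_transformation
proof (intro conjI allI)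
  show "linear ?T"
    by (rule linearI) (auto simp: vec_eq_iff forall_2 algebra_simps)
  fix x :: "complex^2"
  have "complex_of_real ((norm (?T x))\<^sup>2) = complex_of_real (((cmod a)\<^sup>2 + (cmod b)\<^sup>2) * (norm x)\<^sup>2)"
    unfolding norm_complex2 of_real_add of_real_mult complex_norm_square by (simp add: algebra_simps)
  then have "(norm (?T x))\<^sup>2 = (norm x)\<^sup>2"
    unfolding assms of_real_eq_iff by simp
  then show "norm (?T x) = norm x" by simp
qed

text \<open>This is right multiplication by the diagonal matrix with entries c and its conjugate,
  read on the first column.\<close>

lemma orthogonal_transformation_phase:
  assumes "cmod c = 1"
  shows "orthogonal_transformation (\<lambda>x::complex^2. c *s x :: complex^2)"
  unfolding orthogonal_transformation
proof (intro conjI allI)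
  show "linear (\<lambda>x::complex^2. c *s x :: complex^2)"
    by (rule linearI) (auto simp: vec_eq_iff algebra_simps)
  fix x :: "complex^2"
  have "(norm (c *s x))\<^sup>2 = (norm x)\<^sup>2"
    unfolding norm_complex2 by (simp add: norm_mult assms)
  then show "norm (c *s x) = norm x" by simp
qed

lemma continuous_wig_coeff [continuous_intros]: "continuous_on S (\<lambda>x. coeff (wig_poly p q x) k)"
proof -
  have step: "continuous_on S (\<lambda>x. coeff ([:b x, a x:] * P x) k)"
    if "\<And>k. continuous_on S (\<lambda>x. coeff (P x) k)" "continuous_on S a" "continuous_on S b"
    for a b :: "complex^2 \<Rightarrow> complex" and P k
    using that by (cases k) (auto intro!: continuous_intros)
  have right: "continuous_on S (\<lambda>x. coeff (wig_poly 0 q x) k)" for k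
  proof (induction q arbitrary: k)
    case (Suc q)
    show ?case unfolding wig_poly_Suc_right by (intro step Suc continuous_intros)
  qed (simp add: wig_poly_def)
  show ?thesis
  proof (induction p arbitrary: k)
    case (Suc p)
    show ?case unfolding wig_poly_Suc_left by (intro step Suc continuous_intros)
  qed (rule right)
qed

lemma integrable_su2_vol_continuous:
  fixes f :: "complex^2 \<Rightarrow> 'b::{banach, second_countable_topology}"
  assumes "continuous_on UNIV f"
  shows "integrable su2_vol (\<lambda>g. f (column 1 g))"
proof -
  interpret finite_measure su2_vol by (rule finite_measure_su2_vol)
  have [measurable]: "f \<in> borel_measurable borel"
    using assms by (rule borel_measurable_continuous_onI)
  have "compact (f ` sphere 0 1)"
    using assms by (intro compact_continuous_image) (auto intro: continuous_on_subset)
  then have "bounded (f ` sphere 0 1)" by (rule compact_imp_bounded)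
  then obtain B where B: "\<And>y. y \<in> f ` sphere 0 1 \<Longrightarrow> norm y \<le> B"
    unfolding bounded_iff by blast
  show ?thesis
  proof (rule integrable_const_bound[of _ B])
    show "AE g in su2_vol. norm (f (column 1 g)) \<le> B"
      by (rule AE_I2) (auto intro!: B simp: norm_column_SU2)
  qed measurable
qed

text \<open>The arguments are functions on the ambient space and not on \<open>SU2\<close>, so that
  rotations act on them by composition.\<close>

definition su2_inner :: "(complex^2 \<Rightarrow> complex) \<Rightarrow> (complex^2 \<Rightarrow> complex) \<Rightarrow> complex" where
  "su2_inner f h = (\<integral>g. f (column 1 g) * cnj (h (column 1 g)) \<partial>su2_vol)"

lemma su2_inner_commute: "su2_inner h f = cnj (su2_inner f h)"
  unfolding su2_inner_def by (simp add: mult.commute flip: Bochner_Integration.integral_cnj)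

lemma su2_inner_orthogonal_transformation:
  assumes "orthogonal_transformation T" "continuous_on UNIV f" "continuous_on UNIV h"
  shows "su2_inner (\<lambda>x. f (T x)) (\<lambda>x. h (T x)) = su2_inner f h"
  unfolding su2_inner_def
  using assms by (intro integral_su2_vol_orthogonal_transformation[of T "\<lambda>x. f x * cnj (h x)"]
        borel_measurable_continuous_onI continuous_intros)

lemma su2_inner_sum_left:
  assumes "\<And>i. i \<in> I \<Longrightarrow> continuous_on UNIV (f i)" "continuous_on UNIV h"
  shows "su2_inner (\<lambda>x. \<Sum>i\<in>I. c i * f i x) h = (\<Sum>i\<in>I. c i * su2_inner (f i) h)"
proof -
  have "su2_inner (\<lambda>x. \<Sum>i\<in>I. c i * f i x) h
      = (\<integral>g. (\<Sum>i\<in>I. c i * (f i (column 1 g) * cnj (h (column 1 g)))) \<partial>su2_vol)"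
    unfolding su2_inner_def by (simp add: sum_distrib_right mult.assoc)
  also have "\<dots> = (\<Sum>i\<in>I. (\<integral>g. c i * (f i (column 1 g) * cnj (h (column 1 g))) \<partial>su2_vol))"
    using assms by (intro Bochner_Integration.integral_sum integrable_mult_right
      integrable_su2_vol_continuous[of "\<lambda>x. f _ x * cnj (h x)"] continuous_intros)
  finally show ?thesis by (simp add: su2_inner_def)
qed

lemma su2_inner_cmult:
  "su2_inner (\<lambda>x. a * f x) (\<lambda>x. b * h x) = a * cnj b * su2_inner f h"
proof -
  have "su2_inner (\<lambda>x. a * f x) (\<lambda>x. b * h x) = (\<integral>g. (a * cnj b) * (f (column 1 g) * cnj (h (column 1 g))) \<partial>su2_vol)"
    unfolding su2_inner_def by (simp add: mult_ac)
  then show ?thesis by (simp add: su2_inner_def)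
qed

lemma eq_0_if_phase_covariant:
  assumes "\<And>c. cmod c = 1 \<Longrightarrow> J = c ^ a * cnj c ^ b * J" and "a \<noteq> b"
  shows "J = 0"
proof -
  \<comment> \<open>Chosen so that the phase \<open>cis t\<close> contributes exp(i (a - b) t) = -1,
    which leaves J = - J.\<close>
  define t where "t = pi / (real a - real b)"
  have "cis t ^ a * cnj (cis t) ^ b = cis ((real a - real b) * t)"
    by (simp add: cis_cnj Complex.DeMoivre cis_mult algebra_simps)
  also have "\<dots> = -1" using assms(2) by (simp add: t_def)
  finally show ?thesis using assms(1)[of "cis t"] by simp
qed

text \<open>Each of the p first factors contributes the conjugate of c and each of the q others
  contributes c, so the right weight is q - p = - 2 s for every k.\<close>

lemma wig_coeff_phase:
  "coeff (wig_poly p q (c *s x)) k = c ^ q * cnj c ^ p * coeff (wig_poly p q x) k"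
proof -
  have 1: "[:cnj ((c *s x) $ 2), cnj ((c *s x) $ 1):] = smult (cnj c) [:cnj (x $ 2), cnj (x $ 1):]"
    and 2: "[:(c *s x) $ 1, - (c *s x) $ 2:] = smult c [:x $ 1, - x $ 2:]"
    by simp_all
  show ?thesis unfolding wig_poly_def 1 2 smult_power by (simp add: mult_ac)
qed

text \<open>Up to the factor c, the torus rescales the variable of each linear factor by the squared
  conjugate of c. The coefficient at k therefore has left weight p + q - 2 k = - 2 m.\<close>

lemma wig_coeff_left_torus:
  assumes "cmod c = 1"
  shows "coeff (wig_poly p q (vector [c * x $ 1, cnj c * x $ 2])) k
       = c ^ (p + q) * cnj c ^ (2 * k) * coeff (wig_poly p q x) k"
proof -
  have c: "c * cnj c = 1" using assms by (simp flip: complex_norm_square)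
  have c2: "cnj c = c * (cnj c)\<^sup>2"
    using c by (simp add: power2_eq_square mult.assoc[symmetric])
  let ?y = "vector [c * x $ 1, cnj c * x $ 2] :: complex^2" and ?Z = "[:0, (cnj c)\<^sup>2:]"
  have 1: "[:cnj (?y $ 2), cnj (?y $ 1):] = smult c (pcompose [:cnj (x $ 2), cnj (x $ 1):] ?Z)"
    and 2: "[:?y $ 1, - ?y $ 2:] = smult c (pcompose [:x $ 1, - x $ 2:] ?Z)"
    using c2 by (simp_all add: pcompose_pCons mult.assoc mult.left_commute)
  have pow: "pcompose P ?Z ^ m = pcompose (P ^ m) ?Z" for P m
    by (induction m) (simp_all add: pcompose_mult pcompose_1)
  have "wig_poly p q ?y = smult (c ^ (p + q)) (pcompose (wig_poly p q x) ?Z)"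
    unfolding wig_poly_def 1 2 smult_power pow pcompose_mult by (simp add: power_add mult_ac)
  then show ?thesis
    by (simp add: coeff_pcompose_linear power_mult mult.assoc)
qed

text \<open>The hypothesis says q - p and q' - p' differ, in a form free of subtraction on natural
  numbers.\<close>

lemma su2_inner_orthogonal_right_weight:
  assumes "q + p' \<noteq> p + q'"
  shows "su2_inner (\<lambda>x. coeff (wig_poly p q x) k) (\<lambda>x. coeff (wig_poly p' q' x) k') = 0" (is "su2_inner ?f ?h = 0")
proof (rule eq_0_if_phase_covariant)
  fix c assume c: "cmod c = 1"
  have "su2_inner ?f ?h = su2_inner (\<lambda>x. ?f (c *s x)) (\<lambda>x. ?h (c *s x))"
    by (intro su2_inner_orthogonal_transformation[symmetric] orthogonal_transformation_phase[OF c] continuous_wig_coeff)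
  also have "\<dots> = c ^ (q + p') * cnj c ^ (p + q') * su2_inner ?f ?h"
    unfolding wig_coeff_phase su2_inner_cmult by (simp add: power_add mult_ac)
  finally show "su2_inner ?f ?h = c ^ (q + p') * cnj c ^ (p + q') * su2_inner ?f ?h" .
qed fact

lemma su2_inner_orthogonal_left_weight:
  assumes "p + q + 2 * k' \<noteq> p' + q' + 2 * k"
  shows "su2_inner (\<lambda>x. coeff (wig_poly p q x) k) (\<lambda>x. coeff (wig_poly p' q' x) k') = 0" (is "su2_inner ?f ?h = 0")
proof (rule eq_0_if_phase_covariant)
  fix c assume c: "cmod c = 1"
  \<comment> \<open>Left multiplication by the diagonal torus; the zero entries are written out to
    match \<open>orthogonal_transformation_left\<close> at b = 0.\<close>
  let ?T = "\<lambda>x::complex^2. vector [c * x $ 1 - cnj 0 * x $ 2, 0 * x $ 1 + cnj c * x $ 2] :: complex^2"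
  have "su2_inner ?f ?h = su2_inner (\<lambda>x. ?f (?T x)) (\<lambda>x. ?h (?T x))"
    by (intro su2_inner_orthogonal_transformation[symmetric] orthogonal_transformation_left continuous_wig_coeff)
       (simp add: c)
  also have "\<dots> = su2_inner (\<lambda>x. ?f (vector [c * x $ 1, cnj c * x $ 2])) (\<lambda>x. ?h (vector [c * x $ 1, cnj c * x $ 2]))"
    by simp
  also have "\<dots> = c ^ (p + q + 2 * k') * cnj c ^ (p' + q' + 2 * k) * su2_inner ?f ?h"
    unfolding wig_coeff_left_torus[OF c] su2_inner_cmult by (simp add: power_add mult_ac)
  finally show "su2_inner ?f ?h = c ^ (p + q + 2 * k') * cnj c ^ (p' + q' + 2 * k) * su2_inner ?f ?h" .
qed fact

text \<open>The generating form of the coefficients of \<open>wig_poly\<close>, seen as a function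
  of x with z fixed: a product of powers of two linear forms, the first antiholomorphic and the
  second holomorphic in x.\<close>

definition wig_kernel :: "nat \<Rightarrow> nat \<Rightarrow> complex \<Rightarrow> complex \<Rightarrow> complex^2 \<Rightarrow> complex" where
  "wig_kernel p q z0 z1 x = (cnj (x $ 1) * z0 + cnj (x $ 2) * z1) ^ p * (- (x $ 2) * z0 + x $ 1 * z1) ^ q"

lemma wig_kernel_eq:
  "wig_kernel p q z0 z1 = (\<lambda>x. \<Sum>k\<le>p + q. (z0 ^ k * z1 ^ (p + q - k)) * coeff (wig_poly p q x) k)"
  unfolding wig_kernel_def homogenized_wig_poly[symmetric] by (simp add: mult_ac)

lemma continuous_wig_kernel: "continuous_on S (wig_kernel p q z0 z1)"
  unfolding wig_kernel_def by (intro continuous_intros)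

lemma su2_inner_wig_kernel_left:
  assumes "continuous_on UNIV h"
  shows "su2_inner (wig_kernel p q z0 z1) h
     = (\<Sum>k\<le>p + q. (z0 ^ k * z1 ^ (p + q - k)) * su2_inner (\<lambda>x. coeff (wig_poly p q x) k) h)"
  unfolding wig_kernel_eq by (intro su2_inner_sum_left continuous_wig_coeff assms)

text \<open>By rotation invariance one may assume \<open>z = (r, 0)\<close>; then only the highest weight vector
  of the larger representation is involved, and the smaller one has no such weight.\<close>

lemma su2_inner_wig_kernel:
  assumes less: "p' + q' < p + q"
  shows "su2_inner (wig_kernel p q z0 z1) (wig_kernel p' q' w0 w1) = 0"
proof (cases "z0 = 0 \<and> z1 = 0")
  case True
  then have "wig_kernel p q z0 z1 = (\<lambda>x. 0)"
    using less by (auto simp: wig_kernel_def fun_eq_iff)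
  then show ?thesis by (simp add: su2_inner_def)
next
  case False
  define r where "r = sqrt ((cmod z0)\<^sup>2 + (cmod z1)\<^sup>2)"
  have r2: "r\<^sup>2 = (cmod z0)\<^sup>2 + (cmod z1)\<^sup>2" by (simp add: r_def)
  have r0: "r \<noteq> 0" using False by (auto simp: r_def add_nonneg_eq_0_iff)
  define a b where "a = z0 / of_real r" and "b = z1 / of_real r"
  have ab: "(cmod a)\<^sup>2 + (cmod b)\<^sup>2 = 1"
    using r0 by (simp add: a_def b_def norm_divide power_divide r2[symmetric] flip: add_divide_distrib)
  have ab': "cnj a * a + cnj b * b = 1"
    using arg_cong[OF ab, of complex_of_real] unfolding of_real_add complex_norm_square by (simp add: mult.commute)
  have z: "z0 = of_real r * a" "z1 = of_real r * b" using r0 by (simp_all add: a_def b_def)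
  let ?T = "\<lambda>x::complex^2. vector [a * x $ 1 - cnj b * x $ 2, b * x $ 1 + cnj a * x $ 2] :: complex^2"
  \<comment> \<open>Rotating x by a unitary matrix amounts to applying its adjoint to z.\<close>
  have rot: "wig_kernel i j y0 y1 (?T x) = wig_kernel i j (cnj a * y0 + cnj b * y1) (- b * y0 + a * y1) x" for i j y0 y1 x
    unfolding wig_kernel_def by (intro arg_cong2[where f = "(*)"] arg_cong2[where f = "(^)"]) (auto simp: algebra_simps)
  have z': "cnj a * z0 + cnj b * z1 = of_real r" "- b * z0 + a * z1 = 0"
  proof -
    have "cnj a * z0 + cnj b * z1 = of_real r * (cnj a * a + cnj b * b)"
      unfolding z by (simp add: algebra_simps)
    then show "cnj a * z0 + cnj b * z1 = of_real r" using ab' by simp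
  qed (simp add: z)
  let ?w0 = "cnj a * w0 + cnj b * w1" and ?w1 = "- b * w0 + a * w1"
  have "su2_inner (wig_kernel p q z0 z1) (wig_kernel p' q' w0 w1)
      = su2_inner (\<lambda>x. wig_kernel p q z0 z1 (?T x)) (\<lambda>x. wig_kernel p' q' w0 w1 (?T x))"
    by (intro su2_inner_orthogonal_transformation[symmetric] orthogonal_transformation_left[OF ab] continuous_wig_kernel)
  also have "\<dots> = su2_inner (wig_kernel p q (of_real r) 0) (wig_kernel p' q' ?w0 ?w1)"
    unfolding rot z' ..
  also have "\<dots> = (\<Sum>k\<le>p + q. (of_real r ^ k * 0 ^ (p + q - k))
        * su2_inner (\<lambda>x. coeff (wig_poly p q x) k) (wig_kernel p' q' ?w0 ?w1))"
    by (rule su2_inner_wig_kernel_left) (rule continuous_wig_kernel)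
  also have "\<dots> = 0"
  proof (rule sum.neutral, rule ballI)
    fix k assume k: "k \<in> {..p + q}"
    show "of_real r ^ k * 0 ^ (p + q - k)
        * su2_inner (\<lambda>x. coeff (wig_poly p q x) k) (wig_kernel p' q' ?w0 ?w1) = 0"
    proof (cases "k = p + q")
      case True
      \<comment> \<open>At k = p + q the left weight is - (p + q), while the smaller form has only
        weights p' + q' - 2 k' >= - (p' + q') > - (p + q).\<close>
      have "su2_inner (wig_kernel p' q' ?w0 ?w1) (\<lambda>x. coeff (wig_poly p q x) k) = 0"
        unfolding su2_inner_wig_kernel_left[OF continuous_wig_coeff]
        by (intro sum.neutral ballI) (use less True in \<open>auto intro!: su2_inner_orthogonal_left_weight\<close>)
      then show ?thesis by (subst su2_inner_commute) simp
    qed (use k in simp)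
  qed
  finally show ?thesis .
qed

text \<open>The inner product of two kernels is polynomial in z, so its vanishing for all z kills
  every coefficient. The parameter w enters through its conjugate, hence the exchange of arguments
  before the same argument is applied to w.\<close>

lemma su2_inner_orthogonal_degree:
  assumes less: "p' + q' < p + q" and k: "k \<le> p + q" "k' \<le> p' + q'"
  shows "su2_inner (\<lambda>x. coeff (wig_poly p q x) k) (\<lambda>x. coeff (wig_poly p' q' x) k') = 0"
proof -
  let ?f = "\<lambda>k x. coeff (wig_poly p q x) k" and ?h = "\<lambda>k x. coeff (wig_poly p' q' x) k"
  have "su2_inner (?f k) (wig_kernel p' q' w 1) = 0" for w
  proof -
    have "(\<Sum>k\<le>p + q. su2_inner (?f k) (wig_kernel p' q' w 1) * z ^ k) = 0" for z
      using su2_inner_wig_kernel[OF less, of z 1 w 1]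
      unfolding su2_inner_wig_kernel_left[OF continuous_wig_kernel] by (simp add: mult.commute)
    then show ?thesis using polyfun_eq_0[of "\<lambda>k. su2_inner (?f k) (wig_kernel p' q' w 1)" "p + q"] k by blast
  qed
  then have "su2_inner (wig_kernel p' q' w 1) (?f k) = 0" for w
    by (subst su2_inner_commute) simp
  then have "(\<Sum>k'\<le>p' + q'. su2_inner (?h k') (?f k) * w ^ k') = 0" for w
    unfolding su2_inner_wig_kernel_left[OF continuous_wig_coeff] by (simp add: mult.commute)
  then have "su2_inner (?h k') (?f k) = 0"
    using polyfun_eq_0[of "\<lambda>k'. su2_inner (?h k') (?f k)" "p' + q'"] k by blast
  then show ?thesis by (subst su2_inner_commute) simp
qed

lemma wigner_orthogonal:
  assumes "(n, p, k) \<in> wig_idx A" "(n', p', k') \<in> wig_idx A" "(n, p, k) \<noteq> (n', p', k')"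
  shows "su2_inner (\<lambda>x. coeff (wig_poly p (n - p) x) k) (\<lambda>x. coeff (wig_poly p' (n' - p') x) k') = 0"
proof -
  have le: "p \<le> n" "k \<le> n" "p' \<le> n'" "k' \<le> n'" using assms by (auto simp: wig_idx_def)
  consider "n < n'" | "n' < n" | "n = n'" "p \<noteq> p'" | "n = n'" "k \<noteq> k'" using assms(3) by fastforce
  then show ?thesis
  proof cases
    case 1
    then have "su2_inner (\<lambda>x. coeff (wig_poly p' (n' - p') x) k') (\<lambda>x. coeff (wig_poly p (n - p) x) k) = 0"
      using le by (intro su2_inner_orthogonal_degree) auto
    then show ?thesis by (subst su2_inner_commute) simp
  next
    case 2
    then show ?thesis using le by (intro su2_inner_orthogonal_degree) auto
  next
    case 3
    then show ?thesis using le by (intro su2_inner_orthogonal_right_weight) auto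
  next
    case 4
    then show ?thesis using le by (intro su2_inner_orthogonal_left_weight) auto
  qed
qed

section \<open>Harmonicity\<close>

text \<open>Discrete Fourier inversion over the roots of unity of order \<open>p + q + 1\<close>.\<close>

lemma wig_coeff_eq_kernels:
  assumes "k \<le> p + q"
  obtains c z where "\<And>x. coeff (wig_poly p q x) k = (\<Sum>j<p + q + 1. c j * wig_kernel p q (z j) 1 x)"
proof -
  define n where "n = p + q + 1"
  have n: "n \<ge> 1" by (simp add: n_def)
  define \<zeta> where "\<zeta> = exp (2 * of_real pi * \<i> / of_nat n)"
  have root: "\<zeta> ^ j = 1 \<longleftrightarrow> n dvd j" for j
    using complex_root_unity_eq_1[OF n, of j] by (simp add: \<zeta>_def exp_of_nat_mult[symmetric] mult_ac)
  have orth: "(\<Sum>j<n. (\<zeta> ^ (n - k + i)) ^ j) = (if i = k then of_nat n else 0)" if "i < n" for i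
  proof -
    \<comment> \<open>The exponent n - k replaces - k among natural numbers. As n - k + i lies
      strictly between 0 and 2 n, divisibility by n forces the value n.\<close>
    have dvd: "n dvd n - k + i \<longleftrightarrow> i = k"
    proof
      assume "n dvd n - k + i"
      then obtain m where m: "n - k + i = n * m" by blast
      then have "n * m < n * 2" "n * 0 < n * m" using that assms by (auto simp: n_def)
      then have "m = 1" unfolding mult_less_cancel1 by auto
      then show "i = k" using m assms by (auto simp: n_def)
    qed (use assms in \<open>auto simp: n_def\<close>)
    have "(\<zeta> ^ (n - k + i)) ^ n = 1"
      unfolding power_mult[symmetric] root by simp
    then show ?thesis
      using dvd root[of "n - k + i"] by (simp add: sum_gp_strict)
  qed
  have "coeff (wig_poly p q x) k
      = (\<Sum>j<n. ((\<zeta> ^ (n - k)) ^ j / of_nat n) * wig_kernel p q (\<zeta> ^ j) 1 x)" for x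
  proof -
    have "(\<Sum>j<n. (\<zeta> ^ (n - k)) ^ j * wig_kernel p q (\<zeta> ^ j) 1 x)
        = (\<Sum>j<n. \<Sum>i<n. (\<zeta> ^ (n - k + i)) ^ j * coeff (wig_poly p q x) i)"
      unfolding wig_kernel_eq sum_distrib_left
      by (intro sum.cong)
         (auto simp: n_def lessThan_Suc_atMost power_mult[symmetric] power_add[symmetric] algebra_simps
               simp flip: mult.assoc)
    also have "\<dots> = (\<Sum>i<n. (\<Sum>j<n. (\<zeta> ^ (n - k + i)) ^ j) * coeff (wig_poly p q x) i)"
      by (subst sum.swap) (simp add: sum_distrib_right)
    also have "\<dots> = (\<Sum>i<n. if i = k then of_nat n * coeff (wig_poly p q x) i else 0)"
      by (intro sum.cong) (auto simp: orth)
    also have "\<dots> = of_nat n * coeff (wig_poly p q x) k"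
      using assms by (subst sum.delta) (auto simp: n_def)
    finally show ?thesis
      using n by (simp add: sum_divide_distrib[symmetric])
  qed
  then show ?thesis unfolding n_def by (rule that)
qed

lemma has_vector_derivative_power:
  fixes f :: "real \<Rightarrow> complex"
  assumes "(f has_vector_derivative f') (at t)"
  shows "((\<lambda>t. f t ^ n) has_vector_derivative of_nat n * f t ^ (n - 1) * f') (at t)"
proof -
  have "((\<lambda>z. z ^ n) has_field_derivative of_nat n * f t ^ (n - 1)) (at (f t))"
    using DERIV_pow2[of n] by (auto intro!: derivative_eq_intros)
  from field_vector_diff_chain_at[OF assms this] show ?thesis
    by (simp add: o_def mult_ac)
qed

lemma has_vector_derivative_power_prod:
  fixes f g :: "real \<Rightarrow> complex"
  assumes "(f has_vector_derivative f') (at t)" "(g has_vector_derivative g') (at t)"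
  shows "((\<lambda>t. f t ^ p * g t ^ q) has_vector_derivative
     of_nat p * f t ^ (p - 1) * g t ^ q * f' + of_nat q * f t ^ p * g t ^ (q - 1) * g') (at t)"
  using has_vector_derivative_mult[OF has_vector_derivative_power[OF assms(1), of p]
      has_vector_derivative_power[OF assms(2), of q]]
  by (simp add: algebra_simps)

text \<open>Carries the first and second directional derivatives along, so that the Laplace equation is
  stable under linear combinations.\<close>

definition dir_harmonic :: "('a::euclidean_space \<Rightarrow> complex) \<Rightarrow> bool" where
  "dir_harmonic f \<longleftrightarrow> (\<exists>f1 f2.
     (\<forall>b x. ((\<lambda>t. f (x + t *\<^sub>R b)) has_vector_derivative f1 b x) (at 0)) \<and>
     (\<forall>b x. ((\<lambda>t. f1 b (x + t *\<^sub>R b)) has_vector_derivative f2 b x) (at 0)) \<and>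
     (\<forall>x. (\<Sum>b\<in>Basis. f2 b x) = 0))"

lemma laplacian_dir_harmonic:
  assumes "dir_harmonic f"
  shows "laplacian f x = 0"
proof -
  obtain f1 f2 where
    1: "\<And>b x. ((\<lambda>t. f (x + t *\<^sub>R b)) has_vector_derivative f1 b x) (at 0)" and
    2: "\<And>b x. ((\<lambda>t. f1 b (x + t *\<^sub>R b)) has_vector_derivative f2 b x) (at 0)" and
    3: "\<And>x. (\<Sum>b\<in>Basis. f2 b x) = 0"
    using assms unfolding dir_harmonic_def by blast
  have p1: "partial b f = f1 b" for b
    unfolding partial_def by (rule ext) (rule vector_derivative_at[OF 1])
  have p2: "partial b (f1 b) = f2 b" for b
    unfolding partial_def by (rule ext) (rule vector_derivative_at[OF 2])
  show ?thesis unfolding laplacian_def p1 p2 by (rule 3)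
qed

lemma dir_harmonic_add:
  assumes "dir_harmonic f" "dir_harmonic g"
  shows "dir_harmonic (\<lambda>x. f x + g x)"
proof -
  obtain f1 f2 g1 g2 where
    "\<forall>b x. ((\<lambda>t. f (x + t *\<^sub>R b)) has_vector_derivative f1 b x) (at 0)"
    "\<forall>b x. ((\<lambda>t. f1 b (x + t *\<^sub>R b)) has_vector_derivative f2 b x) (at 0)"
    "\<forall>x. (\<Sum>b\<in>Basis. f2 b x) = 0"
    "\<forall>b x. ((\<lambda>t. g (x + t *\<^sub>R b)) has_vector_derivative g1 b x) (at 0)"
    "\<forall>b x. ((\<lambda>t. g1 b (x + t *\<^sub>R b)) has_vector_derivative g2 b x) (at 0)"
    "\<forall>x. (\<Sum>b\<in>Basis. g2 b x) = 0"
    using assms unfolding dir_harmonic_def by blast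
  then show ?thesis
    unfolding dir_harmonic_def
    by (intro exI[of _ "\<lambda>b x. f1 b x + g1 b x"] exI[of _ "\<lambda>b x. f2 b x + g2 b x"])
       (simp add: has_vector_derivative_add sum.distrib)
qed

lemma dir_harmonic_cmult:
  assumes "dir_harmonic f"
  shows "dir_harmonic (\<lambda>x. c * f x)"
proof -
  obtain f1 f2 where
    "\<forall>b x. ((\<lambda>t. f (x + t *\<^sub>R b)) has_vector_derivative f1 b x) (at 0)"
    "\<forall>b x. ((\<lambda>t. f1 b (x + t *\<^sub>R b)) has_vector_derivative f2 b x) (at 0)"
    "\<forall>x. (\<Sum>b\<in>Basis. f2 b x) = 0"
    using assms unfolding dir_harmonic_def by blast
  then show ?thesis
    unfolding dir_harmonic_def
    by (intro exI[of _ "\<lambda>b x. c * f1 b x"] exI[of _ "\<lambda>b x. c * f2 b x"])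
       (simp add: has_vector_derivative_mult_right sum_distrib_left[symmetric])
qed

lemma has_vector_derivative_linear_line:
  assumes "linear U"
  shows "((\<lambda>t. U (x + t *\<^sub>R b)) has_vector_derivative U b) (at t)"
proof -
  have "((\<lambda>t. U x + t *\<^sub>R U b) has_vector_derivative U b) (at t)"
    by (auto intro!: derivative_eq_intros)
  then show ?thesis by (simp add: linear_add[OF assms] linear_scale[OF assms])
qed

text \<open>Linear forms have no second derivatives, so the Laplacian of the product is a
  combination of exactly the three sums assumed to vanish. Exponents truncated by p - 1 or q - 1
  always come with a factor that is then 0.\<close>

lemma dir_harmonic_isotropic:
  fixes U V :: "'a::euclidean_space \<Rightarrow> complex"
  assumes U: "linear U" and V: "linear V"
    and iso: "(\<Sum>b\<in>Basis. U b * U b) = 0" "(\<Sum>b\<in>Basis. U b * V b) = 0" "(\<Sum>b\<in>Basis. V b * V b) = 0"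
  shows "dir_harmonic (\<lambda>x. U x ^ p * V x ^ q)"
proof -
  define D where "D i j b x = of_nat i * U x ^ (i - 1) * V x ^ j * U b + of_nat j * U x ^ i * V x ^ (j - 1) * V b" for i j b x
  have D: "((\<lambda>t. U (x + t *\<^sub>R b) ^ i * V (x + t *\<^sub>R b) ^ j) has_vector_derivative D i j b x) (at 0)" for i j b x
    using has_vector_derivative_power_prod[OF has_vector_derivative_linear_line[OF U, of x b 0]
        has_vector_derivative_linear_line[OF V, of x b 0], of i j] by (simp add: D_def)
  define F2 where "F2 b x = of_nat p * U b * D (p - 1) q b x + of_nat q * V b * D p (q - 1) b x" for b x
  have "((\<lambda>t. D p q b (x + t *\<^sub>R b)) has_vector_derivative F2 b x) (at 0)" for b x
  proof -
    have "((\<lambda>t. of_nat p * U b * (U (x + t *\<^sub>R b) ^ (p - 1) * V (x + t *\<^sub>R b) ^ q)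
        + of_nat q * V b * (U (x + t *\<^sub>R b) ^ p * V (x + t *\<^sub>R b) ^ (q - 1))) has_vector_derivative F2 b x) (at 0)"
      unfolding F2_def by (intro has_vector_derivative_add has_vector_derivative_mult_right D)
    then show ?thesis by (simp add: D_def[of p q] mult_ac)
  qed
  moreover have "(\<Sum>b\<in>Basis. F2 b x) = 0" for x
  proof -
    have "F2 b x = of_nat p * of_nat (p - 1) * U x ^ (p - 1 - 1) * V x ^ q * (U b * U b)
       + (of_nat p * of_nat q * U x ^ (p - 1) * V x ^ (q - 1) + of_nat p * of_nat q * U x ^ (p - 1) * V x ^ (q - 1)) * (U b * V b)
       + of_nat q * of_nat (q - 1) * U x ^ p * V x ^ (q - 1 - 1) * (V b * V b)" for b
      unfolding F2_def D_def by (simp add: algebra_simps)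
    then show ?thesis
      by (simp only: sum.distrib sum_distrib_left[symmetric] iso) simp
  qed
  ultimately show ?thesis
    unfolding dir_harmonic_def using D by blast
qed

lemma sum_Basis_complex2:
  "(\<Sum>b\<in>Basis. f b) = f (axis 1 1) + f (axis 1 \<i>) + f (axis 2 1) + f (axis 2 \<i> :: complex^2)"
proof -
  have B: "(Basis :: (complex^2) set) = {axis 1 1, axis 1 \<i>, axis 2 1, axis 2 \<i>}"
    by (auto simp: Basis_vec_def Basis_complex_def) (metis exhaust_2)+
  show ?thesis unfolding B by (simp add: axis_eq_axis add.assoc)
qed

lemma linear_wig_forms:
  "linear (\<lambda>x::complex^2. cnj (x $ 1) * z0 + cnj (x $ 2) * z1)"
  "linear (\<lambda>x::complex^2. - (x $ 2) * z0 + x $ 1 * z1)"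
  by (auto intro!: linearI simp: algebra_simps)

text \<open>A holomorphic or antiholomorphic linear form is isotropic, because the directions 1 and
  \<i> contribute opposite squares. The mixed sum vanishes because the coefficient vectors are (z0,
  z1) and (z1, - z0).\<close>

lemma dir_harmonic_wig_kernel: "dir_harmonic (wig_kernel p q z0 z1)"
  unfolding wig_kernel_def
  by (intro dir_harmonic_isotropic linear_wig_forms)
     (simp_all add: sum_Basis_complex2 axis_def algebra_simps)

lemma polynomial_function_complex_mult:
  fixes f g :: "'a::real_normed_vector \<Rightarrow> complex"
  assumes "polynomial_function f" "polynomial_function g"
  shows "polynomial_function (\<lambda>x. f x * g x)"
proof -
  have comp: "real_polynomial_function (\<lambda>x. Re (h x)) \<and> real_polynomial_function (\<lambda>x. Im (h x))"
    if "polynomial_function h" for h :: "'a \<Rightarrow> complex"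
    using that bounded_linear_Re bounded_linear_Im unfolding polynomial_function_def o_def by blast
  show ?thesis
    unfolding polynomial_function_iff_Basis_inner Basis_complex_def
    using comp[OF assms(1)] comp[OF assms(2)]
    by (auto simp: inner_complex_def intro!: real_polynomial_function_diff real_polynomial_function.intros(3,4))
qed

lemma polynomial_function_wig_kernel: "polynomial_function (wig_kernel p q z0 z1)"
proof -
  have pow: "polynomial_function (\<lambda>x. f x ^ m)" if "polynomial_function f" for f :: "complex^2 \<Rightarrow> complex" and m
    by (induction m) (auto intro: polynomial_function_complex_mult that)
  show ?thesis
    unfolding wig_kernel_def
    using linear_wig_forms[of z0 z1]
    by (intro polynomial_function_complex_mult pow polynomial_function_bounded_linear)
       (simp_all add: linear_conv_bounded_linear)
qed

lemma homogeneous_wig_kernel: "wig_kernel p q z0 z1 (t *\<^sub>R x) = t ^ (p + q) *\<^sub>R wig_kernel p q z0 z1 x"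
proof -
  have "cnj ((t *\<^sub>R x) $ 1) * z0 + cnj ((t *\<^sub>R x) $ 2) * z1 = of_real t * (cnj (x $ 1) * z0 + cnj (x $ 2) * z1)"
    "- ((t *\<^sub>R x) $ 2) * z0 + (t *\<^sub>R x) $ 1 * z1 = of_real t * (- (x $ 2) * z0 + x $ 1 * z1)"
    by (simp_all add: scaleR_conv_of_real[where 'a = complex] algebra_simps)
  then show ?thesis
    unfolding wig_kernel_def by (simp add: power_mult_distrib power_add scaleR_conv_of_real mult_ac)
qed

lemma homogeneous_harmonic_poly_wig_combination:
  "homogeneous_harmonic_poly (p + q) (\<lambda>x. \<Sum>j\<in>J. c j * wig_kernel p q (z0 j) (z1 j) x)"
proof -
  have "polynomial_function (\<lambda>x. \<Sum>j\<in>J. c j * wig_kernel p q (z0 j) (z1 j) x)"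
  proof (induction J rule: infinite_finite_induct)
    case (insert j J)
    have "polynomial_function (\<lambda>x. c j * wig_kernel p q (z0 j) (z1 j) x
        + (\<Sum>j\<in>J. c j * wig_kernel p q (z0 j) (z1 j) x))"
      by (intro polynomial_function_add polynomial_function_complex_mult polynomial_function_const
          polynomial_function_wig_kernel insert)
    with insert.hyps show ?case by simp
  qed auto
  moreover have "dir_harmonic (\<lambda>x. \<Sum>j\<in>J. c j * wig_kernel p q (z0 j) (z1 j) x)"
  proof (induction J rule: infinite_finite_induct)
    case (insert j J)
    have "dir_harmonic (\<lambda>x. c j * wig_kernel p q (z0 j) (z1 j) x
        + (\<Sum>j\<in>J. c j * wig_kernel p q (z0 j) (z1 j) x))"
      by (intro dir_harmonic_add dir_harmonic_cmult dir_harmonic_wig_kernel insert)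
    with insert.hyps show ?case by simp
  qed (use dir_harmonic_cmult[OF dir_harmonic_wig_kernel[of 0 0 0 0], of 0] in auto)
  ultimately show ?thesis
    unfolding homogeneous_harmonic_poly_def
    by (auto simp: homogeneous_wig_kernel laplacian_dir_harmonic scaleR_sum_right)
qed

section \<open>The Laplace--Beltrami operator in stereographic coordinates\<close>

text \<open>Half the conformal factor of stereographic projection onto the unit sphere: lengths
  scale by 2 \<open>conf\<close> there and by 4 \<open>conf\<close> on the sphere of radius
  2.\<close>

definition conf :: "real^3 \<Rightarrow> real" where
  "conf u = inverse ((norm u)\<^sup>2 + 1)"

lemma conf_pos: "conf u > 0"
  by (simp add: conf_def add_nonneg_pos)

lemma conf_mult: "conf u * ((norm u)\<^sup>2 + 1) = 1"
  using conf_pos[of u] by (simp add: conf_def)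

lemma norm_real3: "(norm (u :: real^3))\<^sup>2 = (u $ 1)\<^sup>2 + (u $ 2)\<^sup>2 + (u $ 3)\<^sup>2"
  unfolding power2_norm_eq_inner inner_vec_def by (simp add: sum_3 power2_eq_square)

lemma norm_add_axis: "(norm (u + t *\<^sub>R axis i 1 :: real^3))\<^sup>2 = (norm u)\<^sup>2 + 2 * t * u $ i + t\<^sup>2"
  unfolding power2_norm_eq_inner
  by (simp add: inner_add_left inner_add_right inner_axis inner_commute power2_eq_square inner_axis_axis algebra_simps)

lemma norm_add_axis_derivative:
  "((\<lambda>t. (norm (u + t *\<^sub>R axis i 1 :: real^3))\<^sup>2) has_real_derivative 2 * u $ i) (at 0)"
  unfolding norm_add_axis by (auto intro!: derivative_eq_intros)

lemma conf_derivative: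
  "((\<lambda>t. conf (u + t *\<^sub>R axis i 1)) has_real_derivative - 2 * u $ i * (conf u)\<^sup>2) (at 0)"
proof -
  have "((\<lambda>t. (norm (u + t *\<^sub>R axis i 1))\<^sup>2 + 1) has_real_derivative 2 * u $ i + 0) (at 0)"
    by (intro DERIV_add norm_add_axis_derivative DERIV_const)
  from DERIV_inverse_fun[OF this] show ?thesis
    using conf_pos[of u] by (simp add: conf_def power2_eq_square[of "inverse _"] del: power_inverse)
qed

text \<open>Together with \<open>pole\<close> an orthonormal basis of the ambient real space adapted
  to the charts: \<open>frame\<close> spans the equatorial hyperplane onto which both poles
  project.\<close>

definition frame :: "3 \<Rightarrow> complex^2" where
  "frame i = (if i = 1 then axis 1 1 else if i = 2 then axis 1 \<i> else axis 2 1)"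

definition pole :: "complex^2" where
  "pole = axis 2 \<i>"

lemma frame_simps [simp]: "frame 1 = axis 1 1" "frame 2 = axis 1 \<i>" "frame 3 = axis 2 1"
  by (simp_all add: frame_def)

lemma inner_frame [simp]: "frame i \<bullet> frame j = (if i = j then 1 else 0)" "frame i \<bullet> pole = 0"
    "pole \<bullet> frame i = 0" "pole \<bullet> pole = 1"
  using exhaust_3[of i] exhaust_3[of j] by (auto simp: pole_def inner_axis_axis)

lemma stereo_eq:
  "stereo \<epsilon> u = conf u *\<^sub>R ((\<Sum>i\<in>UNIV. (2 * u $ i) *\<^sub>R frame i) + (\<epsilon> * ((norm u)\<^sup>2 - 1)) *\<^sub>R pole)"
  unfolding stereo_def conf_def
  by (simp add: sum_3 vec_eq_iff forall_2 axis_def pole_def complex_eq_iff)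

lemma stereo_frame: "stereo \<epsilon> u \<bullet> frame i = 2 * u $ i * conf u"
  using exhaust_3[of i] unfolding stereo_eq
  by (auto simp: inner_add_left sum_3 pole_def inner_axis_axis)

lemma stereo_pole: "stereo \<epsilon> u \<bullet> pole = \<epsilon> * ((norm u)\<^sup>2 - 1) * conf u"
  unfolding stereo_eq by (simp add: inner_add_left inner_sum_left)

text \<open>The part of the derivative that comes from \<open>conf\<close> is expressed through
  \<open>stereo\<close> itself. This makes inner products computable from the unit length of
  \<open>stereo\<close> without expanding it.\<close>

definition stereo_d :: "real \<Rightarrow> 3 \<Rightarrow> real^3 \<Rightarrow> complex^2" where
  "stereo_d \<epsilon> i u = conf u *\<^sub>R (2 *\<^sub>R frame i + (2 * \<epsilon> * u $ i) *\<^sub>R pole) - (2 * u $ i * conf u) *\<^sub>R stereo \<epsilon> u"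

lemma stereo_derivative:
  "((\<lambda>t. stereo \<epsilon> (u + t *\<^sub>R axis i 1)) has_vector_derivative stereo_d \<epsilon> i u) (at 0)"
proof -
  define W where "W v = (\<Sum>i\<in>UNIV. (2 * v $ i) *\<^sub>R frame i) + (\<epsilon> * ((norm v)\<^sup>2 - 1)) *\<^sub>R pole" for v :: "real^3"
  have W: "W (u + t *\<^sub>R axis i 1) = W u + (t *\<^sub>R (2 *\<^sub>R frame i) + (\<epsilon> * (2 * t * u $ i + t\<^sup>2)) *\<^sub>R pole)" for t
  proof -
    have s: "(\<Sum>j\<in>UNIV. (2 * (u + t *\<^sub>R axis i 1) $ j) *\<^sub>R frame j)
       = (\<Sum>j\<in>UNIV. (2 * u $ j) *\<^sub>R frame j) + t *\<^sub>R (2 *\<^sub>R frame i)"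
      using exhaust_3[of i] by (auto simp: sum_3 axis_def scaleR_add_left algebra_simps)
    show ?thesis unfolding W_def s norm_add_axis by (simp add: algebra_simps scaleR_add_left)
  qed
  have left: "((\<lambda>t. h t *\<^sub>R w) has_vector_derivative h' *\<^sub>R w) (at 0)"
    if "(h has_real_derivative h') (at 0)" for h h' and w :: "complex^2"
    using has_vector_derivative_scaleR[OF that has_vector_derivative_const] by simp
  have "((\<lambda>t. W u + (t *\<^sub>R (2 *\<^sub>R frame i) + (\<epsilon> * (2 * t * u $ i + t\<^sup>2)) *\<^sub>R pole))
      has_vector_derivative (0 + (1 *\<^sub>R (2 *\<^sub>R frame i) + (2 * \<epsilon> * u $ i) *\<^sub>R pole))) (at 0)"
    by (intro has_vector_derivative_add has_vector_derivative_const left)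
       (auto intro!: derivative_eq_intros)
  then have "((\<lambda>t. W (u + t *\<^sub>R axis i 1)) has_vector_derivative
      (2 *\<^sub>R frame i + (2 * \<epsilon> * u $ i) *\<^sub>R pole)) (at 0)"
    unfolding W by simp
  from has_vector_derivative_scaleR[OF conf_derivative this, of u]
  have "((\<lambda>t. conf (u + t *\<^sub>R axis i 1) *\<^sub>R W (u + t *\<^sub>R axis i 1)) has_vector_derivative
     (conf u *\<^sub>R (2 *\<^sub>R frame i + (2 * \<epsilon> * u $ i) *\<^sub>R pole) + (- 2 * u $ i * (conf u)\<^sup>2) *\<^sub>R W u)) (at 0)"
    by simp
  moreover have "stereo \<epsilon> v = conf v *\<^sub>R W v" for v unfolding stereo_eq W_def ..
  ultimately show ?thesis by (simp add: stereo_d_def power2_eq_square mult_ac)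
qed

lemma stereo_d_inner:
  assumes \<epsilon>: "\<epsilon> \<in> {1, -1}"
  shows "stereo_d \<epsilon> i u \<bullet> stereo_d \<epsilon> j u = (if i = j then 4 * (conf u)\<^sup>2 else 0)"
proof -
  have e: "\<epsilon> * \<epsilon> = 1" using \<epsilon> by auto
  have ss: "stereo \<epsilon> u \<bullet> stereo \<epsilon> u = 1"
    using norm_stereo[OF \<epsilon>, of u] by (simp flip: power2_norm_eq_inner)
  define d where "d = (if i = j then 1 else 0 :: real)"
  define n where "n = conf u"
  define Q where "Q = (norm u)\<^sup>2"
  \<comment> \<open>After expansion, the remaining cancellation uses only this relation and
    \<epsilon>^2 = 1.\<close>
  have nQ: "n * Q = 1 - n" using conf_mult[of u] by (simp add: n_def Q_def algebra_simps)
  have "stereo_d \<epsilon> i u \<bullet> stereo_d \<epsilon> j u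
     = n * n * (4 * d + 4 * (\<epsilon> * \<epsilon>) * (u $ i * u $ j))
       - 2 * n * n * (u $ i * u $ j) * (4 * n + 2 * (\<epsilon> * \<epsilon>) * (n * Q - n)) * 2
       + 4 * n * n * (u $ i * u $ j)"
    unfolding stereo_d_def
    by (simp add: inner_diff_left inner_diff_right inner_add_left inner_add_right ss stereo_frame stereo_pole
        inner_commute[of "frame _" "stereo _ _"] inner_commute[of pole "stereo _ _"] d_def
        flip: n_def Q_def) (simp add: algebra_simps)
  also have "\<dots> = 4 * n * n * d"
    unfolding e nQ by (simp add: algebra_simps)
  finally show ?thesis by (simp add: d_def n_def power2_eq_square)
qed

lemma metric_tensor_stereo:
  assumes "\<epsilon> \<in> {1, -1}"
  shows "metric_tensor (\<lambda>v. 2 *\<^sub>R stereo \<epsilon> v) u = mat (16 * (conf u)\<^sup>2)"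
proof -
  have p: "partial (axis i 1) (\<lambda>v. 2 *\<^sub>R stereo \<epsilon> v) u = 2 *\<^sub>R stereo_d \<epsilon> i u" for i
    unfolding partial_def
    by (intro vector_derivative_at has_vector_derivative_scaleR[of "\<lambda>_. 2" 0, simplified] stereo_derivative)
  show ?thesis
    unfolding metric_tensor_def mat_def p by (simp add: vec_eq_iff stereo_d_inner[OF assms])
qed

lemma det_mat3: "det (mat k :: real^3^3) = k ^ 3"
  by (simp add: det_3 mat_def power3_eq_cube)

lemma matrix_inv_mat:
  assumes "k \<noteq> 0"
  shows "matrix_inv (mat k :: real^'n^'n) = mat (inverse k)"
proof -
  have m: "(mat a :: real^'n^'n) ** mat b = mat (a * b)" for a b
    by (simp add: mat_def matrix_matrix_mult_def vec_eq_iff if_distrib[of "\<lambda>x. x * _"] cong: if_cong)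
  let ?A = "mat k :: real^'n^'n" and ?B = "mat (inverse k) :: real^'n^'n"
  have AB: "?A ** ?B = mat 1" "?B ** ?A = mat 1" using assms by (simp_all add: m)
  \<comment> \<open>\<open>matrix_inv\<close> is a Hilbert choice among two-sided inverses;
    exhibiting one makes the choice an inverse, and inverses are unique.\<close>
  then have inv: "?A ** matrix_inv ?A = mat 1 \<and> matrix_inv ?A ** ?A = mat 1"
    unfolding matrix_inv_def
    using someI[of "\<lambda>A'. ?A ** A' = mat 1 \<and> A' ** ?A = mat 1" ?B] by blast
  have "matrix_inv ?A = matrix_inv ?A ** (?A ** ?B)" using AB by simp
  also have "\<dots> = ?B" using inv by (simp add: matrix_mul_assoc)
  finally show ?thesis .
qed

text \<open>A ring of functions of u closed under coordinate derivatives, because differentiating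
  \<open>conf\<close> gives - 2 u_i \<open>conf\<close>^2. It contains every linear form composed
  with \<open>stereo\<close>, so smoothness of the local expressions needs no formulas for higher
  derivatives.\<close>

inductive_set stereo_rational :: "(real^3 \<Rightarrow> complex) set" where
  const: "(\<lambda>u. c) \<in> stereo_rational"
| coord: "(\<lambda>u. of_real (u $ i)) \<in> stereo_rational"
| conf: "(\<lambda>u. of_real (conf u)) \<in> stereo_rational"
| add: "f \<in> stereo_rational \<Longrightarrow> g \<in> stereo_rational \<Longrightarrow> (\<lambda>u. f u + g u) \<in> stereo_rational"
| mult: "f \<in> stereo_rational \<Longrightarrow> g \<in> stereo_rational \<Longrightarrow> (\<lambda>u. f u * g u) \<in> stereo_rational"

lemma stereo_rational_derivative_ex:
  assumes "f \<in> stereo_rational"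
  shows "\<exists>f'\<in>stereo_rational. \<forall>u. ((\<lambda>t. f (u + t *\<^sub>R axis i 1)) has_vector_derivative f' u) (at 0)"
  using assms
proof induction
  case (const c)
  show ?case by (rule bexI[of _ "\<lambda>u. 0"]) (auto intro: stereo_rational.const)
next
  case (coord j)
  have "((\<lambda>t. of_real ((u + t *\<^sub>R axis i 1) $ j)) has_vector_derivative (if i = j then 1 else 0)) (at 0)" for u :: "real^3"
    by (auto simp: axis_def intro!: derivative_eq_intros)
  then show ?case
    by (intro bexI[of _ "\<lambda>u. if i = j then 1 else 0"]) (auto intro: stereo_rational.const)
next
  case conf
  have "((\<lambda>t. of_real (conf (u + t *\<^sub>R axis i 1)) :: complex) has_vector_derivative
      (- 2) * (of_real (u $ i) * (of_real (conf u) * of_real (conf u)))) (at 0)" for u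
    using has_vector_derivative_of_real[OF conf_derivative[of u i], where 'a = complex] by (simp add: power2_eq_square mult.assoc)
  then show ?case
    by (intro bexI allI) (assumption, intro stereo_rational.intros)
next
  case (add f g)
  then obtain f' g' where "f' \<in> stereo_rational" "g' \<in> stereo_rational"
    "\<And>u. ((\<lambda>t. f (u + t *\<^sub>R axis i 1)) has_vector_derivative f' u) (at 0)"
    "\<And>u. ((\<lambda>t. g (u + t *\<^sub>R axis i 1)) has_vector_derivative g' u) (at 0)" by blast
  then show ?case
    by (intro bexI[of _ "\<lambda>u. f' u + g' u"] allI has_vector_derivative_add stereo_rational.add)
next
  case (mult f g)
  then obtain f' g' where *: "f' \<in> stereo_rational" "g' \<in> stereo_rational"
    "\<And>u. ((\<lambda>t. f (u + t *\<^sub>R axis i 1)) has_vector_derivative f' u) (at 0)"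
    "\<And>u. ((\<lambda>t. g (u + t *\<^sub>R axis i 1)) has_vector_derivative g' u) (at 0)" by blast
  show ?case
  proof (intro bexI[of _ "\<lambda>u. f u * g' u + f' u * g u"] allI)
    show "((\<lambda>t. f (u + t *\<^sub>R axis i 1) * g (u + t *\<^sub>R axis i 1)) has_vector_derivative f u * g' u + f' u * g u) (at 0)" for u
      using has_vector_derivative_mult[OF *(3,4), of u] by simp
  qed (intro stereo_rational.intros * mult)
qed

lemma stereo_rational_partial:
  assumes "f \<in> stereo_rational"
  shows "partial (axis i 1) f \<in> stereo_rational"
    and "((\<lambda>t. f (u + t *\<^sub>R axis i 1)) has_vector_derivative partial (axis i 1) f u) (at 0)"
proof -
  obtain f' where f': "f' \<in> stereo_rational"
    "\<And>u. ((\<lambda>t. f (u + t *\<^sub>R axis i 1)) has_vector_derivative f' u) (at 0)"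
    using stereo_rational_derivative_ex[OF assms] by blast
  have "partial (axis i 1) f = f'"
    unfolding partial_def by (rule ext) (rule vector_derivative_at[OF f'(2)])
  then show "partial (axis i 1) f \<in> stereo_rational"
    and "((\<lambda>t. f (u + t *\<^sub>R axis i 1)) has_vector_derivative partial (axis i 1) f u) (at 0)"
    using f' by simp_all
qed

lemma partial_eqI:
  "(\<And>u. ((\<lambda>t. f (u + t *\<^sub>R b)) has_vector_derivative f' u) (at 0)) \<Longrightarrow> partial b f = f'"
  unfolding partial_def by (rule ext) (rule vector_derivative_at)

lemma stereo_rational_continuous: "f \<in> stereo_rational \<Longrightarrow> continuous_on UNIV f"
proof (induction rule: stereo_rational.induct)
  case conf
  have "(norm u)\<^sup>2 + 1 \<noteq> 0" for u :: "real^3"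
    by (metis add_nonneg_eq_0_iff one_neq_zero zero_le_one zero_le_power2)
  then show ?case unfolding conf_def by (intro continuous_intros) auto
qed (auto intro!: continuous_intros)

lemma stereo_rational_times_cont_diff: "f \<in> stereo_rational \<Longrightarrow> times_cont_diff k f"
proof (induction k arbitrary: f)
  case (Suc k)
  show ?case
    unfolding times_cont_diff.simps
  proof (intro conjI ballI allI)
    show "continuous_on UNIV f" by (rule stereo_rational_continuous) fact
    fix b :: "real^3" assume "b \<in> Basis"
    then obtain i where b: "b = axis i 1" by (auto simp: Basis_vec_def)
    show "times_cont_diff k (partial b f)"
      unfolding b by (intro Suc stereo_rational_partial)
    show "(\<lambda>t. f (x + t *\<^sub>R b)) differentiable (at 0)" for x
      unfolding b by (rule differentiableI_vector) (rule stereo_rational_partial(2)[OF Suc.prems])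
  qed
qed (simp add: stereo_rational_continuous)

lemma stereo_rational_power: "f \<in> stereo_rational \<Longrightarrow> (\<lambda>u. f u ^ n) \<in> stereo_rational"
  by (induction n) (auto intro: stereo_rational.intros)

lemma stereo_rational_sum: "(\<And>i. i \<in> I \<Longrightarrow> f i \<in> stereo_rational) \<Longrightarrow> (\<lambda>u. \<Sum>i\<in>I. f i u) \<in> stereo_rational"
  by (induction I rule: infinite_finite_induct) (auto intro: stereo_rational.intros)

lemma stereo_rational_linear_stereo:
  assumes "linear U"
  shows "(\<lambda>u. U (stereo \<epsilon> u)) \<in> stereo_rational"
proof -
  have e: "U (stereo \<epsilon> u) = of_real (conf u) * ((\<Sum>i\<in>UNIV. (2 * of_real (u $ i)) * U (frame i))
     + (of_real \<epsilon> * ((of_real (u $ 1) * of_real (u $ 1) + of_real (u $ 2) * of_real (u $ 2)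
        + of_real (u $ 3) * of_real (u $ 3)) + (-1))) * U pole)" for u
    unfolding stereo_eq norm_real3
    by (simp add: linear_scale[OF assms] linear_add[OF assms] linear_sum[OF assms] scaleR_conv_of_real[where 'a = complex] power2_eq_square)
  show ?thesis unfolding e by (intro stereo_rational.intros stereo_rational_sum)
qed

text \<open>In dimension 3 the metric 16 \<open>conf\<close>^2 has volume density 64
  \<open>conf\<close>^3, and density times inverse metric is 4 \<open>conf\<close>. Hence the
  operator div(\<open>conf\<close> grad f), which is the Laplace-Beltrami operator multiplied by 16
  \<open>conf\<close>^3.\<close>

definition conf_laplacian :: "(real^3 \<Rightarrow> complex) \<Rightarrow> real^3 \<Rightarrow> complex" where
  "conf_laplacian f u = (\<Sum>i\<in>UNIV. partial (axis i 1) (\<lambda>v. of_real (conf v) * partial (axis i 1) f v) u)"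

lemma laplace_beltrami_coord_stereo:
  assumes \<epsilon>: "\<epsilon> \<in> {1, -1}" and f: "f \<in> stereo_rational"
  shows "laplace_beltrami_coord (\<lambda>v. 2 *\<^sub>R stereo \<epsilon> v) f u = conf_laplacian f u / of_real (16 * conf u ^ 3)"
proof -
  have sq: "sqrt (det (metric_tensor (\<lambda>v. 2 *\<^sub>R stereo \<epsilon> v) v)) = 64 * conf v ^ 3" for v
  proof -
    have "det (metric_tensor (\<lambda>v. 2 *\<^sub>R stereo \<epsilon> v) v) = (64 * conf v ^ 3)\<^sup>2"
      unfolding metric_tensor_stereo[OF \<epsilon>] det_mat3 by (simp add: power_mult_distrib flip: power_mult)
    then have "sqrt (det (metric_tensor (\<lambda>v. 2 *\<^sub>R stereo \<epsilon> v) v)) = \<bar>64 * conf v ^ 3\<bar>"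
      by (simp only: real_sqrt_abs)
    then show ?thesis using conf_pos[of v] by simp
  qed
  have inner: "(\<Sum>j\<in>UNIV. (sqrt (det (metric_tensor (\<lambda>v. 2 *\<^sub>R stereo \<epsilon> v) v))
        * matrix_inv (metric_tensor (\<lambda>v. 2 *\<^sub>R stereo \<epsilon> v) v) $ i $ j) *\<^sub>R partial (axis j 1) f v)
     = 4 * (of_real (conf v) * partial (axis i 1) f v)" for i v
  proof -
    have "(\<Sum>j\<in>UNIV. (64 * conf v ^ 3 * mat (inverse (16 * (conf v)\<^sup>2)) $ i $ j) *\<^sub>R partial (axis j 1) f v)
      = (\<Sum>j\<in>UNIV. if j = i then (64 * conf v ^ 3 * inverse (16 * (conf v)\<^sup>2)) *\<^sub>R partial (axis i 1) f v else 0)"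
      by (intro sum.cong) (auto simp: mat_def)
    also have "\<dots> = (64 * conf v ^ 3 * inverse (16 * (conf v)\<^sup>2)) *\<^sub>R partial (axis i 1) f v"
      by simp
    also have "64 * conf v ^ 3 * inverse (16 * (conf v)\<^sup>2) = 4 * conf v"
      using conf_pos[of v] by (simp add: power2_eq_square power3_eq_cube field_simps)
    finally have X: "(\<Sum>j\<in>UNIV. (64 * conf v ^ 3 * mat (inverse (16 * (conf v)\<^sup>2)) $ i $ j) *\<^sub>R partial (axis j 1) f v)
      = (4 * conf v) *\<^sub>R partial (axis i 1) f v" .
    have k: "16 * (conf v)\<^sup>2 \<noteq> 0" using conf_pos[of v] by simp
    show ?thesis
      unfolding sq unfolding metric_tensor_stereo[OF \<epsilon>] matrix_inv_mat[OF k] X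
      by (simp add: scaleR_conv_of_real)
  qed
  have p: "partial (axis i 1) (\<lambda>v. 4 * (of_real (conf v) * partial (axis i 1) f v)) u
     = 4 * partial (axis i 1) (\<lambda>v. of_real (conf v) * partial (axis i 1) f v) u" for i
    by (rule fun_cong[OF partial_eqI])
       (intro has_vector_derivative_mult_right stereo_rational_partial stereo_rational.intros f)
  show ?thesis
    unfolding laplace_beltrami_coord_def inner
    unfolding p sq conf_laplacian_def sum_distrib_left[symmetric]
    using conf_pos[of u] by (simp add: scaleR_conv_of_real divide_simps)
qed

text \<open>Dividing the factor by 16 \<open>conf\<close>^3 leaves m (m + 2) / 4 = l (l + 1) for m =
  2 l. Membership in \<open>stereo_rational\<close> is included so that derivatives exist and linear
  combinations stay inside.\<close>

definition conf_eigen :: "nat \<Rightarrow> (real^3 \<Rightarrow> complex) \<Rightarrow> bool" where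
  "conf_eigen m f \<longleftrightarrow> f \<in> stereo_rational \<and>
     (\<forall>u. conf_laplacian f u = - of_real (4 * conf u ^ 3 * (real m * (real m + 2))) * f u)"

text \<open>\<open>partial\<close> is additive only where the derivatives exist;
  \<open>stereo_rational\<close> guarantees them for f and g and again for \<open>conf\<close> times
  their derivatives.\<close>

lemma conf_laplacian_lincomb:
  assumes "f \<in> stereo_rational" "g \<in> stereo_rational"
  shows "conf_laplacian (\<lambda>u. a * f u + g u) u = a * conf_laplacian f u + conf_laplacian g u"
proof -
  have p: "partial (axis i 1) (\<lambda>u. a * f u + g u) = (\<lambda>u. a * partial (axis i 1) f u + partial (axis i 1) g u)"
    if "f \<in> stereo_rational" "g \<in> stereo_rational" for i f g
    by (rule partial_eqI)
       (intro has_vector_derivative_add has_vector_derivative_mult_right stereo_rational_partial that)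
  have "(\<lambda>v. of_real (conf v) * partial (axis i 1) (\<lambda>u. a * f u + g u) v)
    = (\<lambda>v. a * (of_real (conf v) * partial (axis i 1) f v) + of_real (conf v) * partial (axis i 1) g v)" for i
    unfolding p[OF assms] by (simp add: algebra_simps)
  then have "partial (axis i 1) (\<lambda>v. of_real (conf v) * partial (axis i 1) (\<lambda>u. a * f u + g u) v) u
    = a * partial (axis i 1) (\<lambda>v. of_real (conf v) * partial (axis i 1) f v) u
      + partial (axis i 1) (\<lambda>v. of_real (conf v) * partial (axis i 1) g v) u" for i
    using p[of "\<lambda>v. of_real (conf v) * partial (axis i 1) f v" "\<lambda>v. of_real (conf v) * partial (axis i 1) g v" i] assms
    by (simp add: stereo_rational.intros stereo_rational_partial)
  then show ?thesis
    unfolding conf_laplacian_def by (simp add: sum.distrib sum_distrib_left)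
qed

lemma conf_eigen_lincomb:
  assumes "conf_eigen m f" "conf_eigen m g"
  shows "conf_eigen m (\<lambda>u. a * f u + g u)"
proof -
  have f: "f \<in> stereo_rational" "g \<in> stereo_rational"
    and e: "conf_laplacian f u = - of_real (4 * conf u ^ 3 * (real m * (real m + 2))) * f u"
      "conf_laplacian g u = - of_real (4 * conf u ^ 3 * (real m * (real m + 2))) * g u" for u
    using assms by (auto simp: conf_eigen_def)
  show ?thesis
    unfolding conf_eigen_def
  proof (intro conjI allI)
    show "(\<lambda>u. a * f u + g u) \<in> stereo_rational" by (intro stereo_rational.intros f)
    have "a * (- c * x) + - c * y = - c * (a * x + y)" for c x y :: complex
      by (simp add: algebra_simps)
    then show "conf_laplacian (\<lambda>u. a * f u + g u) u
      = - of_real (4 * conf u ^ 3 * (real m * (real m + 2))) * (a * f u + g u)" for u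
      unfolding conf_laplacian_lincomb[OF f] e .
  qed
qed

lemma conf_eigen_imp_laplace_beltrami:
  assumes "\<epsilon> \<in> {1, -1}" "conf_eigen m f"
  shows "laplace_beltrami_coord (\<lambda>v. 2 *\<^sub>R stereo \<epsilon> v) f u = (- (real m / 2) * (real m / 2 + 1)) *\<^sub>R f u"
proof -
  have f: "f \<in> stereo_rational"
    and e: "conf_laplacian f u = - of_real (4 * conf u ^ 3 * (real m * (real m + 2))) * f u"
    using assms by (auto simp: conf_eigen_def)
  have "- of_real (4 * conf u ^ 3 * (real m * (real m + 2))) * f u / of_real (16 * conf u ^ 3)
      = of_real (- (4 * conf u ^ 3 * (real m * (real m + 2))) / (16 * conf u ^ 3)) * f u"
    by simp
  also have "- (4 * conf u ^ 3 * (real m * (real m + 2))) / (16 * conf u ^ 3) = - (real m / 2) * (real m / 2 + 1)"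
    using conf_pos[of u] by (simp add: field_simps)
  finally show ?thesis
    unfolding laplace_beltrami_coord_stereo[OF assms(1) f] e by (simp only: scaleR_conv_of_real)
qed

text \<open>Orthogonality for the complex bilinear extension of the scalar product, evaluated in the
  orthonormal basis made of \<open>frame\<close> and \<open>pole\<close>.\<close>

definition isotropic_pair :: "(complex^2 \<Rightarrow> complex) \<Rightarrow> (complex^2 \<Rightarrow> complex) \<Rightarrow> bool" where
  "isotropic_pair U V \<longleftrightarrow> (\<Sum>i\<in>UNIV. U (frame i) * V (frame i)) + U pole * V pole = 0"

lemma stereo_form_derivative:
  assumes "linear U"
  shows "((\<lambda>t. U (stereo \<epsilon> (u + t *\<^sub>R axis i 1))) has_vector_derivative U (stereo_d \<epsilon> i u)) (at 0)"
  using bounded_linear.has_vector_derivative[OF _ stereo_derivative] assms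
  by (simp add: linear_conv_bounded_linear)

lemma form_stereo:
  fixes U :: "complex^2 \<Rightarrow> complex"
  assumes "linear U"
  shows "U (stereo \<epsilon> u) = of_real (conf u) * (2 * (\<Sum>i\<in>UNIV. of_real (u $ i) * U (frame i))
       + of_real \<epsilon> * (of_real ((norm u)\<^sup>2) - 1) * U pole)"
  unfolding stereo_eq
  by (simp add: linear_scale[OF assms] linear_add[OF assms] linear_sum[OF assms]
      scaleR_conv_of_real[where 'a = complex] sum_distrib_left mult.assoc)

lemma form_stereo_d:
  fixes U :: "complex^2 \<Rightarrow> complex"
  assumes "linear U"
  shows "U (stereo_d \<epsilon> i u) = of_real (conf u) * (2 * U (frame i) + 2 * of_real \<epsilon> * of_real (u $ i) * U pole)
     - 2 * of_real (u $ i) * of_real (conf u) * U (stereo \<epsilon> u)"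
  unfolding stereo_d_def
  by (simp add: linear_scale[OF assms] linear_add[OF assms] linear_diff[OF assms] scaleR_conv_of_real[where 'a = complex])

lemma conf_relation: "complex_of_real (conf u) * (of_real ((norm u)\<^sup>2) + 1) = 1"
  using arg_cong[OF conf_mult[of u], of complex_of_real] by (simp only: of_real_mult of_real_add of_real_1)

lemma sum_norm_real3:
  fixes u :: "real^3"
  shows "(\<Sum>i\<in>UNIV. complex_of_real (u $ i) * of_real (u $ i)) = of_real ((norm u)\<^sup>2)"
  unfolding norm_real3 by (simp add: sum_3 power2_eq_square)

text \<open>The coordinate vectors are orthogonal of squared length 4 \<open>conf\<close>^2, so the
  sum is 4 \<open>conf\<close>^2 times the tangential part of the bilinear product of U and V. The
  full product is 0 by isotropy, and its radial part at the point x is U x * V x.\<close>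

lemma gradient_product_stereo:
  fixes U V :: "complex^2 \<Rightarrow> complex"
  assumes \<epsilon>: "\<epsilon> \<in> {1, -1}" and U: "linear U" and V: "linear V" and iso: "isotropic_pair U V"
  shows "(\<Sum>i\<in>UNIV. U (stereo_d \<epsilon> i u) * V (stereo_d \<epsilon> i u))
       = - 4 * of_real (conf u) * of_real (conf u) * (U (stereo \<epsilon> u) * V (stereo \<epsilon> u))"
proof -
  define e n Q a b where "e = complex_of_real \<epsilon>" and "n = complex_of_real (conf u)"
    and "Q = complex_of_real ((norm u)\<^sup>2)" and "a = U (stereo \<epsilon> u)" and "b = V (stereo \<epsilon> u)"
  define S S' where "S = (\<Sum>i\<in>UNIV. of_real (u $ i) * U (frame i))" and "S' = (\<Sum>i\<in>UNIV. of_real (u $ i) * V (frame i))"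
  define P where "P = (\<Sum>i\<in>UNIV. U (frame i) * V (frame i))"
  have ee: "e * e = 1" using \<epsilon> by (auto simp: e_def)
  have nQ: "n * (Q + 1) = 1" unfolding n_def Q_def by (rule conf_relation)
  have P: "P = - (U pole * V pole)" using iso by (simp add: isotropic_pair_def P_def eq_neg_iff_add_eq_0)
  have a: "a = n * (2 * S + e * (Q - 1) * U pole)" and b: "b = n * (2 * S' + e * (Q - 1) * V pole)"
    unfolding a_def b_def n_def e_def Q_def S_def S'_def by (rule form_stereo[OF U], rule form_stereo[OF V])
  have "(\<Sum>i\<in>UNIV. U (stereo_d \<epsilon> i u) * V (stereo_d \<epsilon> i u))
    = n * n * (4 * P + 4 * e * (V pole * S + U pole * S') + 4 * (e * e) * Q * (U pole * V pole))
      - 4 * n * n * (b * (S + e * Q * U pole) + a * (S' + e * Q * V pole)) + 4 * n * n * Q * (a * b)"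
    unfolding form_stereo_d[OF U] form_stereo_d[OF V] P_def S_def S'_def Q_def sum_norm_real3[symmetric]
    unfolding e_def[symmetric] n_def[symmetric] a_def[symmetric] b_def[symmetric]
    by (simp add: sum_3 algebra_simps)
  also have "\<dots> = - 4 * n * n * (a * b)"
    using a b nQ ee unfolding P by algebra
  finally show ?thesis unfolding n_def a_def b_def .
qed

text \<open>The value of the i-th derivative of \<open>conf\<close> times the i-th derivative of U
  along \<open>stereo\<close>, by the product rule. The sum over i is the conformal Laplacian of the
  linear form.\<close>

definition weighted_gradient_d :: "(complex^2 \<Rightarrow> complex) \<Rightarrow> real \<Rightarrow> 3 \<Rightarrow> real^3 \<Rightarrow> complex" where
  "weighted_gradient_d U \<epsilon> i u =
     - 4 * of_real (u $ i) * of_real (conf u) ^ 3 * (2 * U (frame i) + 2 * of_real \<epsilon> * of_real (u $ i) * U pole)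
     + of_real (conf u) ^ 2 * (2 * of_real \<epsilon> * U pole - 2 * U (stereo \<epsilon> u) - 2 * of_real (u $ i) * U (stereo_d \<epsilon> i u))
     + 8 * of_real (u $ i) ^ 2 * of_real (conf u) ^ 3 * U (stereo \<epsilon> u)"

lemma weighted_gradient_derivative:
  assumes U: "linear U"
  shows "((\<lambda>t. of_real (conf (u + t *\<^sub>R axis i 1)) * U (stereo_d \<epsilon> i (u + t *\<^sub>R axis i 1)))
      has_vector_derivative weighted_gradient_d U \<epsilon> i u) (at 0)"
proof -
  let ?v = "\<lambda>t. u + t *\<^sub>R axis i 1"
  have c: "((\<lambda>t. complex_of_real (conf (?v t))) has_vector_derivative of_real (- 2 * u $ i * (conf u)\<^sup>2)) (at 0)"
    by (rule has_vector_derivative_of_real[OF conf_derivative])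
  have l: "((\<lambda>t. complex_of_real (?v t $ i)) has_vector_derivative of_real 1) (at 0)"
    by (rule has_vector_derivative_of_real) (auto simp: axis_def intro!: derivative_eq_intros)
  note A = stereo_form_derivative[OF U, of \<epsilon> u i]
  have "((\<lambda>t. (of_real (conf (?v t)) * of_real (conf (?v t)))
        * ((2 * U (frame i) + (2 * of_real \<epsilon> * U pole) * of_real (?v t $ i))
           - 2 * (of_real (?v t $ i) * U (stereo \<epsilon> (?v t)))))
     has_vector_derivative
      ((of_real (conf (?v 0)) * of_real (conf (?v 0)))
        * ((0 + (2 * of_real \<epsilon> * U pole) * of_real 1)
           - 2 * (of_real (?v 0 $ i) * U (stereo_d \<epsilon> i u) + of_real 1 * U (stereo \<epsilon> (?v 0))))
      + (of_real (conf (?v 0)) * of_real (- 2 * u $ i * (conf u)\<^sup>2) + of_real (- 2 * u $ i * (conf u)\<^sup>2) * of_real (conf (?v 0)))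
        * ((2 * U (frame i) + (2 * of_real \<epsilon> * U pole) * of_real (?v 0 $ i))
           - 2 * (of_real (?v 0 $ i) * U (stereo \<epsilon> (?v 0)))))) (at 0)"
    by (intro has_vector_derivative_mult has_vector_derivative_diff has_vector_derivative_add
        has_vector_derivative_const has_vector_derivative_mult_right c l A)
  moreover have "(\<lambda>t. (of_real (conf (?v t)) * of_real (conf (?v t)))
        * ((2 * U (frame i) + (2 * of_real \<epsilon> * U pole) * of_real (?v t $ i))
           - 2 * (of_real (?v t $ i) * U (stereo \<epsilon> (?v t)))))
     = (\<lambda>t. of_real (conf (?v t)) * U (stereo_d \<epsilon> i (?v t)))"
    unfolding form_stereo_d[OF U] by (rule ext) (simp add: algebra_simps)
  ultimately have "((\<lambda>t. of_real (conf (?v t)) * U (stereo_d \<epsilon> i (?v t))) has_vector_derivative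
      ((of_real (conf (?v 0)) * of_real (conf (?v 0)))
        * ((0 + (2 * of_real \<epsilon> * U pole) * of_real 1)
           - 2 * (of_real (?v 0 $ i) * U (stereo_d \<epsilon> i u) + of_real 1 * U (stereo \<epsilon> (?v 0))))
      + (of_real (conf (?v 0)) * of_real (- 2 * u $ i * (conf u)\<^sup>2) + of_real (- 2 * u $ i * (conf u)\<^sup>2) * of_real (conf (?v 0)))
        * ((2 * U (frame i) + (2 * of_real \<epsilon> * U pole) * of_real (?v 0 $ i))
           - 2 * (of_real (?v 0 $ i) * U (stereo \<epsilon> (?v 0)))))) (at 0)"
    by (simp only:)
  then show ?thesis
    by (rule has_vector_derivative_eq_rhs) (simp add: weighted_gradient_d_def power2_eq_square power3_eq_cube algebra_simps)
qed

text \<open>The eigenvalue equation for degree m = 1, where 4 m (m + 2) = 12.\<close>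

lemma weighted_gradient_divergence:
  assumes U: "linear U"
  shows "(\<Sum>i\<in>UNIV. weighted_gradient_d U \<epsilon> i u) = - 12 * of_real (conf u) ^ 3 * U (stereo \<epsilon> u)" (is "?L = _")
proof -
  define e n Q a where "e = complex_of_real \<epsilon>" and "n = complex_of_real (conf u)"
    and "Q = complex_of_real ((norm u)\<^sup>2)" and "a = U (stereo \<epsilon> u)"
  define S where "S = (\<Sum>i\<in>UNIV. of_real (u $ i) * U (frame i))"
  have nQ: "n * (Q + 1) = 1" unfolding n_def Q_def by (rule conf_relation)
  have a: "a = n * (2 * S + e * (Q - 1) * U pole)"
    unfolding a_def n_def e_def Q_def S_def by (rule form_stereo[OF U])
  have "?L = - 4 * n ^ 3 * (2 * S + 2 * e * Q * U pole) + 6 * n ^ 2 * (e * U pole - a)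
      - 2 * n ^ 2 * (n * (2 * S + 2 * e * Q * U pole) - 2 * Q * n * a) + 8 * Q * n ^ 3 * a"
    unfolding weighted_gradient_d_def form_stereo_d[OF U] S_def Q_def sum_norm_real3[symmetric]
    unfolding e_def[symmetric] n_def[symmetric] a_def[symmetric]
    by (simp add: sum_3 algebra_simps power2_eq_square)
  also have "\<dots> = - 12 * n ^ 3 * a"
    using a nQ by algebra
  finally show ?thesis unfolding n_def a_def .
qed

text \<open>The product rule leaves divergences of single forms, worth - 12 each, and gradient
  products, worth - 4 each. With n = p + q the total is 12 n + 4 (p (p - 1) + 2 p q + q (q - 1)) =
  12 n + 4 (n^2 - n) = 4 n (n + 2), up to sign and \<open>conf\<close>^3.\<close>

lemma conf_eigen_isotropic:
  assumes \<epsilon>: "\<epsilon> \<in> {1, -1}" and U: "linear U" and V: "linear V"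
    and iso: "isotropic_pair U U" "isotropic_pair U V" "isotropic_pair V V"
  shows "conf_eigen (p + q) (\<lambda>u. U (stereo \<epsilon> u) ^ p * V (stereo \<epsilon> u) ^ q)"
  unfolding conf_eigen_def
proof (intro conjI allI)
  show "(\<lambda>u. U (stereo \<epsilon> u) ^ p * V (stereo \<epsilon> u) ^ q) \<in> stereo_rational"
    by (intro stereo_rational.mult stereo_rational_power stereo_rational_linear_stereo U V)
  fix u :: "real^3"
  define a b ad bd where "a u = U (stereo \<epsilon> u)" and "b u = V (stereo \<epsilon> u)"
    and "ad i u = U (stereo_d \<epsilon> i u)" and "bd i u = V (stereo_d \<epsilon> i u)" for i u
  define D where "D p q i u = of_nat p * a u ^ (p - 1) * b u ^ q * ad i u + of_nat q * a u ^ p * b u ^ (q - 1) * bd i u"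
    for p q i u
  let ?n = "complex_of_real (conf u)"
  have D: "((\<lambda>t. a (u + t *\<^sub>R axis i 1) ^ p * b (u + t *\<^sub>R axis i 1) ^ q) has_vector_derivative D p q i u) (at 0)" for p q i u
    using has_vector_derivative_power_prod[OF stereo_form_derivative[OF U, of \<epsilon> u i] stereo_form_derivative[OF V, of \<epsilon> u i], of p q]
    by (simp add: D_def a_def b_def ad_def bd_def)
  then have part: "partial (axis i 1) (\<lambda>u. a u ^ p * b u ^ q) = D p q i" for i
    by (intro partial_eqI)
  have part2: "partial (axis i 1) (\<lambda>v. of_real (conf v) * D p q i v) u
     = of_nat p * (a u ^ (p - 1) * b u ^ q * weighted_gradient_d U \<epsilon> i u + D (p - 1) q i u * (?n * ad i u))
       + of_nat q * (a u ^ p * b u ^ (q - 1) * weighted_gradient_d V \<epsilon> i u + D p (q - 1) i u * (?n * bd i u))" for i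
  proof -
    \<comment> \<open>The terms with \<open>0 *\<^sub>R axis i 1\<close> are left as the product
      rule at t = 0 produces them, so that the introduction rules apply by unification.\<close>
    have "((\<lambda>t. of_nat p * (a (u + t *\<^sub>R axis i 1) ^ (p - 1) * b (u + t *\<^sub>R axis i 1) ^ q
          * (of_real (conf (u + t *\<^sub>R axis i 1)) * ad i (u + t *\<^sub>R axis i 1)))
        + of_nat q * (a (u + t *\<^sub>R axis i 1) ^ p * b (u + t *\<^sub>R axis i 1) ^ (q - 1)
          * (of_real (conf (u + t *\<^sub>R axis i 1)) * bd i (u + t *\<^sub>R axis i 1))))
      has_vector_derivative
        of_nat p * (a (u + 0 *\<^sub>R axis i 1) ^ (p - 1) * b (u + 0 *\<^sub>R axis i 1) ^ q * weighted_gradient_d U \<epsilon> i u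
           + D (p - 1) q i u * (of_real (conf (u + 0 *\<^sub>R axis i 1)) * ad i (u + 0 *\<^sub>R axis i 1)))
        + of_nat q * (a (u + 0 *\<^sub>R axis i 1) ^ p * b (u + 0 *\<^sub>R axis i 1) ^ (q - 1) * weighted_gradient_d V \<epsilon> i u
           + D p (q - 1) i u * (of_real (conf (u + 0 *\<^sub>R axis i 1)) * bd i (u + 0 *\<^sub>R axis i 1)))) (at 0)"
      unfolding ad_def bd_def
      by (intro has_vector_derivative_add has_vector_derivative_mult_right has_vector_derivative_mult
          D weighted_gradient_derivative U V)
    moreover have "of_real (conf v) * D p q i v = of_nat p * (a v ^ (p - 1) * b v ^ q * (of_real (conf v) * ad i v))
        + of_nat q * (a v ^ p * b v ^ (q - 1) * (of_real (conf v) * bd i v))" for v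
      by (simp add: D_def algebra_simps)
    ultimately show ?thesis
      unfolding partial_def by (intro vector_derivative_at) simp
  qed
  \<comment> \<open>\<open>e1\<close> and \<open>e2\<close> restore the full powers after one or two
    differentiations; the numerical factors make them true also when the exponents are truncated at
    m = 0 or m = 1.\<close>
  have e1: "of_nat m * (z ^ (m - 1) * z) = of_nat m * z ^ m" for m and z :: complex
    by (cases m) (auto simp: mult.commute)
  have e2: "of_nat m * of_nat (m - 1) * (z ^ (m - 1 - 1) * (z * z)) = of_nat m * (of_nat m - 1) * z ^ m" for m and z :: complex
  proof (cases m)
    case (Suc j)
    then show ?thesis by (cases j) (auto simp: algebra_simps)
  qed simp
  note grad = gradient_product_stereo[OF \<epsilon> U U iso(1), of u] gradient_product_stereo[OF \<epsilon> U V iso(2), of u]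
      gradient_product_stereo[OF \<epsilon> V V iso(3), of u]
  note grad = grad[folded a_def b_def ad_def bd_def]
  note div = weighted_gradient_divergence[OF U, of \<epsilon> u, folded a_def] weighted_gradient_divergence[OF V, of \<epsilon> u, folded b_def]
  define A B where "A = a u" and "B = b u"
  have "conf_laplacian (\<lambda>u. a u ^ p * b u ^ q) u
    = of_nat p * A ^ (p - 1) * B ^ q * (\<Sum>i\<in>UNIV. weighted_gradient_d U \<epsilon> i u)
      + of_nat q * A ^ p * B ^ (q - 1) * (\<Sum>i\<in>UNIV. weighted_gradient_d V \<epsilon> i u)
      + of_nat p * of_nat (p - 1) * A ^ (p - 1 - 1) * B ^ q * ?n * (\<Sum>i\<in>UNIV. ad i u * ad i u)
      + 2 * (of_nat p * of_nat q * A ^ (p - 1) * B ^ (q - 1) * ?n) * (\<Sum>i\<in>UNIV. ad i u * bd i u)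
      + of_nat q * of_nat (q - 1) * A ^ p * B ^ (q - 1 - 1) * ?n * (\<Sum>i\<in>UNIV. bd i u * bd i u)"
    unfolding conf_laplacian_def part part2 sum_distrib_left sum.distrib[symmetric]
    by (intro sum.cong) (simp_all add: D_def A_def B_def algebra_simps)
  also have "\<dots> = - 12 * ?n ^ 3 * (of_nat p * (A ^ (p - 1) * A) * B ^ q + A ^ p * (of_nat q * (B ^ (q - 1) * B)))
      - 4 * ?n ^ 3 * ((of_nat p * of_nat (p - 1) * (A ^ (p - 1 - 1) * (A * A))) * B ^ q
        + 2 * (of_nat p * (A ^ (p - 1) * A)) * (of_nat q * (B ^ (q - 1) * B))
        + A ^ p * (of_nat q * of_nat (q - 1) * (B ^ (q - 1 - 1) * (B * B))))"
    unfolding grad div A_def[symmetric] B_def[symmetric] by (simp add: algebra_simps power3_eq_cube)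
  also have "\<dots> = - of_real (4 * conf u ^ 3 * (real (p + q) * (real (p + q) + 2))) * (A ^ p * B ^ q)"
    unfolding e1 e2 by (simp add: algebra_simps)
  finally show "conf_laplacian (\<lambda>u. U (stereo \<epsilon> u) ^ p * V (stereo \<epsilon> u) ^ q) u
      = - of_real (4 * conf u ^ 3 * (real (p + q) * (real (p + q) + 2))) * (U (stereo \<epsilon> u) ^ p * V (stereo \<epsilon> u) ^ q)"
    unfolding A_def B_def a_def b_def .
qed

lemma conf_eigen_wig_kernel:
  assumes "\<epsilon> \<in> {1, -1}"
  shows "conf_eigen (p + q) (\<lambda>u. wig_kernel p q z0 z1 (stereo \<epsilon> u))"
  unfolding wig_kernel_def
  by (rule conf_eigen_isotropic[OF assms linear_wig_forms])
     (simp_all add: isotropic_pair_def sum_3 pole_def axis_def algebra_simps)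

lemma conf_eigen_wig_combination:
  assumes "\<epsilon> \<in> {1, -1}"
  shows "conf_eigen (p + q) (\<lambda>u. \<Sum>j\<in>J. c j * wig_kernel p q (z0 j) (z1 j) (stereo \<epsilon> u))"
proof (induction J rule: infinite_finite_induct)
  case (insert j J)
  then show ?case
    using conf_eigen_lincomb[OF conf_eigen_wig_kernel[OF assms] insert.IH] by simp
qed (simp_all add: conf_eigen_def conf_laplacian_def partial_def stereo_rational.const)

lemma laplace_beltrami_eigenfunction_wig_combination:
  assumes "\<And>x. F (su2_of_vec x) = (\<Sum>j\<in>J. c j * wig_kernel p q (z0 j) (z1 j) x)"
  shows "laplace_beltrami_eigenfunction (- (real (p + q) / 2) * (real (p + q) / 2 + 1)) F"
  unfolding laplace_beltrami_eigenfunction_def Let_def assms smooth_def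
proof (intro ballI conjI allI)
  fix \<epsilon> :: real assume \<epsilon>: "\<epsilon> \<in> {1, -1}"
  show "times_cont_diff k (\<lambda>u. \<Sum>j\<in>J. c j * wig_kernel p q (z0 j) (z1 j) (stereo \<epsilon> u))" for k
    using conf_eigen_wig_combination[OF \<epsilon>] stereo_rational_times_cont_diff unfolding conf_eigen_def by blast
  show "laplace_beltrami_coord (\<lambda>v. 2 *\<^sub>R stereo \<epsilon> v) (\<lambda>u. \<Sum>j\<in>J. c j * wig_kernel p q (z0 j) (z1 j) (stereo \<epsilon> u)) u
     = (- (real (p + q) / 2) * (real (p + q) / 2 + 1)) *\<^sub>R (\<Sum>j\<in>J. c j * wig_kernel p q (z0 j) (z1 j) (stereo \<epsilon> u))" for u
    by (rule conf_eigen_imp_laplace_beltrami[OF \<epsilon> conf_eigen_wig_combination[OF \<epsilon>]])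
qed

section \<open>Best approximation by orthogonal expansions\<close>

lemma borel_measurable_cnj [measurable (raw)]:
  assumes "f \<in> borel_measurable M"
  shows "(\<lambda>x. cnj (f x)) \<in> borel_measurable M"
  by (rule borel_measurable_continuous_on[OF _ assms]) (intro continuous_intros)

lemma square_integrable_mult:
  assumes "square_integrable M f" "square_integrable M g"
  shows "integrable M (\<lambda>x. f x * cnj (g x))"
proof (rule Bochner_Integration.integrable_bound)
  show "integrable M (\<lambda>x. (cmod (f x))\<^sup>2 + (cmod (g x))\<^sup>2)"
    using assms by (auto simp: square_integrable_def)
  have [measurable]: "f \<in> borel_measurable M" "g \<in> borel_measurable M"
    using assms by (auto simp: square_integrable_def)
  show "(\<lambda>x. f x * cnj (g x)) \<in> borel_measurable M"
    by measurable
  show "AE x in M. norm (f x * cnj (g x)) \<le> norm ((cmod (f x))\<^sup>2 + (cmod (g x))\<^sup>2)"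
  proof (rule AE_I2)
    fix x
    have "2 * (cmod (f x) * cmod (g x)) \<le> (cmod (f x))\<^sup>2 + (cmod (g x))\<^sup>2"
      using sum_squares_bound[of "cmod (f x)" "cmod (g x)"] by (simp add: mult.assoc)
    moreover have "0 \<le> cmod (f x) * cmod (g x)" by simp
    ultimately have "cmod (f x) * cmod (g x) \<le> (cmod (f x))\<^sup>2 + (cmod (g x))\<^sup>2" by linarith
    then show "norm (f x * cnj (g x)) \<le> norm ((cmod (f x))\<^sup>2 + (cmod (g x))\<^sup>2)"
      by (simp add: norm_mult)
  qed
qed

lemma square_integrable_iff:
  "square_integrable M f \<longleftrightarrow> f \<in> borel_measurable M \<and> integrable M (\<lambda>x. f x * cnj (f x))"
proof -
  have "integrable M (\<lambda>x. f x * cnj (f x)) \<longleftrightarrow> integrable M (\<lambda>x. complex_of_real ((cmod (f x))\<^sup>2))"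
    unfolding complex_norm_square ..
  then show ?thesis
    unfolding square_integrable_def complex_of_real_integrable_eq by blast
qed

lemma square_integrable_cmult:
  assumes "square_integrable M f"
  shows "square_integrable M (\<lambda>x. c * f x)"
  using assms unfolding square_integrable_def by (auto simp: norm_mult power_mult_distrib)

lemma square_integrable_add:
  assumes f: "square_integrable M f" and g: "square_integrable M g"
  shows "square_integrable M (\<lambda>x. f x + g x)"
  unfolding square_integrable_iff
proof
  show "(\<lambda>x. f x + g x) \<in> borel_measurable M" using assms by (auto simp: square_integrable_def)
  have "integrable M (\<lambda>x. f x * cnj (f x) + f x * cnj (g x) + (g x * cnj (f x) + g x * cnj (g x)))"
    by (intro Bochner_Integration.integrable_add square_integrable_mult assms)
  then show "integrable M (\<lambda>x. (f x + g x) * cnj (f x + g x))"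
    by (simp add: algebra_simps)
qed

lemma square_integrable_sum:
  "(\<And>i. i \<in> I \<Longrightarrow> square_integrable M (f i)) \<Longrightarrow> square_integrable M (\<lambda>x. \<Sum>i\<in>I. f i x)"
proof (induction I rule: infinite_finite_induct)
  case (insert i I)
  then show ?case using square_integrable_add[of M "f i" "\<lambda>x. \<Sum>i\<in>I. f i x"] by simp
qed (simp_all add: square_integrable_def)

text \<open>Pythagoras: h is the residual of the better approximation a, and d = a - b is orthogonal
  to it.\<close>

lemma L2_dist2_le_orthogonal:
  assumes h: "square_integrable M h" and d: "square_integrable M d" and orth: "(\<integral>x. h x * cnj (d x) \<partial>M) = 0"
    and f: "\<And>x. f x - a x = h x" "\<And>x. f x - b x = h x + d x"
  shows "L2_dist2 M f a \<le> L2_dist2 M f b"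
proof -
  have i: "integrable M (\<lambda>x. h x * cnj (d x))" by (rule square_integrable_mult[OF h d])
  have re: "integrable M (\<lambda>x. Re (h x * cnj (d x)))" "(\<integral>x. Re (h x * cnj (d x)) \<partial>M) = 0"
    using integrable_Re[OF i] integral_Re[OF i] unfolding orth by (simp_all only: zero_complex.simps)
  have sq: "integrable M (\<lambda>x. (cmod (h x))\<^sup>2)" "integrable M (\<lambda>x. (cmod (d x))\<^sup>2)"
    "integrable M (\<lambda>x. (cmod (h x + d x))\<^sup>2)"
    using h d square_integrable_add[OF h d] by (auto simp: square_integrable_def)
  have "(cmod (z + w))\<^sup>2 = (cmod z)\<^sup>2 + 2 * Re (z * cnj w) + (cmod w)\<^sup>2" for z w
    unfolding cmod_power2 by (simp add: power2_eq_square algebra_simps)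
  then have "(\<integral>x. (cmod (h x + d x))\<^sup>2 \<partial>M)
    = (\<integral>x. (cmod (h x))\<^sup>2 + 2 * Re (h x * cnj (d x)) + (cmod (d x))\<^sup>2 \<partial>M)" by simp
  also have "\<dots> = (\<integral>x. (cmod (h x))\<^sup>2 + 2 * Re (h x * cnj (d x)) \<partial>M) + (\<integral>x. (cmod (d x))\<^sup>2 \<partial>M)"
    by (intro Bochner_Integration.integral_add Bochner_Integration.integrable_add integrable_mult_right sq re)
  also have "(\<integral>x. (cmod (h x))\<^sup>2 + 2 * Re (h x * cnj (d x)) \<partial>M)
      = (\<integral>x. (cmod (h x))\<^sup>2 \<partial>M) + (\<integral>x. 2 * Re (h x * cnj (d x)) \<partial>M)"
    by (intro Bochner_Integration.integral_add integrable_mult_right sq re)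
  also have "(\<integral>x. 2 * Re (h x * cnj (d x)) \<partial>M) = 0"
    using re(2) by (simp only: integral_mult_right_zero mult_zero_right)
  finally have "(\<integral>x. (cmod (h x + d x))\<^sup>2 \<partial>M) = (\<integral>x. (cmod (h x))\<^sup>2 \<partial>M) + (\<integral>x. (cmod (d x))\<^sup>2 \<partial>M)"
    by simp
  moreover have "0 \<le> (\<integral>x. (cmod (d x))\<^sup>2 \<partial>M)" by simp
  ultimately have "(\<integral>x. (cmod (h x))\<^sup>2 \<partial>M) \<le> (\<integral>x. (cmod (h x + d x))\<^sup>2 \<partial>M)" by linarith
  then show ?thesis
    unfolding L2_dist2_def f using sq by (simp add: nn_integral_eq_integral ennreal_leI)
qed

text \<open>A function of norm 0 vanishes almost everywhere, so a Fourier coefficient with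
  denominator 0 also has numerator 0.\<close>

lemma integral_mult_cnj_eq_0:
  assumes f: "square_integrable M f" and g: "square_integrable M g" and g0: "(\<integral>x. g x * cnj (g x) \<partial>M) = 0"
  shows "(\<integral>x. f x * cnj (g x) \<partial>M) = 0"
proof -
  have "(\<integral>x. g x * cnj (g x) \<partial>M) = of_real (\<integral>x. (cmod (g x))\<^sup>2 \<partial>M)"
    unfolding complex_norm_square[symmetric] by (rule integral_complex_of_real)
  then have "(\<integral>x. (cmod (g x))\<^sup>2 \<partial>M) = 0" using g0 by simp
  then have "AE x in M. (cmod (g x))\<^sup>2 = 0"
    using g by (subst (asm) integral_nonneg_eq_0_iff_AE) (auto simp: square_integrable_def)
  then have "AE x in M. f x * cnj (g x) = 0" by eventually_elim simp
  moreover have "(\<lambda>x. f x * cnj (g x)) \<in> borel_measurable M"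
    by (rule borel_measurable_integrable[OF square_integrable_mult[OF f g]])
  ultimately have "(\<integral>x. f x * cnj (g x) \<partial>M) = (\<integral>x. 0 \<partial>M)" by (intro integral_cong_AE) auto
  then show ?thesis by simp
qed

text \<open>If some \<open>\<phi> i\<close> vanishes almost everywhere, its coefficient is \<open>0 / 0 = 0\<close>.\<close>

lemma fourier_best_approximation:
  assumes f: "square_integrable M f" and fin: "finite I"
    and \<phi>: "\<And>i. i \<in> I \<Longrightarrow> square_integrable M (\<phi> i)"
    and orth: "\<And>i j. i \<in> I \<Longrightarrow> j \<in> I \<Longrightarrow> i \<noteq> j \<Longrightarrow> (\<integral>x. \<phi> i x * cnj (\<phi> j x) \<partial>M) = 0"
    and a: "\<And>i. i \<in> I \<Longrightarrow> a i = (\<integral>x. f x * cnj (\<phi> i x) \<partial>M) / (\<integral>x. \<phi> i x * cnj (\<phi> i x) \<partial>M)"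
  shows "L2_dist2 M f (\<lambda>x. \<Sum>i\<in>I. a i * \<phi> i x) \<le> L2_dist2 M f (\<lambda>x. \<Sum>i\<in>I. c i * \<phi> i x)"
proof (rule L2_dist2_le_orthogonal)
  let ?S = "\<lambda>c x. \<Sum>i\<in>I. c i * \<phi> i x"
  let ?h = "\<lambda>x. f x + (-1) * ?S a x"
  have S: "square_integrable M (?S c)" for c by (intro square_integrable_sum square_integrable_cmult \<phi>)
  show h: "square_integrable M ?h" by (intro square_integrable_add f square_integrable_cmult S)
  show "square_integrable M (?S (\<lambda>i. a i - c i))" by (rule S)
  have hj: "(\<integral>x. ?h x * cnj (\<phi> j x) \<partial>M) = 0" if j: "j \<in> I" for j
  proof -
    have "(\<integral>x. ?h x * cnj (\<phi> j x) \<partial>M)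
      = (\<integral>x. f x * cnj (\<phi> j x) - (\<Sum>i\<in>I. a i * (\<phi> i x * cnj (\<phi> j x))) \<partial>M)"
      by (intro Bochner_Integration.integral_cong) (auto simp: algebra_simps sum_distrib_left sum_negf)
    also have "\<dots> = (\<integral>x. f x * cnj (\<phi> j x) \<partial>M) - (\<Sum>i\<in>I. a i * (\<integral>x. \<phi> i x * cnj (\<phi> j x) \<partial>M))"
    proof -
      have int: "integrable M (\<lambda>x. a i * (\<phi> i x * cnj (\<phi> j x)))" if "i \<in> I" for i
        by (intro integrable_mult_right square_integrable_mult \<phi> that j)
      then have "(\<integral>x. (\<Sum>i\<in>I. a i * (\<phi> i x * cnj (\<phi> j x))) \<partial>M) = (\<Sum>i\<in>I. a i * (\<integral>x. \<phi> i x * cnj (\<phi> j x) \<partial>M))"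
        by (subst Bochner_Integration.integral_sum) (simp_all only: integral_mult_right_zero)
      then show ?thesis
        using int by (subst Bochner_Integration.integral_diff)
          (simp_all add: square_integrable_mult f \<phi> j Bochner_Integration.integrable_sum)
    qed
    also have "(\<Sum>i\<in>I. a i * (\<integral>x. \<phi> i x * cnj (\<phi> j x) \<partial>M)) = (\<Sum>i\<in>I. if i = j then a j * (\<integral>x. \<phi> j x * cnj (\<phi> j x) \<partial>M) else 0)"
      using j orth by (intro sum.cong) auto
    also have "\<dots> = a j * (\<integral>x. \<phi> j x * cnj (\<phi> j x) \<partial>M)"
      using j fin by simp
    also have "\<dots> = (\<integral>x. f x * cnj (\<phi> j x) \<partial>M)"
      using a[OF j] integral_mult_cnj_eq_0[OF f \<phi>[OF j]] by auto
    finally show ?thesis by simp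
  qed
  have "(\<integral>x. ?h x * cnj (?S (\<lambda>i. a i - c i) x) \<partial>M)
      = (\<integral>x. (\<Sum>i\<in>I. cnj (a i - c i) * (?h x * cnj (\<phi> i x))) \<partial>M)"
    by (intro Bochner_Integration.integral_cong) (auto simp: sum_distrib_left mult_ac)
  also have "\<dots> = (\<Sum>i\<in>I. cnj (a i - c i) * (\<integral>x. ?h x * cnj (\<phi> i x) \<partial>M))"
    using square_integrable_mult[OF h \<phi>] by (subst Bochner_Integration.integral_sum) auto
  also have "\<dots> = 0" using hj by simp
  finally show "(\<integral>x. ?h x * cnj (?S (\<lambda>i. a i - c i) x) \<partial>M) = 0" .
  show "f x - ?S a x = ?h x" for x by simp
  show "f x - ?S c x = ?h x + ?S (\<lambda>i. a i - c i) x" for x by (simp add: sum_subtractf algebra_simps)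
qed

section \<open>The decomposition\<close>

text \<open>The normalized Wigner function with half-integers replaced by n = 2 l, p = l + s, k = l
  + m; the row index m corresponds to k and the spin s to p.\<close>

definition wig_fun :: "nat \<Rightarrow> nat \<Rightarrow> nat \<Rightarrow> complex^2^2 \<Rightarrow> complex" where
  "wig_fun n p k = wigner_phi (real n / 2) (real k - real n / 2) (real p - real n / 2)"

text \<open>The normalization sqrt (2 l + 1) / (4 pi) times the binomial quotient from
  \<open>wigner_D_half\<close>. Being nonzero, it can be divided out when an approximant is
  rewritten in terms of \<open>wig_fun\<close>.\<close>

definition wig_const :: "nat \<Rightarrow> nat \<Rightarrow> nat \<Rightarrow> real" where
  "wig_const n p k = sqrt (real n + 1) / (4 * pi) * (sqrt (real (n choose p)) / sqrt (real (n choose k)))"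

lemma wig_fun_eq:
  assumes "p \<le> n" "k \<le> n"
  shows "wig_fun n p k g = of_real (wig_const n p k) * coeff (wig_poly p (n - p) (column 1 g)) k"
  unfolding wig_fun_def wigner_phi_def wigner_D_half[OF assms] wig_const_def by simp

lemma wig_const_nonzero: "p \<le> n \<Longrightarrow> k \<le> n \<Longrightarrow> wig_const n p k \<noteq> 0"
  by (simp add: wig_const_def)

lemma square_integrable_su2_vol_continuous:
  fixes f :: "complex^2 \<Rightarrow> complex"
  assumes "continuous_on UNIV f"
  shows "square_integrable su2_vol (\<lambda>g. f (column 1 g))"
  unfolding square_integrable_def
proof
  show "(\<lambda>g. f (column 1 g)) \<in> borel_measurable su2_vol"
    by (rule borel_measurable_integrable[OF integrable_su2_vol_continuous[OF assms]])
  show "integrable su2_vol (\<lambda>g. (cmod (f (column 1 g)))\<^sup>2)"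
    by (rule integrable_su2_vol_continuous[of "\<lambda>x. (cmod (f x))\<^sup>2"]) (intro continuous_intros assms)
qed

lemma square_integrable_wig_fun:
  assumes "p \<le> n" "k \<le> n"
  shows "square_integrable su2_vol (wig_fun n p k)"
  using square_integrable_su2_vol_continuous[of "\<lambda>x. of_real (wig_const n p k) * coeff (wig_poly p (n - p) x) k"]
  unfolding wig_fun_eq[OF assms, abs_def] by (simp add: continuous_intros)

lemma wig_fun_orthogonal:
  assumes "(n, p, k) \<in> wig_idx A" "(n', p', k') \<in> wig_idx A" "(n, p, k) \<noteq> (n', p', k')"
  shows "(\<integral>g. wig_fun n p k g * cnj (wig_fun n' p' k' g) \<partial>su2_vol) = 0"
proof -
  have le: "p \<le> n" "k \<le> n" "p' \<le> n'" "k' \<le> n'" using assms by (auto simp: wig_idx_def)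
  have "(\<integral>g. wig_fun n p k g * cnj (wig_fun n' p' k' g) \<partial>su2_vol)
     = su2_inner (\<lambda>x. of_real (wig_const n p k) * coeff (wig_poly p (n - p) x) k)
         (\<lambda>x. of_real (wig_const n' p' k') * coeff (wig_poly p' (n' - p') x) k')"
    unfolding su2_inner_def wig_fun_eq[OF le(1,2)] wig_fun_eq[OF le(3,4)] ..
  then show ?thesis unfolding su2_inner_cmult wigner_orthogonal[OF assms] by simp
qed

text \<open>The quotient by the squared norm makes orthogonality alone sufficient for best
  approximation, whatever the length of the Wigner functions.\<close>

definition wig_fourier :: "(complex^2^2 \<Rightarrow> complex) \<Rightarrow> nat \<Rightarrow> nat \<Rightarrow> nat \<Rightarrow> complex" where
  "wig_fourier f n p k = (\<integral>g. f g * cnj (wig_fun n p k g) \<partial>su2_vol)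
     / (\<integral>g. wig_fun n p k g * cnj (wig_fun n p k g) \<partial>su2_vol)"

lemma wig_fourier_best_approximation:
  assumes f: "square_integrable su2_vol f" and A: "finite A"
  shows "L2_dist2 su2_vol f (\<lambda>g. \<Sum>(n, p, k)\<in>wig_idx A. wig_fourier f n p k * wig_fun n p k g)
       \<le> L2_dist2 su2_vol f (\<lambda>g. \<Sum>(n, p, k)\<in>wig_idx A. c n p k * wig_fun n p k g)"
proof -
  let ?\<phi> = "\<lambda>(n, p, k). wig_fun n p k"
  have "L2_dist2 su2_vol f (\<lambda>g. \<Sum>i\<in>wig_idx A. (case i of (n, p, k) \<Rightarrow> wig_fourier f n p k) * ?\<phi> i g)
       \<le> L2_dist2 su2_vol f (\<lambda>g. \<Sum>i\<in>wig_idx A. (case i of (n, p, k) \<Rightarrow> c n p k) * ?\<phi> i g)"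
  proof (rule fourier_best_approximation[OF f finite_wig_idx[OF A]])
    show "square_integrable su2_vol (?\<phi> i)" if "i \<in> wig_idx A" for i
      using that by (auto simp: wig_idx_def intro!: square_integrable_wig_fun)
    show "(\<integral>g. ?\<phi> i g * cnj (?\<phi> j g) \<partial>su2_vol) = 0" if "i \<in> wig_idx A" "j \<in> wig_idx A" "i \<noteq> j" for i j
      using that wig_fun_orthogonal by (cases i; cases j) auto
    show "(case i of (n, p, k) \<Rightarrow> wig_fourier f n p k)
       = (\<integral>g. f g * cnj (?\<phi> i g) \<partial>su2_vol) / (\<integral>g. ?\<phi> i g * cnj (?\<phi> i g) \<partial>su2_vol)" for i
      by (cases i) (simp add: wig_fourier_def)
  qed
  then show ?thesis by (simp add: case_prod_unfold)
qed

lemma wig_fourier_converges: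
  assumes f: "square_integrable su2_vol f"
  shows "((\<lambda>A. L2_dist2 su2_vol f (\<lambda>g. \<Sum>(n, p, k)\<in>wig_idx A. wig_fourier f n p k * wig_fun n p k g)) \<longlongrightarrow> 0)
     (finite_subsets_at_top UNIV)" (is "(?L \<longlongrightarrow> 0) _")
proof (rule order_tendstoI)
  fix r :: ennreal assume "0 < r"
  \<comment> \<open>If r is infinite, e = 1 serves.\<close>
  then obtain e where e: "e > 0" "ennreal e \<le> r"
    by (cases r) (auto simp: ennreal_less_zero_iff intro: that[of 1])
  obtain N c where c: "L2_dist2 su2_vol f
     (\<lambda>g. \<Sum>(n, p, k)\<in>wig_idx {..N}. c n p k * coeff (wig_poly p (n - p) (column 1 g)) k) < ennreal e"
    by (rule wigner_total[OF f e(1)])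
  have "?L A < r" if A: "finite A" "{..N} \<subseteq> A" for A
  proof -
    \<comment> \<open>The approximant of degree at most N, rescaled from coefficients of
      \<open>wig_poly\<close> to \<open>wig_fun\<close> and extended by 0 to the larger set A of
      degrees.\<close>
    let ?c = "\<lambda>n p k. if n \<le> N then c n p k / of_real (wig_const n p k) else 0"
    have eq: "(\<Sum>(n, p, k)\<in>wig_idx {..N}. c n p k * coeff (wig_poly p (n - p) (column 1 g)) k)
      = (\<Sum>(n, p, k)\<in>wig_idx A. ?c n p k * wig_fun n p k g)" for g
      by (rule sum.mono_neutral_cong_left)
         (use A in \<open>auto simp: finite_wig_idx\<close>, auto simp: wig_idx_def wig_fun_eq wig_const_nonzero)
    have "?L A \<le> L2_dist2 su2_vol f (\<lambda>g. \<Sum>(n, p, k)\<in>wig_idx A. ?c n p k * wig_fun n p k g)"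
      by (rule wig_fourier_best_approximation[OF f A(1)])
    also have "\<dots> < ennreal e" using c unfolding eq .
    finally show ?thesis using e(2) by simp
  qed
  then show "eventually (\<lambda>A. ?L A < r) (finite_subsets_at_top UNIV)"
    unfolding eventually_finite_subsets_at_top by (intro exI[of _ "{..N}"]) auto
qed simp

lemma sum_spins_half:
  "(\<Sum>m\<in>spins (real n / 2). f m) = (\<Sum>k\<le>n. f (real k - real n / 2))"
  unfolding spins_half by (subst sum.reindex) (auto simp: inj_on_def)

text \<open>For fixed spin the exponents p and n - p are common to all weights m, so the whole
  component is one finite sum of kernels. The indices are pairs of a weight k and the exponent j of
  a root of unity.\<close>

lemma spin_component_eq_kernels:
  assumes p: "p \<le> n"
  obtains J :: "(nat \<times> nat) set" and c z where
    "\<And>g. (\<Sum>k\<le>n. b k * wig_fun n p k g) = (\<Sum>j\<in>J. c j * wig_kernel p (n - p) (z j) 1 (column 1 g))"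
proof -
  have "\<exists>c z. \<forall>x. coeff (wig_poly p (n - p) x) k = (\<Sum>j<n + 1. c j * wig_kernel p (n - p) (z j) 1 x)" if "k \<le> n" for k
  proof -
    have "k \<le> p + (n - p)" using that p by simp
    then obtain c z where "\<And>x. coeff (wig_poly p (n - p) x) k = (\<Sum>j<p + (n - p) + 1. c j * wig_kernel p (n - p) (z j) 1 x)"
      by (rule wig_coeff_eq_kernels) (rule that)
    then show ?thesis using p by auto
  qed
  then obtain c z where cz: "\<And>k x. k \<le> n \<Longrightarrow>
      coeff (wig_poly p (n - p) x) k = (\<Sum>j<n + 1. c k j * wig_kernel p (n - p) (z k j) 1 x)"
    by metis
  show ?thesis
  proof (rule that)
    fix g
    have "(\<Sum>k\<le>n. b k * wig_fun n p k g)
      = (\<Sum>k\<le>n. \<Sum>j<n + 1. b k * of_real (wig_const n p k) * c k j * wig_kernel p (n - p) (z k j) 1 (column 1 g))"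
      using p by (intro sum.cong) (auto simp: wig_fun_eq cz sum_distrib_left distrib_left mult.assoc)
    also have "\<dots> = (\<Sum>(k, j)\<in>{..n} \<times> {..<n + 1}. b k * of_real (wig_const n p k) * c k j * wig_kernel p (n - p) (z k j) 1 (column 1 g))"
      by (rule sum.cartesian_product)
    finally show "(\<Sum>k\<le>n. b k * wig_fun n p k g)
      = (\<Sum>i\<in>{..n} \<times> {..<n + 1}. (b (fst i) * of_real (wig_const n p (fst i)) * c (fst i) (snd i))
          * wig_kernel p (n - p) (z (fst i) (snd i)) 1 (column 1 g))"
      by (simp add: case_prod_unfold)
  qed
qed

lemma spin_component_harmonic:
  assumes p: "p \<le> n"
  shows "\<exists>P. homogeneous_harmonic_poly n P \<and> (\<forall>g. (\<Sum>k\<le>n. b k * wig_fun n p k g) = P (column 1 g))"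
    and "laplace_beltrami_eigenfunction (- (real n / 2) * (real n / 2 + 1)) (\<lambda>g. \<Sum>k\<le>n. b k * wig_fun n p k g)"
proof -
  obtain J :: "(nat \<times> nat) set" and c z where
    eq: "\<And>g. (\<Sum>k\<le>n. b k * wig_fun n p k g) = (\<Sum>j\<in>J. c j * wig_kernel p (n - p) (z j) 1 (column 1 g))"
    by (rule spin_component_eq_kernels[OF p, of b]) (rule that)
  show "\<exists>P. homogeneous_harmonic_poly n P \<and> (\<forall>g. (\<Sum>k\<le>n. b k * wig_fun n p k g) = P (column 1 g))"
    using homogeneous_harmonic_poly_wig_combination[of p "n - p" c z "\<lambda>_. 1" J] p eq by auto
  show "laplace_beltrami_eigenfunction (- (real n / 2) * (real n / 2 + 1)) (\<lambda>g. \<Sum>k\<le>n. b k * wig_fun n p k g)"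
    using laplace_beltrami_eigenfunction_wig_combination[of "\<lambda>g. \<Sum>k\<le>n. b k * wig_fun n p k g" c p "n - p" z "\<lambda>_. 1" J] p
    by (simp add: eq)
qed

lemma spin_component_pullback:
  assumes p: "p \<le> n"
  defines "s \<equiv> real p - real n / 2"
  shows "\<exists>\<sigma>. spin_section s \<sigma> \<and> is_pullback s \<sigma> (\<lambda>g. \<Sum>k\<le>n. b k * wig_fun n p k g)"
proof -
  have "2 * s = of_int (2 * int p - int n)" by (simp add: s_def)
  then have "2 * s \<in> \<int>" by (metis Ints_of_int)
  moreover have "(\<Sum>k\<le>n. b k * wig_fun n p k (g ** su2_mat (cis (\<psi> / 2)) 0)) = (\<Sum>k\<le>n. b k * wig_fun n p k g) * cis (- s * \<psi>)"
    if g: "g \<in> SU2" for g \<psi>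
  proof -
    obtain a b where ab: "g = su2_mat a b" using g by (auto simp: SU2_def)
    have col: "column 1 (g ** su2_mat (cis (\<psi> / 2)) 0) = cis (\<psi> / 2) *s column 1 g"
      by (simp add: ab su2_mat_def matrix_matrix_mult_def column_def vec_eq_iff forall_2 sum_2 mult.commute)
    \<comment> \<open>The right weight n - 2 p = - 2 s meets the half angle \<psi> / 2, which gives
      the phase - s \<psi>.\<close>
    have "cis (\<psi> / 2) ^ (n - p) * cnj (cis (\<psi> / 2)) ^ p = cis (real (n - p) * (\<psi> / 2) - real p * (\<psi> / 2))"
      unfolding cis_cnj Complex.DeMoivre cis_mult by simp
    also have "real (n - p) * (\<psi> / 2) - real p * (\<psi> / 2) = - s * \<psi>"
      using p by (simp add: s_def of_nat_diff field_simps)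
    finally have w: "cis (\<psi> / 2) ^ (n - p) * cnj (cis (\<psi> / 2)) ^ p = cis (- s * \<psi>)" .
    have "wig_fun n p k (g ** su2_mat (cis (\<psi> / 2)) 0) = cis (- s * \<psi>) * wig_fun n p k g" if "k \<le> n" for k
      unfolding wig_fun_eq[OF p that] col wig_coeff_phase w by simp
    then show ?thesis by (simp add: sum_distrib_left mult_ac)
  qed
  ultimately show ?thesis by (simp only: pullback_iff_equivariant) blast
qed

theorem theorem3:
  fixes M :: "'w measure" and X :: "'w \<Rightarrow> complex^2^2 \<Rightarrow> complex"
  assumes "prob_space M"
    and "square_integrable_random_field M X"
  shows "\<exists>(a :: real \<Rightarrow> real \<Rightarrow> real \<Rightarrow> 'w \<Rightarrow> complex)
          (Y :: real \<Rightarrow> real \<Rightarrow> 'w \<Rightarrow> complex^2^2 \<Rightarrow> complex).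
      (\<forall>l\<in>half_nats. \<forall>m\<in>spins l. \<forall>s\<in>spins l. a l m s \<in> borel_measurable M) \<and>
      (\<forall>l\<in>half_nats. \<forall>s\<in>spins l.
         square_integrable_random_field M (Y l s) \<and>
         (\<forall>\<omega>\<in>space M. \<forall>g\<in>SU2.
            Y l s \<omega> g = (\<Sum>m\<in>spins l. a l m s \<omega> * wigner_phi l m s g))) \<and>
      (AE \<omega> in M.
         ((\<lambda>\<Lambda>. L2_dist2 su2_vol (X \<omega>) (\<lambda>g. \<Sum>l\<in>\<Lambda>. \<Sum>s\<in>spins l. Y l s \<omega> g)) \<longlongrightarrow> 0)
           (finite_subsets_at_top half_nats)) \<and>
      (\<forall>l\<in>half_nats. \<forall>s\<in>spins l. \<forall>\<omega>\<in>space M.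
         (\<exists>p :: complex^2 \<Rightarrow> complex. homogeneous_harmonic_poly (nat \<lfloor>2 * l\<rfloor>) p \<and>
            (\<forall>g\<in>SU2. Y l s \<omega> g = p (column 1 g))) \<and>
         laplace_beltrami_eigenfunction (- l * (l + 1)) (Y l s \<omega>) \<and>
         (\<exists>\<sigma>. spin_section s \<sigma> \<and> is_pullback s \<sigma> (Y l s \<omega>)))"
proof -
  \<comment> \<open>The Bochner integral takes the value 0 on functions that are not integrable, so
    \<open>a\<close> and \<open>Y\<close> are defined for every \<omega>. Harmonicity and the
    pull-back property then hold everywhere, and only convergence excludes the null set where X
    \<omega> is not square integrable.\<close>
  define a where "a l m s \<omega> = (\<integral>g. X \<omega> g * cnj (wigner_phi l m s g) \<partial>su2_vol)
     / (\<integral>g. wigner_phi l m s g * cnj (wigner_phi l m s g) \<partial>su2_vol)" for l m s \<omega>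
  define Y where "Y l s \<omega> g = (\<Sum>m\<in>spins l. a l m s \<omega> * wigner_phi l m s g)" for l s \<omega> g
  have a_eq: "a (real n / 2) (real k - real n / 2) (real p - real n / 2) \<omega> = wig_fourier (X \<omega>) n p k" for n p k \<omega>
    unfolding a_def wig_fourier_def wig_fun_def ..
  have Y_eq: "Y (real n / 2) (real p - real n / 2) \<omega> = (\<lambda>g. \<Sum>k\<le>n. wig_fourier (X \<omega>) n p k * wig_fun n p k g)" for n p \<omega>
    unfolding Y_def sum_spins_half a_eq wig_fun_def ..
  have X[measurable]: "(\<lambda>(\<omega>, g). X \<omega> g) \<in> borel_measurable (M \<Otimes>\<^sub>M su2_vol)"
    and X2: "AE \<omega> in M. square_integrable su2_vol (X \<omega>)"
    using assms(2) by (auto simp: square_integrable_random_field_def)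
  interpret finite_measure su2_vol by (rule finite_measure_su2_vol)
  have fun_meas: "wig_fun n p k \<in> borel_measurable su2_vol" if "p \<le> n" "k \<le> n" for n p k
    using square_integrable_wig_fun[OF that] by (simp add: square_integrable_def)
  have a_meas: "(\<lambda>\<omega>. wig_fourier (X \<omega>) n p k) \<in> borel_measurable M" if "p \<le> n" "k \<le> n" for n p k
  proof -
    note [measurable] = fun_meas[OF that]
    have "(\<lambda>(\<omega>, g). X \<omega> g * cnj (wig_fun n p k g)) \<in> borel_measurable (M \<Otimes>\<^sub>M su2_vol)"
      by measurable
    then have "(\<lambda>\<omega>. \<integral>g. X \<omega> g * cnj (wig_fun n p k g) \<partial>su2_vol) \<in> borel_measurable M"
      by (rule borel_measurable_lebesgue_integral)
    then show ?thesis unfolding wig_fourier_def by measurable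
  qed
  have Y_field: "square_integrable_random_field M (Y (real n / 2) (real p - real n / 2))" if p: "p \<le> n" for n p
    unfolding square_integrable_random_field_def
  proof
    have "(\<lambda>x. \<Sum>k\<le>n. wig_fourier (X (fst x)) n p k * wig_fun n p k (snd x)) \<in> borel_measurable (M \<Otimes>\<^sub>M su2_vol)"
      using p by (intro borel_measurable_sum borel_measurable_times measurable_compose[OF measurable_fst a_meas]
          measurable_compose[OF measurable_snd fun_meas]) auto
    then show "(\<lambda>(\<omega>, g). Y (real n / 2) (real p - real n / 2) \<omega> g) \<in> borel_measurable (M \<Otimes>\<^sub>M su2_vol)"
      unfolding Y_eq case_prod_unfold .
    show "AE \<omega> in M. square_integrable su2_vol (Y (real n / 2) (real p - real n / 2) \<omega>)"
      unfolding Y_eq using p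
      by (intro AE_I2 square_integrable_sum square_integrable_cmult square_integrable_wig_fun) auto
  qed
  have conv: "((\<lambda>\<Lambda>. L2_dist2 su2_vol (X \<omega>) (\<lambda>g. \<Sum>l\<in>\<Lambda>. \<Sum>s\<in>spins l. Y l s \<omega> g)) \<longlongrightarrow> 0)
           (finite_subsets_at_top half_nats)" if "square_integrable su2_vol (X \<omega>)" for \<omega>
  proof -
    let ?h = "\<lambda>n::nat. real n / 2"
    have inj: "inj_on ?h B" for B by (auto simp: inj_on_def)
    have eq: "(\<Sum>l\<in>?h ` A. \<Sum>s\<in>spins l. Y l s \<omega> g)
      = (\<Sum>(n, p, k)\<in>wig_idx A. wig_fourier (X \<omega>) n p k * wig_fun n p k g)" if "finite A" for A g
    proof -
      have "(\<Sum>l\<in>?h ` A. \<Sum>s\<in>spins l. Y l s \<omega> g) = (\<Sum>n\<in>A. \<Sum>p\<le>n. \<Sum>k\<le>n. wig_fourier (X \<omega>) n p k * wig_fun n p k g)"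
        by (subst sum.reindex[OF inj]) (simp add: sum_spins_half Y_eq)
      also have "\<dots> = (\<Sum>n\<in>A. \<Sum>(p, k)\<in>{..n} \<times> {..n}. wig_fourier (X \<omega>) n p k * wig_fun n p k g)"
        by (simp add: sum.cartesian_product)
      also have "\<dots> = (\<Sum>(n, p, k)\<in>wig_idx A. wig_fourier (X \<omega>) n p k * wig_fun n p k g)"
        unfolding wig_idx_def using that by (subst sum.Sigma) (auto simp: case_prod_unfold)
      finally show ?thesis .
    qed
    \<comment> \<open>The injection n to n / 2 carries the net of finite sets of degrees onto that
      of finite sets of spins l, so the unconditional convergence in n is transferred.\<close>
    have "finite_subsets_at_top half_nats = filtermap ((`) ?h) (finite_subsets_at_top UNIV)"
      unfolding half_nats_def by (rule filtermap_image_finite_subsets_at_top[OF inj, symmetric])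
    moreover have "((\<lambda>A. L2_dist2 su2_vol (X \<omega>) (\<lambda>g. \<Sum>l\<in>?h ` A. \<Sum>s\<in>spins l. Y l s \<omega> g)) \<longlongrightarrow> 0)
           (finite_subsets_at_top UNIV)"
      by (rule Lim_transform_eventually[OF wig_fourier_converges[OF that]])
         (auto simp: eq intro!: eventually_finite_subsets_at_top_weakI)
    ultimately show ?thesis by (simp add: filterlim_filtermap)
  qed
  show ?thesis
  proof (intro exI[of _ a] exI[of _ Y] conjI ballI)
    fix l m s assume "l \<in> half_nats" "m \<in> spins l" "s \<in> spins l"
    then obtain n p k where npk: "l = real n / 2" "s = real p - real n / 2" "m = real k - real n / 2" "p \<le> n" "k \<le> n"
      by (auto simp: half_nats_def spins_half)
    have "a l m s = (\<lambda>\<omega>. wig_fourier (X \<omega>) n p k)"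
      unfolding npk(1-3) by (rule ext) (rule a_eq)
    with a_meas[OF npk(4,5)] show "a l m s \<in> borel_measurable M" by simp
  next
    show "AE \<omega> in M. ((\<lambda>\<Lambda>. L2_dist2 su2_vol (X \<omega>) (\<lambda>g. \<Sum>l\<in>\<Lambda>. \<Sum>s\<in>spins l. Y l s \<omega> g)) \<longlongrightarrow> 0)
           (finite_subsets_at_top half_nats)"
      using X2 by eventually_elim (rule conv)
  next
    fix l s assume "l \<in> half_nats" "s \<in> spins l"
    then obtain n p where np: "l = real n / 2" "s = real p - real n / 2" "p \<le> n"
      by (auto simp: half_nats_def spins_half)
    show "square_integrable_random_field M (Y l s)"
      unfolding np(1,2) by (rule Y_field) (rule np)
    show "Y l s \<omega> g = (\<Sum>m\<in>spins l. a l m s \<omega> * wigner_phi l m s g)" for \<omega> g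
      by (rule Y_def)
    show "\<exists>p. homogeneous_harmonic_poly (nat \<lfloor>2 * l\<rfloor>) p \<and> (\<forall>g\<in>SU2. Y l s \<omega> g = p (column 1 g))" for \<omega>
      using spin_component_harmonic(1)[OF np(3), of "wig_fourier (X \<omega>) n p"] unfolding np(1,2) Y_eq by auto
    show "laplace_beltrami_eigenfunction (- l * (l + 1)) (Y l s \<omega>)" for \<omega>
      unfolding np(1,2) Y_eq by (rule spin_component_harmonic(2)) (rule np)
    show "\<exists>\<sigma>. spin_section s \<sigma> \<and> is_pullback s \<sigma> (Y l s \<omega>)" for \<omega>
      unfolding np(1,2) Y_eq by (rule spin_component_pullback) (rule np)
  qed
qed

end
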